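(* Let $(TM,C,\mathcal U,g,\kappa,h,D,\mathcal Q)$ be a CV-structure on the holomorphic tangent bundle $K=TM$ of a complex manifold $M$, with the unfolding condition, and let $\circ$ be the multiplication on $TM$ and $e,E$ the holomorphic vector fields with $C_X(Y)=-X\circ Y$, $C_e=-\mathrm{id}$, $C_E=-\mathcal U$. (a) $(M,\circ,e,E)$ is an $F$-manifold with Euler field $E$. (b) The operator $\mathcal Q$ is given by $$\mathcal Q=(D_E-L_E)^{skew},$$ where "skew" denotes the $g$-skew-symmetric part, and it satisfies $L_{\bar e}(\mathcal Q)=D_{\bar e}(\mathcal Q)=D_e(\mathcal Q)=0$. (c) The following statements are equivalent: $D_e-L_e=0$ on $C^\infty$ tensors; $D_e e=0$; $L_e(h)=0$; $L_{\bar e}(h)=0$; $L_e(\kappa)=0$; $L_{\bar e}(\kappa)=0$; $L_e(g)=0$. If these statements hold, then also $L_e(\mathcal Q)=0$. (d) Fix $d\in\mathbb R$. If $L_E(g)=(2-d)g$, then $$\mathcal Q=D_E-L_E-\frac{2-d}{2}\,\mathrm{id},\qquad L_{E-\bar E}(h)=0,$$ $$L_E(\mathcal Q)=L_{\bar E}(\mathcal Q)=D_E(\mathcal Q)=D_{\bar E}(\mathcal Q)=[\mathcal U,\kappa\,\mathcal U\kappa].$$ In particular, the tensors $h$ and $\mathcal Q$ are invariant under the flow of $E-\bar E$.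
   Context: $\mathcal T_M$ is the sheaf of holomorphic vector fields, $\mathcal O(K)$ the sheaf of holomorphic sections of $K$. **CV-structure.** A CV-structure is a tuple $(K\to M,C,\mathcal U,g,\kappa,h,D,\mathcal Q)$ where: - $K\to M$ is a holomorphic vector bundle, $C\in\Omega^1_M\otimes\mathcal O(\mathrm{End}K)$ and $\mathcal U\in\mathcal O(\mathrm{End}K)$ are holomorphic, $g$ is a holomorphic symmetric non-degenerate bilinear form on $K$, with $C_XC_Y=C_YC_X$, $[C_X,\mathcal U]=0$, $g(C_Xa,b)=g(a,C_Xb)$, $g(\mathcal U a,b)=g(a,\mathcal U b)$; - $\kappa:K\to K$ is a smooth fibrewise $\mathbb C$-antilinear bundle map, $\kappa^2=\mathrm{id}$, $g(\kappa a,\kappa b)=\overline{g(a,b)}$; - $h:=g(\cdot,\kappa\cdot)$ is a non-degenerate (possibly indefinite) hermitian form, linear in the first and conjugate linear in the second argument, and its Chern connection $D$ satisfies, for $X,Y\in\mathcal T_M$: $D(\kappa)=0$ (i.e. $D_X(\kappa a)=\kappa D_{\bar X}a$), $D_X(C_Y)-D_Y(C_X)-C_{[X,Y]}=0$, and $R^D(X,\bar Y)+[C_X,\kappa C_Y\kappa]=0$, where $R^D$ is the curvature of $D$; - $\mathcal Q$ is a smooth endomorphism of $K$ with $g(\mathcal Qa,b)=-g(a,\mathcal Qb)$, $h(\mathcal Qa,b)=h(a,\mathcal Qb)$, and for $X\in\mathcal T_M$: $D_X(\mathcal U)-[C_X,\mathcal Q]+C_X=0$, $D_X(\mathcal Q)+[C_X,\kappa\,\mathcal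 U\kappa]=0$. **Unfolding condition.** There is a section $\zeta\in\mathcal O(K)$ such that $TM\to K$, $X\mapsto -C_X(\zeta)$, is an isomorphism. **$F$-manifold.** A complex manifold $M$ with a holomorphic, commutative, associative multiplication $\circ$ on $TM$ and unit field $e$ such that $L_{X\circ Y}(\circ)=X\circ L_Y(\circ)+Y\circ L_X(\circ)$ for all $X,Y\in\mathcal T_M$. An Euler field is an $E\in\mathcal T_M$ with $L_E(\circ)=\circ$. **Conventions.** For a holomorphic vector field $X$, the Lie derivatives $L_X$, $L_{\bar X}$ act on smooth $(1,0)$-vector fields $Y$ by $[X,Y]$, $[\bar X,Y]$ (again of type $(1,0)$) and extend to tensors by the Leibniz rule; e.g. $L_X(h)(Y,Z)=X\,h(Y,Z)-h([X,Y],Z)-h(Y,[\bar X,Z])$, $L_X(\kappa)(Y)=[X,\kappa Y]-\kappa[\bar X,Y]$ and similarly with $X$ and $\bar X$ interchanged; $L_{E-\bar E}=L_E-L_{\bar E}$. $D$ acts on smooth sections of the bundle of $(1,0)$-vectors and on tensors by the Leibniz rule (and by conjugation on $(0,1)$-vectors). $D_E-L_E$ is viewed as a ($C^\infty$-linear) endomorphism of the $(1,0)$-tangent bundle.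
   Formalization: Besides C_X(Y) = -X∘Y, the multiplication ∘ is also assumed to satisfy C_{X∘Y} = -C_X C_Y (the multiplication determined by the unfolding condition); without this, ∘ can fail to be commutative and associative and (a) is false. *)

theory Defs
  imports "HOL-Analysis.Analysis" "HOL-Library.Function_Algebras"
begin

section \<open>Smooth and holomorphic functions of several variables\<close>

primrec Ck_on :: "nat \<Rightarrow> ('a::real_normed_vector \<Rightarrow> 'b::real_normed_vector) \<Rightarrow> 'a set \<Rightarrow> bool" where
  "Ck_on 0 f S \<longleftrightarrow> continuous_on S f"
| "Ck_on (Suc k) f S \<longleftrightarrow> (\<forall>x\<in>S. f differentiable (at x)) \<and>
     (\<forall>v. Ck_on k (\<lambda>x. frechet_derivative f (at x) v) S)"

text \<open>Only used on open sets of finite-dimensional spaces, where the quantification over directions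
  \<open>v\<close> amounts to all iterated partial derivatives.\<close>

definition Cinf_on :: "('a::real_normed_vector \<Rightarrow> 'b::real_normed_vector) \<Rightarrow> 'a set \<Rightarrow> bool" where
  "Cinf_on f S \<longleftrightarrow> (\<forall>k. Ck_on k f S)"

text \<open>Smooth functions with \<open>\<partial>\<close>-bar derivative zero, i.e. with complex linear differential.\<close>

definition holo_on :: "(complex^'n \<Rightarrow> complex) \<Rightarrow> (complex^'n) set \<Rightarrow> bool" where
  "holo_on f S \<longleftrightarrow> Cinf_on f S \<and>
     (\<forall>x\<in>S. \<forall>v. frechet_derivative f (at x) (\<i> *s v) = \<i> * frechet_derivative f (at x) v)"

section \<open>Complex manifolds\<close>

text \<open>A manifold is the whole type \<open>'m\<close>, with an atlas (not necessarily maximal) of charts \<open>(U, \<phi>)\<close>,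
  where \<open>\<phi>\<close> only matters on \<open>U\<close>.\<close>

type_synonym ('m, 'n) atlas = "('m set \<times> ('m \<Rightarrow> complex^'n)) set"

definition complex_manifold ::
    "('m::{t2_space,second_countable_topology}, 'n::finite) atlas \<Rightarrow> bool" where
  "complex_manifold A \<longleftrightarrow>
     (\<forall>(U, \<phi>)\<in>A. open U \<and> open (\<phi> ` U) \<and> homeomorphism U (\<phi> ` U) \<phi> (inv_into U \<phi>)) \<and>
     (\<Union>(U, \<phi>)\<in>A. U) = UNIV \<and>
     (\<forall>(U, \<phi>)\<in>A. \<forall>(V, \<psi>)\<in>A. \<forall>i. holo_on (\<lambda>x. \<psi> (inv_into U \<phi> x) $ i) (\<phi> ` (U \<inter> V)))"

definition smooth_fun ::
    "('m::topological_space, 'n::finite) atlas \<Rightarrow> 'm set \<Rightarrow> ('m \<Rightarrow> complex) \<Rightarrow> bool" where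
  "smooth_fun A W f \<longleftrightarrow> open W \<and> (\<forall>(U, \<phi>)\<in>A. Cinf_on (\<lambda>x. f (inv_into U \<phi> x)) (\<phi> ` (U \<inter> W)))"

definition hol_fun ::
    "('m::topological_space, 'n::finite) atlas \<Rightarrow> 'm set \<Rightarrow> ('m \<Rightarrow> complex) \<Rightarrow> bool" where
  "hol_fun A W f \<longleftrightarrow> open W \<and> (\<forall>(U, \<phi>)\<in>A. holo_on (\<lambda>x. f (inv_into U \<phi> x)) (\<phi> ` (U \<inter> W)))"

definition smooth_near ::
    "('m::topological_space, 'n::finite) atlas \<Rightarrow> 'm \<Rightarrow> ('m \<Rightarrow> complex) \<Rightarrow> bool" where
  "smooth_near A p f \<longleftrightarrow> (\<exists>W. p \<in> W \<and> smooth_fun A W f)"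

definition hol_near ::
    "('m::topological_space, 'n::finite) atlas \<Rightarrow> 'm \<Rightarrow> ('m \<Rightarrow> complex) \<Rightarrow> bool" where
  "hol_near A p f \<longleftrightarrow> (\<exists>W. p \<in> W \<and> hol_fun A W f)"

section \<open>Tangent vectors and vector fields\<close>

text \<open>Complexified tangent vectors at \<open>p\<close> are derivations of the algebra of germs at \<open>p\<close> of smooth
  complex-valued functions. Germs are represented by functions on all of \<open>'m\<close>; to make a vector
  determined by its values on germs, it is required to be \<open>0\<close> on functions not smooth near \<open>p\<close>.
  Addition, negation and \<open>0\<close> of vectors are pointwise.\<close>

type_synonym 'm cvec = "('m \<Rightarrow> complex) \<Rightarrow> complex"
type_synonym 'm cfield = "'m \<Rightarrow> 'm cvec"

definition smul :: "complex \<Rightarrow> ('a \<Rightarrow> complex) \<Rightarrow> ('a \<Rightarrow> complex)"  (infixr "*\<^sub>V" 75) where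
  "c *\<^sub>V v = (\<lambda>f. c * v f)"

definition CT :: "('m::topological_space, 'n::finite) atlas \<Rightarrow> 'm \<Rightarrow> 'm cvec set" where
  "CT A p = {v.
     (\<forall>f. \<not> smooth_near A p f \<longrightarrow> v f = 0) \<and>
     (\<forall>f g. smooth_near A p f \<and> smooth_near A p g \<and> (\<exists>W. open W \<and> p \<in> W \<and> (\<forall>q\<in>W. f q = g q))
        \<longrightarrow> v f = v g) \<and>
     (\<forall>f g. smooth_near A p f \<and> smooth_near A p g \<longrightarrow>
        v (\<lambda>q. f q + g q) = v f + v g \<and> v (\<lambda>q. f q * g q) = v f * g p + f p * v g) \<and>
     (\<forall>c f. smooth_near A p f \<longrightarrow> v (\<lambda>q. c * f q) = c * v f)}"

text \<open>The holomorphic tangent space: vectors of type (1,0).\<close>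

definition T10 :: "('m::topological_space, 'n::finite) atlas \<Rightarrow> 'm \<Rightarrow> 'm cvec set" where
  "T10 A p = {v \<in> CT A p. \<forall>f. hol_near A p f \<longrightarrow> v (\<lambda>q. cnj (f q)) = 0}"

definition conjv :: "'m cvec \<Rightarrow> 'm cvec" where
  "conjv v = (\<lambda>f. cnj (v (\<lambda>q. cnj (f q))))"

definition conjf :: "'m cfield \<Rightarrow> 'm cfield" where
  "conjf X = (\<lambda>p. conjv (X p))"

definition part10 :: "('m::topological_space, 'n::finite) atlas \<Rightarrow> 'm \<Rightarrow> 'm cvec \<Rightarrow> 'm cvec" where
  "part10 A p z = (THE a. a \<in> T10 A p \<and> (\<exists>b\<in>T10 A p. z = a + conjv b))"

definition part01 :: "('m::topological_space, 'n::finite) atlas \<Rightarrow> 'm \<Rightarrow> 'm cvec \<Rightarrow> 'm cvec" where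
  "part01 A p z = z - part10 A p z"

definition smooth_cvf ::
    "('m::topological_space, 'n::finite) atlas \<Rightarrow> 'm set \<Rightarrow> 'm cfield \<Rightarrow> bool" where
  "smooth_cvf A W X \<longleftrightarrow> open W \<and> (\<forall>p\<in>W. X p \<in> CT A p) \<and>
     (\<forall>V f. V \<subseteq> W \<and> smooth_fun A V f \<longrightarrow> smooth_fun A V (\<lambda>p. X p f))"

definition smooth_vf ::
    "('m::topological_space, 'n::finite) atlas \<Rightarrow> 'm set \<Rightarrow> 'm cfield \<Rightarrow> bool" where
  "smooth_vf A W X \<longleftrightarrow> smooth_cvf A W X \<and> (\<forall>p\<in>W. X p \<in> T10 A p)"

definition hol_vf ::
    "('m::topological_space, 'n::finite) atlas \<Rightarrow> 'm set \<Rightarrow> 'm cfield \<Rightarrow> bool" where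
  "hol_vf A W X \<longleftrightarrow> open W \<and> (\<forall>p\<in>W. X p \<in> T10 A p) \<and>
     (\<forall>V f. V \<subseteq> W \<and> hol_fun A V f \<longrightarrow> hol_fun A V (\<lambda>p. X p f))"

definition bracket ::
    "('m::topological_space, 'n::finite) atlas \<Rightarrow> 'm cfield \<Rightarrow> 'm cfield \<Rightarrow> 'm cfield" where
  "bracket A X Y = (\<lambda>p f. if smooth_near A p f
     then X p (\<lambda>q. Y q f) - Y p (\<lambda>q. X q f) else 0)"

section \<open>Derivatives of tensors\<close>

text \<open>For an operator \<open>\<delta>\<close> on vector fields, such as \<open>L\<^sub>X\<close> (that is, \<open>bracket A X\<close>) or \<open>D\<^sub>X\<close>, the
  operators it induces by the Leibniz rule. The second operator \<open>\<delta>'\<close> acts on arguments that enter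
  conjugate linearly.\<close>

definition deriv_endo ::
    "('m cfield \<Rightarrow> 'm cfield) \<Rightarrow> ('m \<Rightarrow> 'm cvec \<Rightarrow> 'm cvec) \<Rightarrow> 'm cfield \<Rightarrow> 'm cfield" where
  "deriv_endo \<delta> T Y = (\<lambda>p. \<delta> (\<lambda>q. T q (Y q)) p - T p (\<delta> Y p))"

definition deriv_anti ::
    "('m cfield \<Rightarrow> 'm cfield) \<Rightarrow> ('m cfield \<Rightarrow> 'm cfield) \<Rightarrow> ('m \<Rightarrow> 'm cvec \<Rightarrow> 'm cvec)
      \<Rightarrow> 'm cfield \<Rightarrow> 'm cfield" where
  "deriv_anti \<delta> \<delta>' \<kappa> Y = (\<lambda>p. \<delta> (\<lambda>q. \<kappa> q (Y q)) p - \<kappa> p (\<delta>' Y p))"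

definition deriv_form ::
    "'m cfield \<Rightarrow> ('m cfield \<Rightarrow> 'm cfield) \<Rightarrow> ('m cfield \<Rightarrow> 'm cfield)
      \<Rightarrow> ('m \<Rightarrow> 'm cvec \<Rightarrow> 'm cvec \<Rightarrow> complex) \<Rightarrow> 'm cfield \<Rightarrow> 'm cfield \<Rightarrow> 'm \<Rightarrow> complex" where
  "deriv_form X \<delta> \<delta>' b Y Z = (\<lambda>p. X p (\<lambda>q. b q (Y q) (Z q)) - b p (\<delta> Y p) (Z p) - b p (Y p) (\<delta>' Z p))"

definition deriv_mult ::
    "('m cfield \<Rightarrow> 'm cfield) \<Rightarrow> ('m \<Rightarrow> 'm cvec \<Rightarrow> 'm cvec \<Rightarrow> 'm cvec)
      \<Rightarrow> 'm cfield \<Rightarrow> 'm cfield \<Rightarrow> 'm cfield" where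
  "deriv_mult \<delta> m Y Z = (\<lambda>p. \<delta> (\<lambda>q. m q (Y q) (Z q)) p - m p (\<delta> Y p) (Z p) - m p (Y p) (\<delta> Z p))"

text \<open>General smooth tensor fields with \<open>k\<close> covariant and \<open>l\<close> contravariant arguments on the
  complexified tangent bundle; \<open>T p vs \<alpha>s\<close> takes a list of \<open>k\<close> vectors and a list of \<open>l\<close> covectors.\<close>

type_synonym 'm covec = "'m cvec \<Rightarrow> complex"

definition cotangent :: "('m::topological_space, 'n::finite) atlas \<Rightarrow> 'm \<Rightarrow> 'm covec set" where
  "cotangent A p = {\<alpha>. (\<forall>v\<in>CT A p. \<forall>w\<in>CT A p. \<alpha> (v + w) = \<alpha> v + \<alpha> w) \<and>
     (\<forall>c. \<forall>v\<in>CT A p. \<alpha> (c *\<^sub>V v) = c * \<alpha> v) \<and> (\<forall>v. v \<notin> CT A p \<longrightarrow> \<alpha> v = 0)}"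

definition smooth_form ::
    "('m::topological_space, 'n::finite) atlas \<Rightarrow> 'm set \<Rightarrow> ('m \<Rightarrow> 'm covec) \<Rightarrow> bool" where
  "smooth_form A W \<omega> \<longleftrightarrow> open W \<and> (\<forall>p\<in>W. \<omega> p \<in> cotangent A p) \<and>
     (\<forall>V Y. V \<subseteq> W \<and> smooth_cvf A V Y \<longrightarrow> smooth_fun A V (\<lambda>p. \<omega> p (Y p)))"

definition smooth_tensor :: "('m::topological_space, 'n::finite) atlas \<Rightarrow> 'm set \<Rightarrow> nat \<Rightarrow> nat
      \<Rightarrow> ('m \<Rightarrow> 'm cvec list \<Rightarrow> 'm covec list \<Rightarrow> complex) \<Rightarrow> bool" where
  "smooth_tensor A W k l T \<longleftrightarrow> open W \<and>
     (\<forall>p\<in>W. \<forall>vs \<alpha>s. length vs = k \<and> set vs \<subseteq> CT A p \<and> length \<alpha>s = l \<and> set \<alpha>s \<subseteq> cotangent A p \<longrightarrow>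
        (\<forall>i<k. \<forall>a\<in>CT A p. \<forall>b\<in>CT A p. \<forall>c.
           T p (vs[i := a + b]) \<alpha>s = T p (vs[i := a]) \<alpha>s + T p (vs[i := b]) \<alpha>s \<and>
           T p (vs[i := c *\<^sub>V a]) \<alpha>s = c * T p (vs[i := a]) \<alpha>s) \<and>
        (\<forall>j<l. \<forall>a\<in>cotangent A p. \<forall>b\<in>cotangent A p. \<forall>c.
           T p vs (\<alpha>s[j := a + b]) = T p vs (\<alpha>s[j := a]) + T p vs (\<alpha>s[j := b]) \<and>
           T p vs (\<alpha>s[j := c *\<^sub>V a]) = c * T p vs (\<alpha>s[j := a]))) \<and>
     (\<forall>V Ys \<omega>s. V \<subseteq> W \<and> open V \<and> length Ys = k \<and> (\<forall>Y\<in>set Ys. smooth_cvf A V Y) \<and>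
        length \<omega>s = l \<and> (\<forall>\<omega>\<in>set \<omega>s. smooth_form A V \<omega>) \<longrightarrow>
        smooth_fun A V (\<lambda>p. T p (map (\<lambda>Y. Y p) Ys) (map (\<lambda>\<omega>. \<omega> p) \<omega>s)))"

text \<open>The derivative of a 1-form, \<open>(\<delta> \<omega>)(Y) = X (\<omega> Y) - \<omega> (\<delta> Y)\<close>; for the operators \<open>\<delta>\<close> considered
  here the value at \<open>p\<close> depends only on \<open>Y p\<close>, so that \<open>v\<close> may be extended to any smooth field.\<close>

definition deriv_covec :: "('m::topological_space, 'n::finite) atlas \<Rightarrow> 'm cfield
      \<Rightarrow> ('m cfield \<Rightarrow> 'm cfield) \<Rightarrow> ('m \<Rightarrow> 'm covec) \<Rightarrow> 'm \<Rightarrow> 'm covec" where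
  "deriv_covec A X \<delta> \<omega> p = (\<lambda>v. if v \<in> CT A p
     then (THE c. \<exists>W Y. p \<in> W \<and> smooth_cvf A W Y \<and> Y p = v \<and>
             c = X p (\<lambda>q. \<omega> q (Y q)) - \<omega> p (\<delta> Y p))
     else 0)"

definition deriv_tensor :: "('m::topological_space, 'n::finite) atlas \<Rightarrow> 'm cfield
      \<Rightarrow> ('m cfield \<Rightarrow> 'm cfield) \<Rightarrow> ('m \<Rightarrow> 'm cvec list \<Rightarrow> 'm covec list \<Rightarrow> complex)
      \<Rightarrow> 'm cfield list \<Rightarrow> ('m \<Rightarrow> 'm covec) list \<Rightarrow> 'm \<Rightarrow> complex" where
  "deriv_tensor A X \<delta> T Ys \<omega>s p =
     X p (\<lambda>q. T q (map (\<lambda>Y. Y q) Ys) (map (\<lambda>\<omega>. \<omega> q) \<omega>s))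
     - (\<Sum>i<length Ys. T p ((map (\<lambda>Y. Y p) Ys)[i := \<delta> (Ys ! i) p]) (map (\<lambda>\<omega>. \<omega> p) \<omega>s))
     - (\<Sum>j<length \<omega>s. T p (map (\<lambda>Y. Y p) Ys) ((map (\<lambda>\<omega>. \<omega> p) \<omega>s)[j := deriv_covec A X \<delta> (\<omega>s ! j) p]))"

definition agree_on_tensors :: "('m::topological_space, 'n::finite) atlas \<Rightarrow> 'm cfield
      \<Rightarrow> ('m cfield \<Rightarrow> 'm cfield) \<Rightarrow> ('m cfield \<Rightarrow> 'm cfield) \<Rightarrow> bool" where
  "agree_on_tensors A X \<delta> \<epsilon> \<longleftrightarrow>
     (\<forall>k l W T Ys \<omega>s. smooth_tensor A W k l T \<and> length Ys = k \<and> (\<forall>Y\<in>set Ys. smooth_cvf A W Y) \<and>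
        length \<omega>s = l \<and> (\<forall>\<omega>\<in>set \<omega>s. smooth_form A W \<omega>) \<longrightarrow>
        (\<forall>p\<in>W. deriv_tensor A X \<delta> T Ys \<omega>s p = deriv_tensor A X \<epsilon> T Ys \<omega>s p))"

section \<open>Connections on the holomorphic tangent bundle\<close>

text \<open>\<open>D p v Y\<close> is the covariant derivative at \<open>p\<close> of the local (1,0)-field \<open>Y\<close> in the direction of the
  complexified tangent vector \<open>v\<close>.\<close>

type_synonym 'm conn = "'m \<Rightarrow> 'm cvec \<Rightarrow> 'm cfield \<Rightarrow> 'm cvec"

definition connection :: "('m::topological_space, 'n::finite) atlas \<Rightarrow> 'm conn \<Rightarrow> bool" where
  "connection A D \<longleftrightarrow>
     (\<forall>W X Y. smooth_cvf A W X \<and> smooth_vf A W Y \<longrightarrow> smooth_vf A W (\<lambda>p. D p (X p) Y)) \<and>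
     (\<forall>W Y. \<forall>p\<in>W. \<forall>v\<in>CT A p. \<forall>w\<in>CT A p. \<forall>c. smooth_vf A W Y \<longrightarrow>
        D p v Y \<in> T10 A p \<and> D p (v + w) Y = D p v Y + D p w Y \<and> D p (c *\<^sub>V v) Y = c *\<^sub>V D p v Y) \<and>
     (\<forall>W Y Z f. \<forall>p\<in>W. \<forall>v\<in>CT A p. smooth_vf A W Y \<and> smooth_vf A W Z \<and> smooth_fun A W f \<longrightarrow>
        D p v (\<lambda>q. Y q + Z q) = D p v Y + D p v Z \<and>
        D p v (\<lambda>q. f q *\<^sub>V Y q) = v f *\<^sub>V Y p + f p *\<^sub>V D p v Y) \<and>
     (\<forall>W Y Z. \<forall>p\<in>W. \<forall>v\<in>CT A p. smooth_vf A W Y \<and> smooth_vf A W Z \<and> (\<forall>q\<in>W. Y q = Z q) \<longrightarrow>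
        D p v Y = D p v Z)"

definition cov :: "'m conn \<Rightarrow> 'm cfield \<Rightarrow> 'm cfield \<Rightarrow> 'm cfield" where
  "cov D X Y = (\<lambda>p. D p (X p) Y)"

text \<open>Extension to the complexified tangent bundle, by conjugation on (0,1)-vectors.\<close>

definition covC ::
    "('m::topological_space, 'n::finite) atlas \<Rightarrow> 'm conn \<Rightarrow> 'm cfield \<Rightarrow> 'm cfield \<Rightarrow> 'm cfield" where
  "covC A D X Y = (\<lambda>p. D p (X p) (\<lambda>q. part10 A q (Y q))
     + conjv (D p (conjv (X p)) (\<lambda>q. conjv (part01 A q (Y q)))))"

definition chern_connection :: "('m::topological_space, 'n::finite) atlas
      \<Rightarrow> ('m \<Rightarrow> 'm cvec \<Rightarrow> 'm cvec \<Rightarrow> complex) \<Rightarrow> 'm conn \<Rightarrow> bool" where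
  "chern_connection A h D \<longleftrightarrow> connection A D \<and>
     (\<forall>W Y. \<forall>p\<in>W. \<forall>v\<in>T10 A p. hol_vf A W Y \<longrightarrow> D p (conjv v) Y = 0) \<and>
     (\<forall>W Y Z. \<forall>p\<in>W. \<forall>v\<in>CT A p. smooth_vf A W Y \<and> smooth_vf A W Z \<longrightarrow>
        v (\<lambda>q. h q (Y q) (Z q)) = h p (D p v Y) (Z p) + h p (Y p) (D p (conjv v) Z))"

definition curvature :: "('m::topological_space, 'n::finite) atlas \<Rightarrow> 'm conn
      \<Rightarrow> 'm cfield \<Rightarrow> 'm cfield \<Rightarrow> 'm cfield \<Rightarrow> 'm cfield" where
  "curvature A D X Y Z = (\<lambda>p. cov D X (cov D Y Z) p - cov D Y (cov D X Z) p - cov D (bracket A X Y) Z p)"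

section \<open>CV-structures on the holomorphic tangent bundle\<close>

definition clinear_endo ::
    "('m::topological_space, 'n::finite) atlas \<Rightarrow> ('m \<Rightarrow> 'm cvec \<Rightarrow> 'm cvec) \<Rightarrow> bool" where
  "clinear_endo A T \<longleftrightarrow> (\<forall>p. \<forall>a\<in>T10 A p. \<forall>b\<in>T10 A p. \<forall>c. T p a \<in> T10 A p \<and>
     T p (a + b) = T p a + T p b \<and> T p (c *\<^sub>V a) = c *\<^sub>V T p a)"

definition hol_endo ::
    "('m::topological_space, 'n::finite) atlas \<Rightarrow> ('m \<Rightarrow> 'm cvec \<Rightarrow> 'm cvec) \<Rightarrow> bool" where
  "hol_endo A T \<longleftrightarrow> clinear_endo A T \<and> (\<forall>W Y. hol_vf A W Y \<longrightarrow> hol_vf A W (\<lambda>p. T p (Y p)))"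

definition smooth_endo ::
    "('m::topological_space, 'n::finite) atlas \<Rightarrow> ('m \<Rightarrow> 'm cvec \<Rightarrow> 'm cvec) \<Rightarrow> bool" where
  "smooth_endo A T \<longleftrightarrow> clinear_endo A T \<and> (\<forall>W Y. smooth_vf A W Y \<longrightarrow> smooth_vf A W (\<lambda>p. T p (Y p)))"

definition hol_mult ::
    "('m::topological_space, 'n::finite) atlas \<Rightarrow> ('m \<Rightarrow> 'm cvec \<Rightarrow> 'm cvec \<Rightarrow> 'm cvec) \<Rightarrow> bool" where
  "hol_mult A m \<longleftrightarrow>
     (\<forall>p. \<forall>a\<in>T10 A p. \<forall>b\<in>T10 A p. \<forall>x\<in>T10 A p. \<forall>c. m p a x \<in> T10 A p \<and>
        m p (a + b) x = m p a x + m p b x \<and> m p (c *\<^sub>V a) x = c *\<^sub>V m p a x \<and>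
        m p x (a + b) = m p x a + m p x b \<and> m p x (c *\<^sub>V a) = c *\<^sub>V m p x a) \<and>
     (\<forall>W X Y. hol_vf A W X \<and> hol_vf A W Y \<longrightarrow> hol_vf A W (\<lambda>p. m p (X p) (Y p)))"

definition hol_metric ::
    "('m::topological_space, 'n::finite) atlas \<Rightarrow> ('m \<Rightarrow> 'm cvec \<Rightarrow> 'm cvec \<Rightarrow> complex) \<Rightarrow> bool" where
  "hol_metric A g \<longleftrightarrow>
     (\<forall>p. \<forall>a\<in>T10 A p. \<forall>b\<in>T10 A p. \<forall>x\<in>T10 A p. \<forall>c.
        g p (a + b) x = g p a x + g p b x \<and> g p (c *\<^sub>V a) x = c * g p a x \<and> g p a b = g p b a) \<and>
     (\<forall>p. \<forall>a\<in>T10 A p. (\<forall>b\<in>T10 A p. g p a b = 0) \<longrightarrow> a = 0) \<and>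
     (\<forall>W Y Z. hol_vf A W Y \<and> hol_vf A W Z \<longrightarrow> hol_fun A W (\<lambda>p. g p (Y p) (Z p)))"

definition antilinear_map ::
    "('m::topological_space, 'n::finite) atlas \<Rightarrow> ('m \<Rightarrow> 'm cvec \<Rightarrow> 'm cvec) \<Rightarrow> bool" where
  "antilinear_map A \<kappa> \<longleftrightarrow>
     (\<forall>p. \<forall>a\<in>T10 A p. \<forall>b\<in>T10 A p. \<forall>c. \<kappa> p a \<in> T10 A p \<and>
        \<kappa> p (a + b) = \<kappa> p a + \<kappa> p b \<and> \<kappa> p (c *\<^sub>V a) = cnj c *\<^sub>V \<kappa> p a) \<and>
     (\<forall>W Y. smooth_vf A W Y \<longrightarrow> smooth_vf A W (\<lambda>p. \<kappa> p (Y p)))"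

definition nondeg_hermitian ::
    "('m::topological_space, 'n::finite) atlas \<Rightarrow> ('m \<Rightarrow> 'm cvec \<Rightarrow> 'm cvec \<Rightarrow> complex) \<Rightarrow> bool" where
  "nondeg_hermitian A h \<longleftrightarrow>
     (\<forall>p. \<forall>a\<in>T10 A p. \<forall>b\<in>T10 A p. \<forall>x\<in>T10 A p. \<forall>c.
        h p (a + b) x = h p a x + h p b x \<and> h p (c *\<^sub>V a) x = c * h p a x \<and>
        h p b a = cnj (h p a b)) \<and>
     (\<forall>p. \<forall>a\<in>T10 A p. (\<forall>b\<in>T10 A p. h p a b = 0) \<longrightarrow> a = 0)"

definition CV_structure :: "('m::{t2_space,second_countable_topology}, 'n::finite) atlas
      \<Rightarrow> ('m \<Rightarrow> 'm cvec \<Rightarrow> 'm cvec \<Rightarrow> 'm cvec) \<Rightarrow> ('m \<Rightarrow> 'm cvec \<Rightarrow> 'm cvec)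
      \<Rightarrow> ('m \<Rightarrow> 'm cvec \<Rightarrow> 'm cvec \<Rightarrow> complex) \<Rightarrow> ('m \<Rightarrow> 'm cvec \<Rightarrow> 'm cvec)
      \<Rightarrow> ('m \<Rightarrow> 'm cvec \<Rightarrow> 'm cvec \<Rightarrow> complex) \<Rightarrow> 'm conn \<Rightarrow> ('m \<Rightarrow> 'm cvec \<Rightarrow> 'm cvec) \<Rightarrow> bool" where
  "CV_structure A C \<U> g \<kappa> h D \<Q> \<longleftrightarrow>
     complex_manifold A \<and>
     hol_mult A C \<and> hol_endo A \<U> \<and> hol_metric A g \<and>
     (\<forall>p. \<forall>x\<in>T10 A p. \<forall>y\<in>T10 A p. \<forall>a\<in>T10 A p. \<forall>b\<in>T10 A p.
        C p x (C p y a) = C p y (C p x a) \<and> C p x (\<U> p a) = \<U> p (C p x a) \<and>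
        g p (C p x a) b = g p a (C p x b) \<and> g p (\<U> p a) b = g p a (\<U> p b)) \<and>
     antilinear_map A \<kappa> \<and>
     (\<forall>p. \<forall>a\<in>T10 A p. \<forall>b\<in>T10 A p. \<kappa> p (\<kappa> p a) = a \<and> g p (\<kappa> p a) (\<kappa> p b) = cnj (g p a b)) \<and>
     (\<forall>p. \<forall>a\<in>T10 A p. \<forall>b\<in>T10 A p. h p a b = g p a (\<kappa> p b)) \<and>
     nondeg_hermitian A h \<and> chern_connection A h D \<and>
     (\<forall>W Y. \<forall>p\<in>W. \<forall>v\<in>CT A p. smooth_vf A W Y \<longrightarrow>
        D p v (\<lambda>q. \<kappa> q (Y q)) = \<kappa> p (D p (conjv v) Y)) \<and>
     (\<forall>W X Y Z. \<forall>p\<in>W. hol_vf A W X \<and> hol_vf A W Y \<and> smooth_vf A W Z \<longrightarrow>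
        deriv_endo (cov D X) (\<lambda>q. C q (Y q)) Z p - deriv_endo (cov D Y) (\<lambda>q. C q (X q)) Z p
          - C p (bracket A X Y p) (Z p) = 0) \<and>
     (\<forall>W X Y Z. \<forall>p\<in>W. hol_vf A W X \<and> hol_vf A W Y \<and> smooth_vf A W Z \<longrightarrow>
        curvature A D X (conjf Y) Z p
          + (C p (X p) (\<kappa> p (C p (Y p) (\<kappa> p (Z p)))) - \<kappa> p (C p (Y p) (\<kappa> p (C p (X p) (Z p))))) = 0) \<and>
     smooth_endo A \<Q> \<and>
     (\<forall>p. \<forall>a\<in>T10 A p. \<forall>b\<in>T10 A p.
        g p (\<Q> p a) b = - g p a (\<Q> p b) \<and> h p (\<Q> p a) b = h p a (\<Q> p b)) \<and>
     (\<forall>W X Z. \<forall>p\<in>W. hol_vf A W X \<and> smooth_vf A W Z \<longrightarrow>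
        deriv_endo (cov D X) \<U> Z p - (C p (X p) (\<Q> p (Z p)) - \<Q> p (C p (X p) (Z p)))
          + C p (X p) (Z p) = 0 \<and>
        deriv_endo (cov D X) \<Q> Z p
          + (C p (X p) (\<kappa> p (\<U> p (\<kappa> p (Z p)))) - \<kappa> p (\<U> p (\<kappa> p (C p (X p) (Z p))))) = 0)"

definition unfolding_condition :: "('m::topological_space, 'n::finite) atlas
      \<Rightarrow> ('m \<Rightarrow> 'm cvec \<Rightarrow> 'm cvec \<Rightarrow> 'm cvec) \<Rightarrow> bool" where
  "unfolding_condition A C \<longleftrightarrow>
     (\<exists>\<zeta>. hol_vf A UNIV \<zeta> \<and> (\<forall>p. bij_betw (\<lambda>x. - C p x (\<zeta> p)) (T10 A p) (T10 A p)))"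

section \<open>F-manifolds\<close>

definition F_manifold :: "('m::{t2_space,second_countable_topology}, 'n::finite) atlas
      \<Rightarrow> ('m \<Rightarrow> 'm cvec \<Rightarrow> 'm cvec \<Rightarrow> 'm cvec) \<Rightarrow> 'm cfield \<Rightarrow> bool" where
  "F_manifold A m e \<longleftrightarrow>
     complex_manifold A \<and> hol_mult A m \<and> hol_vf A UNIV e \<and>
     (\<forall>p. \<forall>a\<in>T10 A p. \<forall>b\<in>T10 A p. \<forall>c\<in>T10 A p.
        m p a b = m p b a \<and> m p (m p a b) c = m p a (m p b c) \<and> m p (e p) a = a) \<and>
     (\<forall>W X Y Z Z'. \<forall>p\<in>W. hol_vf A W X \<and> hol_vf A W Y \<and> hol_vf A W Z \<and> hol_vf A W Z' \<longrightarrow>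
        deriv_mult (bracket A (\<lambda>q. m q (X q) (Y q))) m Z Z' p =
          m p (X p) (deriv_mult (bracket A Y) m Z Z' p) + m p (Y p) (deriv_mult (bracket A X) m Z Z' p))"

definition Euler_field :: "('m::topological_space, 'n::finite) atlas
      \<Rightarrow> ('m \<Rightarrow> 'm cvec \<Rightarrow> 'm cvec \<Rightarrow> 'm cvec) \<Rightarrow> 'm cfield \<Rightarrow> bool" where
  "Euler_field A m E \<longleftrightarrow> hol_vf A UNIV E \<and>
     (\<forall>W Z Z'. \<forall>p\<in>W. hol_vf A W Z \<and> hol_vf A W Z' \<longrightarrow>
        deriv_mult (bracket A E) m Z Z' p = m p (Z p) (Z' p))"

section \<open>Skew part of an endomorphism given as an operator on sections\<close>

definition g_adjoint :: "('m::topological_space, 'n::finite) atlas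
      \<Rightarrow> ('m \<Rightarrow> 'm cvec \<Rightarrow> 'm cvec \<Rightarrow> complex) \<Rightarrow> ('m cfield \<Rightarrow> 'm cfield) \<Rightarrow> 'm cfield \<Rightarrow> 'm cfield" where
  "g_adjoint A g B Y = (\<lambda>p. THE w. w \<in> T10 A p \<and>
     (\<forall>W Z. p \<in> W \<and> smooth_vf A W Z \<longrightarrow> g p w (Z p) = g p (Y p) (B Z p)))"

definition skew_part :: "('m::topological_space, 'n::finite) atlas
      \<Rightarrow> ('m \<Rightarrow> 'm cvec \<Rightarrow> 'm cvec \<Rightarrow> complex) \<Rightarrow> ('m cfield \<Rightarrow> 'm cfield) \<Rightarrow> 'm cfield \<Rightarrow> 'm cfield" where
  "skew_part A g B Y = (\<lambda>p. (1/2) *\<^sub>V (B Y p - g_adjoint A g B Y p))"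

section \<open>Flows\<close>

text \<open>A smooth local flow, on \<open>V\<close> and for times in \<open>J\<close>, of the real vector field \<open>\<xi>\<close>; continuity
  and the condition after it say that \<open>\<Phi>\<close> is smooth jointly in time and point.\<close>

definition local_flow :: "('m::topological_space, 'n::finite) atlas \<Rightarrow> 'm cfield
      \<Rightarrow> real set \<Rightarrow> 'm set \<Rightarrow> (real \<Rightarrow> 'm \<Rightarrow> 'm) \<Rightarrow> bool" where
  "local_flow A \<xi> J V \<Phi> \<longleftrightarrow>
     open J \<and> is_interval J \<and> 0 \<in> J \<and> open V \<and>
     continuous_on (J \<times> V) (\<lambda>(t, p). \<Phi> t p) \<and>
     (\<forall>W f. smooth_fun A W f \<longrightarrow> (\<forall>(U, \<phi>)\<in>A.
        Cinf_on (\<lambda>(t, x). f (\<Phi> t (inv_into U \<phi> x)))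
          {(t, x). t \<in> J \<and> x \<in> \<phi> ` (U \<inter> V) \<and> \<Phi> t (inv_into U \<phi> x) \<in> W})) \<and>
     (\<forall>p\<in>V. \<Phi> 0 p = p) \<and>
     (\<forall>p\<in>V. \<forall>t\<in>J. \<forall>f. smooth_near A (\<Phi> t p) f \<longrightarrow>
        ((\<lambda>s. f (\<Phi> s p)) has_vector_derivative \<xi> (\<Phi> t p) f) (at t))"

definition pushforward :: "('m::topological_space, 'n::finite) atlas
      \<Rightarrow> ('m \<Rightarrow> 'm) \<Rightarrow> 'm \<Rightarrow> 'm cvec \<Rightarrow> 'm cvec" where
  "pushforward A F p v = (\<lambda>f. if smooth_near A (F p) f then v (\<lambda>q. f (F q)) else 0)"

text \<open>The flow maps must preserve type (1,0) for the invariance of tensors on \<open>T10\<close> to make sense.\<close>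

definition flow_preserves_T10 ::
    "('m::topological_space, 'n::finite) atlas \<Rightarrow> 'm cfield \<Rightarrow> bool" where
  "flow_preserves_T10 A \<xi> \<longleftrightarrow> (\<forall>J V \<Phi>. local_flow A \<xi> J V \<Phi> \<longrightarrow>
     (\<forall>t\<in>J. \<forall>p\<in>V. \<forall>v\<in>T10 A p. pushforward A (\<Phi> t) p v \<in> T10 A (\<Phi> t p)))"

definition flow_invariant_form :: "('m::topological_space, 'n::finite) atlas \<Rightarrow> 'm cfield
      \<Rightarrow> ('m \<Rightarrow> 'm cvec \<Rightarrow> 'm cvec \<Rightarrow> complex) \<Rightarrow> bool" where
  "flow_invariant_form A \<xi> b \<longleftrightarrow> flow_preserves_T10 A \<xi> \<and>
     (\<forall>J V \<Phi>. local_flow A \<xi> J V \<Phi> \<longrightarrow>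
       (\<forall>t\<in>J. \<forall>p\<in>V. \<forall>v\<in>T10 A p. \<forall>w\<in>T10 A p.
          b (\<Phi> t p) (pushforward A (\<Phi> t) p v) (pushforward A (\<Phi> t) p w) = b p v w))"

definition flow_invariant_endo :: "('m::topological_space, 'n::finite) atlas \<Rightarrow> 'm cfield
      \<Rightarrow> ('m \<Rightarrow> 'm cvec \<Rightarrow> 'm cvec) \<Rightarrow> bool" where
  "flow_invariant_endo A \<xi> T \<longleftrightarrow> flow_preserves_T10 A \<xi> \<and>
     (\<forall>J V \<Phi>. local_flow A \<xi> J V \<Phi> \<longrightarrow>
       (\<forall>t\<in>J. \<forall>p\<in>V. \<forall>v\<in>T10 A p.
          T (\<Phi> t p) (pushforward A (\<Phi> t) p v) = pushforward A (\<Phi> t) p (T p v)))"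

end

theory Submission
  imports Defs
begin

text \<open>Write \<open>\<mu>\<^sub>X\<close> for multiplication by \<open>X\<close>, so that \<open>C\<^sub>X = - \<mu>\<^sub>X\<close> and the potentiality condition becomes
  \<open>D\<^sub>X(\<mu>\<^sub>Y) - D\<^sub>Y(\<mu>\<^sub>X) = \<mu>\<^bsub>[X,Y]\<^esub>\<close>. Inserting products into it expresses \<open>L\<^sub>X(\<circ>)\<close> through derivatives
  of \<open>\<mu>\<^sub>X\<close> alone, which yields the F-manifold identity and, with the equation for \<open>D\<^sub>X(\<U>)\<close>, the Euler field.
  The same equations show that \<open>D\<^sub>E - L\<^sub>E - \<Q>\<close> and \<open>D\<^sub>e - L\<^sub>e\<close> commute with all \<open>\<mu>\<^sub>X\<close>, so each is itself a
  multiplication, hence g-symmetric; as \<open>\<Q>\<close> is g-skew, this gives (b). In (c) the multiplier is \<open>D\<^sub>e e\<close>, and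
  every condition says that it vanishes; in (d) it is the constant \<open>(2 - d)/2\<close>. Since \<open>L\<close> and \<open>D\<close> agree in
  antiholomorphic directions, the remaining identities follow from \<open>D(h) = 0\<close>. They integrate along the flow
  of \<open>\<i>(E - E')\<close>, with \<open>E'\<close> the conjugate of \<open>E\<close>; this flow is holomorphic because the (0,1)-components of a
  transported vector solve a linear system.\<close>

section \<open>Calculus of smooth functions\<close>

text \<open>A fibrewise linear map commuting with all multiplications is multiplication by its value
  at the unit \<open>e\<close>, so the multipliers are simply read off by evaluating at
  \<open>e\<close>. The equations for \<Q> are given in (1,0) directions only. The other directions
  are reached by adjunction: differentiating h(\<Q>Y,Z) = h(Y,\<Q>Z) makes D\<Q> in the direction v
  the h-adjoint of D\<Q> in the conjugate direction. The flow statement for \<Q> is likewise reduced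
  to one about forms: h(\<Q>a,b) is transported like h(a,b), and it can be tested against all b
  because a transport that preserves the nondegenerate h is injective, hence onto by equality of
  dimensions. Two analytic obstacles shape the preparation. Vectors are derivations of germs, so
  that their having coordinates rests on Hadamard's lemma. And mixed partial derivatives must
  commute, both for derivatives of holomorphic functions to be holomorphic and for the time
  derivative of a transported vector.\<close>

lemma has_frechet_derivative:
  "f differentiable (at x) \<Longrightarrow> (f has_derivative frechet_derivative f (at x)) (at x)"
  using frechet_derivative_works by blast

lemma frechet_derivative_eqI: "(f has_derivative f') (at x) \<Longrightarrow> frechet_derivative f (at x) = f'"
  using frechet_derivative_at by metis

lemma differentiable_cong_open:
  assumes "open S" "x \<in> S" "\<And>y. y \<in> S \<Longrightarrow> f y = g y" "f differentiable (at x)"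
  shows "g differentiable (at x)" "frechet_derivative g (at x) = frechet_derivative f (at x)"
proof -
  have "(g has_derivative frechet_derivative f (at x)) (at x)"
    using has_derivative_transform_within_open[OF has_frechet_derivative[OF assms(4)] assms(1,2)] assms(3)
    by auto
  then show "g differentiable (at x)" "frechet_derivative g (at x) = frechet_derivative f (at x)"
    by (auto simp: differentiable_def intro: frechet_derivative_eqI)
qed

text \<open>Openness of \<open>S\<close> makes the derivative at a point of \<open>S\<close> depend
  only on the values on \<open>S\<close>, so the derivatives of the two functions agree there and
  the induction can vary both functions.\<close>

lemma Ck_on_cong:
  assumes "open S" "\<And>y. y \<in> S \<Longrightarrow> f y = g y" "Ck_on k f S"
  shows "Ck_on k g S"
  using assms(2,3)
proof (induction k arbitrary: f g)
  case 0
  then show ?case using continuous_on_cong[of S S f g] by auto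
next
  case (Suc k)
  have eq: "frechet_derivative g (at x) = frechet_derivative f (at x)" if "x \<in> S" for x
    using differentiable_cong_open(2)[OF assms(1) that] Suc.prems that by auto
  have "Ck_on k (\<lambda>x. frechet_derivative g (at x) v) S" for v
    by (rule Suc.IH[of "\<lambda>x. frechet_derivative f (at x) v"]) (use Suc.prems eq in auto)
  moreover have "g differentiable (at x)" if "x \<in> S" for x
    using differentiable_cong_open(1)[OF assms(1) that] Suc.prems that by auto
  ultimately show ?case by auto
qed

lemma Ck_on_subset: "Ck_on k f S \<Longrightarrow> T \<subseteq> S \<Longrightarrow> Ck_on k f T"
  by (induction k arbitrary: f) (auto intro: continuous_on_subset)

lemma Ck_on_Suc_imp: "Ck_on (Suc k) f S \<Longrightarrow> Ck_on k f S"
proof (induction k arbitrary: f)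
  case 0
  then have "isCont f x" if "x \<in> S" for x
    using that differentiable_imp_continuous_within by auto
  then show ?case by (simp add: continuous_at_imp_continuous_on)
next
  case (Suc k)
  then show ?case by (metis Ck_on.simps(2))
qed

lemma Ck_on_mono: "Ck_on k f S \<Longrightarrow> j \<le> k \<Longrightarrow> Ck_on j f S"
  by (induction k) (auto simp del: Ck_on.simps simp: le_Suc_eq intro: Ck_on_Suc_imp)

lemma Ck_on_local:
  assumes "\<And>x. x \<in> S \<Longrightarrow> \<exists>T. open T \<and> x \<in> T \<and> Ck_on k f T"
  shows "Ck_on k f S"
  using assms
proof (induction k arbitrary: f)
  case 0
  have "isCont f x" if "x \<in> S" for x
    using 0[OF that] by (auto simp: continuous_on_eq_continuous_at)
  then show ?case by (simp add: continuous_at_imp_continuous_on)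
next
  case (Suc k)
  have "f differentiable (at x)" if "x \<in> S" for x
    using Suc.prems[OF that] by auto
  moreover have "Ck_on k (\<lambda>x. frechet_derivative f (at x) v) S" for v
    by (rule Suc.IH) (use Suc.prems in fastforce)
  ultimately show ?case by auto
qed

lemma Ck_on_const: "Ck_on k (\<lambda>x. c) S"
  by (induction k arbitrary: c) auto

lemma Ck_on_bounded_linear:
  assumes "bounded_linear L" shows "Ck_on k L S"
proof (cases k)
  case 0
  then show ?thesis using assms by (simp add: linear_continuous_on)
next
  case (Suc j)
  have "frechet_derivative L (at x) = L" for x
    by (intro frechet_derivative_eqI bounded_linear_imp_has_derivative assms)
  then show ?thesis
    using Suc assms by (auto simp: Ck_on_const intro: bounded_linear_imp_differentiable)
qed


lemma Ck_on_linear_image: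
  assumes "bounded_linear L" "open S" "Ck_on k f S"
  shows "Ck_on k (\<lambda>x. L (f x)) S"
  using assms(3)
proof (induction k arbitrary: f)
  case 0
  then show ?case
    using continuous_on_compose[OF _ linear_continuous_on[OF assms(1)]] by (auto simp: o_def)
next
  case (Suc k)
  have d: "((\<lambda>x. L (f x)) has_derivative (\<lambda>v. L (frechet_derivative f (at x) v))) (at x)" if "x \<in> S" for x
    using bounded_linear.has_derivative[OF assms(1) has_frechet_derivative] Suc.prems that by auto
  have "Ck_on k (\<lambda>x. frechet_derivative (\<lambda>x. L (f x)) (at x) v) S" for v
    by (rule Ck_on_cong[OF assms(2) _ Suc.IH[of "\<lambda>x. frechet_derivative f (at x) v"]])
       (use Suc.prems frechet_derivative_eqI[OF d] in auto)
  then show ?case using d by (auto simp: differentiable_def)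
qed

lemma Ck_on_add:
  assumes "open S" "Ck_on k f S" "Ck_on k g S"
  shows "Ck_on k (\<lambda>x. f x + g x) S"
  using assms(2,3)
proof (induction k arbitrary: f g)
  case 0
  then show ?case by (auto intro: continuous_on_add)
next
  case (Suc k)
  have d: "((\<lambda>x. f x + g x) has_derivative
      (\<lambda>v. frechet_derivative f (at x) v + frechet_derivative g (at x) v)) (at x)" if "x \<in> S" for x
    using Suc.prems that by (auto intro!: has_derivative_add has_frechet_derivative)
  have "Ck_on k (\<lambda>x. frechet_derivative (\<lambda>x. f x + g x) (at x) v) S" for v
    by (rule Ck_on_cong[OF assms(1) _ Suc.IH[of "\<lambda>x. frechet_derivative f (at x) v"
          "\<lambda>x. frechet_derivative g (at x) v"]])
       (use Suc.prems frechet_derivative_eqI[OF d] in auto)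
  then show ?case using d by (auto simp: differentiable_def)
qed

lemma Ck_on_sum:
  assumes "open S" "\<And>i. i \<in> I \<Longrightarrow> Ck_on k (f i) S"
  shows "Ck_on k (\<lambda>x. \<Sum>i\<in>I. f i x) S"
  using assms(2)
  by (induction I rule: infinite_finite_induct) (auto intro: Ck_on_const Ck_on_add assms(1))

lemma Ck_on_bilinear:
  assumes "bounded_bilinear B" "open S" "Ck_on k f S" "Ck_on k g S"
  shows "Ck_on k (\<lambda>x. B (f x) (g x)) S"
  using assms(3,4)
proof (induction k arbitrary: f g)
  case 0
  then show ?case using bounded_bilinear.continuous_on[OF assms(1)] by auto
next
  case (Suc k)
  have d: "((\<lambda>x. B (f x) (g x)) has_derivative
      (\<lambda>v. B (f x) (frechet_derivative g (at x) v) + B (frechet_derivative f (at x) v) (g x))) (at x)"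
    if "x \<in> S" for x
    using Suc.prems that by (auto intro!: bounded_bilinear.FDERIV[OF assms(1)] has_frechet_derivative)
  have "Ck_on k (\<lambda>x. frechet_derivative (\<lambda>x. B (f x) (g x)) (at x) v) S" for v
  proof (rule Ck_on_cong[OF assms(2)])
    show "Ck_on k (\<lambda>x. B (f x) (frechet_derivative g (at x) v) + B (frechet_derivative f (at x) v) (g x)) S"
      using Suc.prems Suc.IH Ck_on_Suc_imp[OF Suc.prems(1)] Ck_on_Suc_imp[OF Suc.prems(2)]
      by (intro Ck_on_add assms) auto
  qed (use frechet_derivative_eqI[OF d] in auto)
  then show ?case using d by (auto simp: differentiable_def)
qed

lemma frechet_derivative_expand:
  fixes f :: "'a::euclidean_space \<Rightarrow> 'b::real_normed_vector"
  assumes "f differentiable (at x)"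
  shows "frechet_derivative f (at x) v = (\<Sum>b\<in>Basis. (v \<bullet> b) *\<^sub>R frechet_derivative f (at x) b)"
proof -
  have l: "linear (frechet_derivative f (at x))" by (rule linear_frechet_derivative[OF assms])
  have "frechet_derivative f (at x) (\<Sum>b\<in>Basis. (v \<bullet> b) *\<^sub>R b) =
      (\<Sum>b\<in>Basis. (v \<bullet> b) *\<^sub>R frechet_derivative f (at x) b)"
    by (simp only: linear_sum[OF l] linear_scale[OF l])
  then show ?thesis by (simp only: euclidean_representation)
qed

text \<open>By the chain rule the derivative in direction \<open>v\<close> is the derivative of
  \<open>F\<close> at \<open>G x\<close> applied to a vector that moves with \<open>x\<close>.
  Expanding this vector in the standard basis separates the two dependences: a finite sum of
  coordinates of the derivative of \<open>G\<close> times partial derivatives of \<open>F\<close>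
  composed with the same \<open>G\<close>, to which the induction applies.\<close>

lemma Ck_on_compose:
  fixes F :: "'b::euclidean_space \<Rightarrow> 'c::real_normed_vector"
  assumes "open S" "open T" "Ck_on k F S" "Ck_on k G T" "G ` T \<subseteq> S"
  shows "Ck_on k (\<lambda>x. F (G x)) T"
  using assms(3,4)
proof (induction k arbitrary: F)
  case 0
  then show ?case using continuous_on_compose2[of S F T G] assms(5) by auto
next
  case (Suc k)
  have d: "((\<lambda>x. F (G x)) has_derivative
      (\<lambda>v. frechet_derivative F (at (G x)) (frechet_derivative G (at x) v))) (at x)" if "x \<in> T" for x
    using diff_chain_at[OF has_frechet_derivative has_frechet_derivative, of G x F] Suc.prems that assms(5)
    by (auto simp: o_def)
  have eq: "frechet_derivative (\<lambda>x. F (G x)) (at x) v =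
      (\<Sum>b\<in>Basis. (frechet_derivative G (at x) v \<bullet> b) *\<^sub>R frechet_derivative F (at (G x)) b)"
    if x: "x \<in> T" for x v
    unfolding frechet_derivative_eqI[OF d[OF x]]
    by (rule frechet_derivative_expand) (use Suc.prems(1) assms(5) x in auto)
  have "Ck_on k (\<lambda>x. frechet_derivative (\<lambda>x. F (G x)) (at x) v) T" for v
  proof (rule Ck_on_cong[OF assms(2)])
    show "Ck_on k (\<lambda>x. \<Sum>b\<in>Basis. (frechet_derivative G (at x) v \<bullet> b) *\<^sub>R frechet_derivative F (at (G x)) b) T"
      using Suc.prems Ck_on_Suc_imp[OF Suc.prems(2)]
      by (intro Ck_on_sum assms(2) Ck_on_bilinear[OF bounded_bilinear_scaleR] Suc.IH
          Ck_on_linear_image[OF bounded_linear_inner_left]) auto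
  qed (use eq in auto)
  then show ?case using d by (auto simp: differentiable_def)
qed

lemma Cinf_on_cong: "open S \<Longrightarrow> (\<And>y. y \<in> S \<Longrightarrow> f y = g y) \<Longrightarrow> Cinf_on f S \<Longrightarrow> Cinf_on g S"
  unfolding Cinf_on_def using Ck_on_cong by blast

lemma Cinf_on_subset: "Cinf_on f S \<Longrightarrow> T \<subseteq> S \<Longrightarrow> Cinf_on f T"
  unfolding Cinf_on_def using Ck_on_subset by blast

lemma Cinf_on_local: "(\<And>x. x \<in> S \<Longrightarrow> \<exists>T. open T \<and> x \<in> T \<and> Cinf_on f T) \<Longrightarrow> Cinf_on f S"
  unfolding Cinf_on_def using Ck_on_local by metis

lemma Cinf_on_const: "Cinf_on (\<lambda>x. c) S"
  unfolding Cinf_on_def using Ck_on_const by blast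

lemma Cinf_on_bounded_linear: "bounded_linear L \<Longrightarrow> Cinf_on L S"
  unfolding Cinf_on_def using Ck_on_bounded_linear by blast

lemma Cinf_on_linear_image: "bounded_linear L \<Longrightarrow> open S \<Longrightarrow> Cinf_on f S \<Longrightarrow> Cinf_on (\<lambda>x. L (f x)) S"
  unfolding Cinf_on_def using Ck_on_linear_image by blast

lemma Cinf_on_add: "open S \<Longrightarrow> Cinf_on f S \<Longrightarrow> Cinf_on g S \<Longrightarrow> Cinf_on (\<lambda>x. f x + g x) S"
  unfolding Cinf_on_def using Ck_on_add by blast

lemma Cinf_on_sum: "open S \<Longrightarrow> (\<And>i. i \<in> I \<Longrightarrow> Cinf_on (f i) S) \<Longrightarrow> Cinf_on (\<lambda>x. \<Sum>i\<in>I. f i x) S"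
  unfolding Cinf_on_def by (intro allI Ck_on_sum) auto

lemma Cinf_on_bilinear:
  "bounded_bilinear B \<Longrightarrow> open S \<Longrightarrow> Cinf_on f S \<Longrightarrow> Cinf_on g S \<Longrightarrow> Cinf_on (\<lambda>x. B (f x) (g x)) S"
  unfolding Cinf_on_def using Ck_on_bilinear[of B S _ f g] by simp

lemma Cinf_on_compose:
  fixes F :: "'b::euclidean_space \<Rightarrow> 'c::real_normed_vector"
  shows "open S \<Longrightarrow> open T \<Longrightarrow> Cinf_on F S \<Longrightarrow> Cinf_on G T \<Longrightarrow> G ` T \<subseteq> S \<Longrightarrow> Cinf_on (\<lambda>x. F (G x)) T"
  unfolding Cinf_on_def using Ck_on_compose[of S T _ F G] by simp

lemma Cinf_on_differentiable: "Cinf_on f S \<Longrightarrow> x \<in> S \<Longrightarrow> f differentiable (at x)"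
  unfolding Cinf_on_def by (metis Ck_on.simps(2))

lemma Cinf_on_frechet: "Cinf_on f S \<Longrightarrow> Cinf_on (\<lambda>x. frechet_derivative f (at x) v) S"
  unfolding Cinf_on_def by (metis Ck_on.simps(2))

lemma Cinf_on_continuous: "Cinf_on f S \<Longrightarrow> continuous_on S f"
  unfolding Cinf_on_def by (metis Ck_on.simps(1))

lemma Cinf_on_has_derivative:
  "Cinf_on f S \<Longrightarrow> x \<in> S \<Longrightarrow> (f has_derivative frechet_derivative f (at x)) (at x)"
  by (intro has_frechet_derivative Cinf_on_differentiable)

lemma Cinf_on_linear_frechet: "Cinf_on f S \<Longrightarrow> x \<in> S \<Longrightarrow> linear (frechet_derivative f (at x))"
  by (intro linear_frechet_derivative Cinf_on_differentiable)

subsection \<open>Differentiation under the integral sign\<close>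

text \<open>The derivative packaged as an element of the normed space of bounded linear maps,
  because \<open>leibniz_rule\<close> asks for a derivative that is continuous with values
  there.\<close>

definition blin_frechet :: "('a::euclidean_space \<Rightarrow> 'b::euclidean_space) \<Rightarrow> 'a \<Rightarrow> 'a \<Rightarrow>\<^sub>L 'b" where
  "blin_frechet f x = Blinfun (frechet_derivative f (at x))"

lemma blin_frechet_apply:
  "f differentiable (at x) \<Longrightarrow> blinfun_apply (blin_frechet f x) = frechet_derivative f (at x)"
  unfolding blin_frechet_def
  by (rule bounded_linear_Blinfun_apply) (auto intro: has_derivative_bounded_linear has_frechet_derivative)

lemma continuous_on_blin_frechet:
  fixes f :: "'a::euclidean_space \<Rightarrow> 'b::euclidean_space"
  assumes "Ck_on (Suc 0) f S"
  shows "continuous_on S (blin_frechet f)"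
proof (rule continuous_on_blinfun_componentwise)
  fix i :: 'a assume "i \<in> Basis"
  have "continuous_on S (\<lambda>x. frechet_derivative f (at x) i)" using assms by auto
  then show "continuous_on S (\<lambda>x. blinfun_apply (blin_frechet f x) i)"
    by (rule continuous_on_eq) (use assms in \<open>auto simp: blin_frechet_apply\<close>)
qed

lemma segment_point_in_ball:
  fixes x x0 :: "'a::real_normed_vector"
  assumes "x \<in> ball x0 r" "0 \<le> t" "t \<le> 1"
  shows "x0 + t *\<^sub>R (x - x0) \<in> ball x0 r"
proof -
  have "norm (t *\<^sub>R (x - x0)) \<le> norm (x - x0)" using assms by (simp add: mult_left_le_one_le)
  then show ?thesis using assms by (simp add: dist_norm norm_minus_commute)
qed

text \<open>Moving \<open>x\<close> moves the point at parameter \<open>t\<close> only by the factor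
  \<open>t\<close>; this is why differentiation raises the exponent from \<open>m\<close> to
  \<open>Suc m\<close>.\<close>

lemma integral_segment_derivative:
  fixes F :: "'a::euclidean_space \<Rightarrow> 'b::euclidean_space"
  assumes F: "Ck_on (Suc 0) F (ball x0 r)" and x: "x \<in> ball x0 r"
  shows "((\<lambda>x. integral {0..1} (\<lambda>t. t^m *\<^sub>R F (x0 + t *\<^sub>R (x - x0)))) has_derivative
    (\<lambda>v. integral {0..1} (\<lambda>t. t^Suc m *\<^sub>R frechet_derivative F (at (x0 + t *\<^sub>R (x - x0))) v))) (at x)"
proof -
  let ?B = "ball x0 r"
  let ?p = "\<lambda>x t. x0 + t *\<^sub>R (x - x0)"
  have p: "?p x t \<in> ?B" if "x \<in> ?B" "t \<in> cbox 0 1" for x and t::real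
    using segment_point_in_ball that by auto
  have Fd: "F differentiable (at y)" if "y \<in> ?B" for y using F that by auto
  have contF: "continuous_on ?B F" using Ck_on_Suc_imp[OF F] by simp
  let ?fx = "\<lambda>x t. (t^Suc m) *\<^sub>R blin_frechet F (?p x t)"
  have contfx: "continuous_on (?B \<times> cbox 0 1) (\<lambda>(x,t). ?fx x t)"
    unfolding split_beta
    by (intro continuous_intros continuous_on_compose2[OF continuous_on_blin_frechet[OF F]])
       (use p in auto)
  have "((\<lambda>x. integral (cbox 0 1) (\<lambda>t. t^m *\<^sub>R F (?p x t))) has_derivative
      blinfun_apply (integral (cbox 0 1) (?fx x))) (at x within ?B)"
  proof (rule leibniz_rule[OF _ _ contfx x convex_ball])
    fix y and t :: real assume yt: "y \<in> ?B" "t \<in> cbox 0 1"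
    have "((\<lambda>y. t^m *\<^sub>R F (?p y t)) has_derivative
        (\<lambda>v. t^m *\<^sub>R frechet_derivative F (at (?p y t)) (t *\<^sub>R v))) (at y)"
      by (rule derivative_eq_intros diff_chain_at[where f="\<lambda>y. ?p y t", unfolded o_def] has_frechet_derivative refl
          Fd[OF p[OF yt]] | simp)+
    moreover have "frechet_derivative F (at (?p y t)) (t *\<^sub>R v) = t *\<^sub>R frechet_derivative F (at (?p y t)) v" for v
      using linear_scale[OF linear_frechet_derivative[OF Fd[OF p[OF yt]]]] .
    ultimately have "((\<lambda>y. t^m *\<^sub>R F (?p y t)) has_derivative blinfun_apply (?fx y t)) (at y)"
      by (simp add: scaleR_blinfun.rep_eq blin_frechet_apply[OF Fd[OF p[OF yt]]] power_commutes)
    then show "((\<lambda>y. t^m *\<^sub>R F (?p y t)) has_derivative blinfun_apply (?fx y t)) (at y within ?B)"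
      by (rule has_derivative_at_withinI)
  next
    fix y assume y: "y \<in> ?B"
    show "(\<lambda>t. t^m *\<^sub>R F (?p y t)) integrable_on cbox 0 1"
      by (intro integrable_continuous continuous_intros continuous_on_compose2[OF contF]) (use p y in auto)
  qed
  moreover have val: "blinfun_apply (integral (cbox 0 1) (?fx x)) v =
      integral {0..1} (\<lambda>t. t^Suc m *\<^sub>R frechet_derivative F (at (?p x t)) v)" for v
  proof -
    have "?fx x integrable_on cbox 0 1"
      by (intro integrable_continuous continuous_intros continuous_on_compose2[OF continuous_on_blin_frechet[OF F]])
         (use p x in auto)
    then have "blinfun_apply (integral (cbox 0 1) (?fx x)) v = integral (cbox 0 1) (\<lambda>t. blinfun_apply (?fx x t) v)"
      by (rule blinfun_apply_integral)
    also have "\<dots> = integral {0..1} (\<lambda>t. t^Suc m *\<^sub>R frechet_derivative F (at (?p x t)) v)"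
      unfolding cbox_interval
      by (rule integral_cong) (use p x in \<open>auto simp: scaleR_blinfun.rep_eq blin_frechet_apply[OF Fd]\<close>)
    finally show ?thesis .
  qed
  moreover have "blinfun_apply (integral (cbox 0 1) (?fx x)) =
      (\<lambda>v. integral {0..1} (\<lambda>t. t^Suc m *\<^sub>R frechet_derivative F (at (?p x t)) v))"
    by (rule ext) (rule val)
  ultimately show ?thesis by (simp only: at_within_open[OF x open_ball] cbox_interval)
qed

text \<open>The exponent is left free because each differentiation trades \<open>F\<close> and
  \<open>m\<close> for a partial derivative of \<open>F\<close> and \<open>Suc m\<close>.\<close>

lemma Ck_on_integral_segment:
  fixes F :: "'a::euclidean_space \<Rightarrow> 'b::euclidean_space"
  assumes "Ck_on k F (ball x0 r)"
  shows "Ck_on k (\<lambda>x. integral {0..1} (\<lambda>t. t^m *\<^sub>R F (x0 + t *\<^sub>R (x - x0)))) (ball x0 r)"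
  using assms
proof (induction k arbitrary: F m)
  case 0
  then have "continuous_on (ball x0 r) F" by simp
  then have "continuous_on (ball x0 r \<times> cbox 0 1) (\<lambda>z. F (x0 + snd z *\<^sub>R (fst z - x0)))"
  proof (rule continuous_on_compose2)
    show "continuous_on (ball x0 r \<times> cbox 0 (1::real)) (\<lambda>z. x0 + snd z *\<^sub>R (fst z - x0))"
      by (intro continuous_intros)
    show "(\<lambda>z. x0 + snd z *\<^sub>R (fst z - x0)) ` (ball x0 r \<times> cbox 0 1) \<subseteq> ball x0 r"
      using segment_point_in_ball[of _ x0 r] by (auto simp del: mem_ball)
  qed
  then have "continuous_on (ball x0 r \<times> cbox 0 1) (\<lambda>(x,t). t^m *\<^sub>R F (x0 + t *\<^sub>R (x - x0)))"
    unfolding split_beta by (intro continuous_intros)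
  then have "continuous_on (ball x0 r) (\<lambda>x. integral (cbox 0 1) (\<lambda>t::real. t^m *\<^sub>R F (x0 + t *\<^sub>R (x - x0))))"
    by (rule integral_continuous_on_param)
  then show ?case by simp
next
  case (Suc k)
  have F0: "Ck_on (Suc 0) F (ball x0 r)"
    by (rule Ck_on_mono[OF Suc.prems]) simp
  note d = integral_segment_derivative[OF F0]
  have "Ck_on k (\<lambda>x. frechet_derivative (\<lambda>x. integral {0..1} (\<lambda>t. t^m *\<^sub>R F (x0 + t *\<^sub>R (x - x0)))) (at x) v) (ball x0 r)" for v
    by (rule Ck_on_cong[OF open_ball _ Suc.IH[of "\<lambda>x. frechet_derivative F (at x) v" "Suc m"]])
       (use frechet_derivative_eqI[OF d] Suc.prems in auto)
  then show ?case using d unfolding Ck_on.simps differentiable_def by blast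
qed

text \<open>Integrate the derivative of \<open>F\<close> along the segment from \<open>x0\<close> to
  \<open>x\<close>; \<open>G b\<close> is the integral of the partial derivative in direction
  \<open>b\<close>. The expansion is exact and has smooth coefficients, so a derivation of germs can
  be applied to it term by term.\<close>

lemma Hadamard:
  fixes F :: "'a::euclidean_space \<Rightarrow> 'b::euclidean_space"
  assumes F: "Cinf_on F (ball x0 r)" and "r > 0"
  shows "\<exists>G. (\<forall>b\<in>Basis. Cinf_on (G b) (ball x0 r) \<and> G b x0 = frechet_derivative F (at x0) b) \<and>
    (\<forall>x\<in>ball x0 r. F x = F x0 + (\<Sum>b\<in>Basis. ((x - x0) \<bullet> b) *\<^sub>R G b x))"
proof (intro exI conjI ballI)
  \<comment> \<open>The factor \<open>t^0\<close> is 1 and only brings the integrand into the form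
    of \<open>Ck_on_integral_segment\<close>.\<close>
  let ?G = "\<lambda>b x. integral {0..1} (\<lambda>t. t^0 *\<^sub>R frechet_derivative F (at (x0 + t *\<^sub>R (x - x0))) b)"
  fix b :: 'a assume "b \<in> Basis"
  show "Cinf_on (?G b) (ball x0 r)"
    unfolding Cinf_on_def
    by (intro allI Ck_on_integral_segment) (use Cinf_on_frechet[OF F] in \<open>auto simp: Cinf_on_def\<close>)
  show "?G b x0 = frechet_derivative F (at x0) b" by simp
next
  let ?G = "\<lambda>b x. integral {0..1} (\<lambda>t. t^0 *\<^sub>R frechet_derivative F (at (x0 + t *\<^sub>R (x - x0))) b)"
  fix x assume x: "x \<in> ball x0 r"
  let ?p = "\<lambda>t. x0 + t *\<^sub>R (x - x0)"
  have p: "?p t \<in> ball x0 r" if "t \<in> {0..1}" for t using segment_point_in_ball[OF x] that by auto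
  have "((\<lambda>t. F (?p t)) has_vector_derivative frechet_derivative F (at (?p t)) (x - x0)) (at t within {0..1})"
    if "t \<in> {0..1}" for t
  proof -
    have "(?p has_derivative (\<lambda>s. s *\<^sub>R (x - x0))) (at t)"
      by (auto intro!: derivative_eq_intros)
    from diff_chain_at[OF this Cinf_on_has_derivative[OF F p[OF that]]]
    have "((\<lambda>t. F (?p t)) has_derivative (\<lambda>s. frechet_derivative F (at (?p t)) (s *\<^sub>R (x - x0)))) (at t)"
      by (simp add: o_def)
    then show ?thesis
      using linear_scale[OF Cinf_on_linear_frechet[OF F p[OF that]]]
      by (auto simp: has_vector_derivative_def intro: has_derivative_at_withinI)
  qed
  then have "((\<lambda>t. frechet_derivative F (at (?p t)) (x - x0)) has_integral F (?p 1) - F (?p 0)) {0..1}"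
    by (intro fundamental_theorem_of_calculus) auto
  then have "F x - F x0 = integral {0..1} (\<lambda>t. frechet_derivative F (at (?p t)) (x - x0))"
    by (simp add: integral_unique)
  also have "\<dots> = integral {0..1} (\<lambda>t. \<Sum>b\<in>Basis. ((x - x0) \<bullet> b) *\<^sub>R frechet_derivative F (at (?p t)) b)"
    by (rule integral_cong) (use frechet_derivative_expand[OF Cinf_on_differentiable[OF F p]] in auto)
  also have "\<dots> = (\<Sum>b\<in>Basis. integral {0..1} (\<lambda>t. ((x - x0) \<bullet> b) *\<^sub>R frechet_derivative F (at (?p t)) b))"
  proof (intro integral_sum integrable_continuous_real continuous_intros)
    fix b :: 'a
    show "continuous_on {0..1} (\<lambda>t. frechet_derivative F (at (?p t)) b)"
      by (rule continuous_on_compose2[OF Cinf_on_continuous[OF Cinf_on_frechet[OF F]], where f="?p"])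
         (use p in \<open>auto intro!: continuous_intros\<close>)
  qed auto
  finally show "F x = F x0 + (\<Sum>b\<in>Basis. ((x - x0) \<bullet> b) *\<^sub>R ?G b x)"
    by (simp add: diff_eq_eq add.commute)
qed

text \<open>Differentiate the increment of \<open>F\<close> in direction \<open>w\<close>, written as an integral over a segment, in direction \<open>v\<close>.\<close>

lemma second_derivative_symmetric:
  fixes F :: "'a::euclidean_space \<Rightarrow> 'b::euclidean_space"
  assumes F: "Cinf_on F S" and S: "open S" "x \<in> S"
  shows "frechet_derivative (\<lambda>y. frechet_derivative F (at y) v) (at x) w =
    frechet_derivative (\<lambda>y. frechet_derivative F (at y) w) (at x) v"
proof -
  let ?G = "\<lambda>y. frechet_derivative F (at y) w"
  let ?H = "\<lambda>y. frechet_derivative F (at y) v"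
  obtain r0 where r0: "r0 > 0" "ball x r0 \<subseteq> S" using S openE by blast
  \<comment> \<open>Half the radius, since a point of \<open>ball x r\<close> gets displaced by a
    multiple of \<open>w\<close> of norm at most \<open>r\<close> and must stay within
    \<open>r0\<close> of \<open>x\<close>.\<close>
  define r where "r = r0 / 2"
  have r: "r > 0" using r0 by (simp add: r_def)
  \<comment> \<open>The summand 1 keeps the quotient meaningful for \<open>w = 0\<close>.\<close>
  define \<epsilon> where "\<epsilon> = r / (norm w + 1)"
  have nw: "norm w + 1 > 0" by (simp add: add_nonneg_pos)
  have \<epsilon>: "\<epsilon> > 0" using r nw by (simp add: \<epsilon>_def)
  have inS: "y + t *\<^sub>R w \<in> S" if "y \<in> ball x r" "\<bar>t\<bar> \<le> \<epsilon>" for y t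
  proof -
    have "norm (t *\<^sub>R w) \<le> \<epsilon> * norm w" using that by (simp add: mult_right_mono)
    also have "\<dots> \<le> r" using r nw by (simp add: \<epsilon>_def field_simps)
    finally have "dist x (y + t *\<^sub>R w) < r0"
      using that norm_triangle_ineq4[of "x - y" "t *\<^sub>R w"] by (simp add: dist_norm r_def algebra_simps)
    then show ?thesis using r0 by auto
  qed
  have G: "Cinf_on ?G S" and H: "Cinf_on ?H S" by (rule Cinf_on_frechet[OF F])+
  have line: "((\<lambda>s. K (y + s *\<^sub>R w)) has_vector_derivative frechet_derivative K (at (y + s *\<^sub>R w)) w) (at s within T)"
    if K: "Cinf_on K S" and "y + s *\<^sub>R w \<in> S" for K :: "'a \<Rightarrow> 'b" and y s T
  proof -
    have "((\<lambda>s. y + s *\<^sub>R w) has_derivative (\<lambda>u. u *\<^sub>R w)) (at s)"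
      by (auto intro!: derivative_eq_intros)
    from diff_chain_at[OF this Cinf_on_has_derivative[OF that]]
    have "((\<lambda>s. K (y + s *\<^sub>R w)) has_derivative (\<lambda>u. frechet_derivative K (at (y + s *\<^sub>R w)) (u *\<^sub>R w))) (at s)"
      by (simp add: o_def)
    then show ?thesis using linear_scale[OF Cinf_on_linear_frechet[OF that]]
      by (auto simp: has_vector_derivative_def intro: has_derivative_at_withinI)
  qed
  define I where "I t = integral {0..t} (\<lambda>s. frechet_derivative ?G (at (x + s *\<^sub>R w)) v)" for t
  have incr: "F (y + t *\<^sub>R w) - F y = integral {0..t} (\<lambda>s. ?G (y + s *\<^sub>R w))"
    if "y \<in> ball x r" "0 \<le> t" "t \<le> \<epsilon>" for y t
  proof -
    have "((\<lambda>s. ?G (y + s *\<^sub>R w)) has_integral F (y + t *\<^sub>R w) - F (y + 0 *\<^sub>R w)) {0..t}"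
      by (rule fundamental_theorem_of_calculus[OF that(2)])
         (use that in \<open>auto intro!: line[OF F] inS\<close>)
    then show ?thesis by (simp add: integral_unique)
  qed
  have HI: "?H (x + t *\<^sub>R w) - ?H x = I t" if t: "0 \<le> t" "t \<le> \<epsilon>" for t
  proof -
    let ?B = "ball x r"
    have xB: "x \<in> ?B" using r by simp
    have inB: "y + s *\<^sub>R w \<in> S" if "y \<in> ?B" "s \<in> cbox 0 t" for y s
      using inS that t by auto
    let ?fx = "\<lambda>y s. blin_frechet ?G (y + s *\<^sub>R w)"
    have G1: "Ck_on (Suc 0) ?G S" using G unfolding Cinf_on_def by blast
    have cont: "continuous_on (?B \<times> cbox 0 t) (\<lambda>(y,s). ?fx y s)"
      unfolding split_beta
      by (rule continuous_on_compose2[OF continuous_on_blin_frechet[OF G1]])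
         (use inB in \<open>auto intro!: continuous_intros\<close>)
    have "((\<lambda>y. integral (cbox 0 t) (\<lambda>s. ?G (y + s *\<^sub>R w))) has_derivative
        blinfun_apply (integral (cbox 0 t) (?fx x))) (at x within ?B)"
    proof (rule leibniz_rule[OF _ _ cont xB convex_ball])
      fix y s assume ys: "y \<in> ?B" "s \<in> cbox 0 t"
      have "((\<lambda>y. y + s *\<^sub>R w) has_derivative (\<lambda>u. u)) (at y)"
        by (auto intro!: derivative_eq_intros)
      from diff_chain_at[OF this Cinf_on_has_derivative[OF G inB[OF ys]]]
      show "((\<lambda>y. ?G (y + s *\<^sub>R w)) has_derivative blinfun_apply (?fx y s)) (at y within ?B)"
        using blin_frechet_apply[OF Cinf_on_differentiable[OF G inB[OF ys]]]
        by (auto simp: o_def intro: has_derivative_at_withinI)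
    next
      fix y assume y: "y \<in> ?B"
      show "(\<lambda>s. ?G (y + s *\<^sub>R w)) integrable_on cbox 0 t"
        by (intro integrable_continuous continuous_on_compose2[OF Cinf_on_continuous[OF G]])
           (use inB y in \<open>auto intro!: continuous_intros\<close>)
    qed
    then have 1: "((\<lambda>y. integral {0..t} (\<lambda>s. ?G (y + s *\<^sub>R w))) has_derivative
        blinfun_apply (integral {0..t} (?fx x))) (at x)"
      by (simp only: at_within_open[OF xB open_ball] cbox_interval)
    have "((\<lambda>y. y + t *\<^sub>R w) has_derivative (\<lambda>u. u)) (at x)"
      by (auto intro!: derivative_eq_intros)
    from diff_chain_at[OF this Cinf_on_has_derivative[OF F]] inB[OF xB, of t] t
    have "((\<lambda>y. F (y + t *\<^sub>R w)) has_derivative frechet_derivative F (at (x + t *\<^sub>R w))) (at x)"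
      by (simp add: o_def)
    then have "((\<lambda>y. F (y + t *\<^sub>R w) - F y) has_derivative
        (\<lambda>u. frechet_derivative F (at (x + t *\<^sub>R w)) u - frechet_derivative F (at x) u)) (at x)"
      by (intro has_derivative_diff Cinf_on_has_derivative[OF F S(2)])
    then have "((\<lambda>y. integral {0..t} (\<lambda>s. ?G (y + s *\<^sub>R w))) has_derivative
        (\<lambda>u. frechet_derivative F (at (x + t *\<^sub>R w)) u - frechet_derivative F (at x) u)) (at x)"
      by (rule has_derivative_transform_within_open[OF _ open_ball xB]) (use incr t in auto)
    from has_derivative_unique[OF this 1]
    have "?H (x + t *\<^sub>R w) - ?H x = blinfun_apply (integral {0..t} (?fx x)) v" by metis
    also have "\<dots> = integral {0..t} (\<lambda>s. blinfun_apply (?fx x s) v)"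
    proof (rule blinfun_apply_integral)
      show "?fx x integrable_on {0..t}"
        by (intro integrable_continuous_real continuous_on_compose2[OF continuous_on_blin_frechet[OF G1]])
           (use inB xB in \<open>auto intro!: continuous_intros\<close>)
    qed
    also have "\<dots> = I t"
      unfolding I_def
      by (rule integral_cong) (use blin_frechet_apply[OF Cinf_on_differentiable[OF G inB[OF xB]]] in auto)
    finally show ?thesis .
  qed
  have contI: "continuous_on {0..\<epsilon>} (\<lambda>s. frechet_derivative ?G (at (x + s *\<^sub>R w)) v)"
    by (rule continuous_on_compose2[OF Cinf_on_continuous[OF Cinf_on_frechet[OF G]]])
       (use inS r in \<open>auto intro!: continuous_intros\<close>)
  \<comment> \<open>\<open>I\<close> has two one-sided derivatives at 0: its integrand there, by the
    fundamental theorem, and the derivative of \<open>?H\<close> along \<open>w\<close>, by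
    \<open>HI\<close>. Uniqueness equates them.\<close>
  have "(I has_vector_derivative frechet_derivative ?G (at (x + 0 *\<^sub>R w)) v) (at 0 within {0..\<epsilon>})"
    unfolding I_def by (rule integral_has_vector_derivative[OF contI]) (use \<epsilon> in auto)
  moreover have "(I has_vector_derivative frechet_derivative ?H (at (x + 0 *\<^sub>R w)) w) (at 0 within {0..\<epsilon>})"
  proof (rule has_vector_derivative_transform[of _ _ I])
    have "((\<lambda>t. ?H (x + t *\<^sub>R w)) has_vector_derivative frechet_derivative ?H (at (x + 0 *\<^sub>R w)) w) (at 0 within {0..\<epsilon>})"
      by (rule line[OF H]) (use S in auto)
    then show "((\<lambda>t. ?H (x + t *\<^sub>R w) - ?H x) has_vector_derivative frechet_derivative ?H (at (x + 0 *\<^sub>R w)) w) (at 0 within {0..\<epsilon>})"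
      by (auto intro!: derivative_eq_intros)
  qed (use \<epsilon> HI in auto)
  ultimately show ?thesis
    using vector_derivative_unique_within_closed_interval[of 0 \<epsilon> 0 I] \<epsilon> by (metis add_0_right scaleR_zero_left atLeastAtMost_iff
        order_refl less_imp_le cbox_interval)
qed

section \<open>Holomorphic functions of several variables\<close>

lemma sum_Basis_complex_vec:
  "(\<Sum>b\<in>(Basis :: (complex^'n) set). f b) = (\<Sum>i\<in>UNIV. f (axis i 1) + f (axis i \<i>))"
proof -
  have "(Basis :: (complex^'n) set) = (\<Union>i\<in>UNIV. {axis i 1, axis i \<i>})"
    by (auto simp: Basis_vec_def Basis_complex_def)
  then have "(\<Sum>b\<in>(Basis :: (complex^'n) set). f b) = (\<Sum>b\<in>(\<Union>i\<in>UNIV. {axis i 1, axis i \<i>}). f b)"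
    by simp
  also have "\<dots> = (\<Sum>i\<in>UNIV. \<Sum>b\<in>{axis i 1, axis i \<i>}. f b)"
    by (rule sum.UNION_disjoint) (auto simp: axis_eq_axis)
  also have "\<dots> = (\<Sum>i\<in>UNIV. f (axis i 1) + f (axis i \<i>))"
    by (rule sum.cong) (auto simp: axis_eq_axis)
  finally show ?thesis .
qed

lemma holo_on_Cinf: "holo_on f S \<Longrightarrow> Cinf_on f S"
  by (simp add: holo_on_def)

lemma holo_on_i:
  "holo_on f S \<Longrightarrow> x \<in> S \<Longrightarrow> frechet_derivative f (at x) (\<i> *s v) = \<i> * frechet_derivative f (at x) v"
  by (simp add: holo_on_def)

lemma holo_on_subset: "holo_on f S \<Longrightarrow> T \<subseteq> S \<Longrightarrow> holo_on f T"
  unfolding holo_on_def using Cinf_on_subset by blast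

lemma holo_on_cong:
  assumes "open S" "\<And>y. y \<in> S \<Longrightarrow> f y = g y" "holo_on f S"
  shows "holo_on g S"
proof -
  have "frechet_derivative g (at x) = frechet_derivative f (at x)" if "x \<in> S" for x
    using differentiable_cong_open(2)[OF assms(1) that assms(2) Cinf_on_differentiable[OF holo_on_Cinf[OF assms(3)] that]] .
  then show ?thesis
    using assms(3) Cinf_on_cong[OF assms(1,2) holo_on_Cinf[OF assms(3)]] by (simp add: holo_on_def)
qed

lemma holo_onI:
  assumes "Cinf_on f S" "\<And>x v. x \<in> S \<Longrightarrow> \<exists>f'. (f has_derivative f') (at x) \<and> f' (\<i> *s v) = \<i> * f' v"
  shows "holo_on f S"
  unfolding holo_on_def using assms frechet_derivative_eqI by metis

lemma holo_on_has_derivative: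
  "holo_on f S \<Longrightarrow> x \<in> S \<Longrightarrow> (f has_derivative frechet_derivative f (at x)) (at x)"
  by (rule Cinf_on_has_derivative[OF holo_on_Cinf])

lemma holo_on_const: "holo_on (\<lambda>x. c) S"
  by (simp add: holo_on_def Cinf_on_const)

lemma holo_on_coord: "holo_on (\<lambda>x::complex^'n. x $ i) S"
proof (rule holo_onI)
  show "Cinf_on (\<lambda>x::complex^'n. x $ i) S" by (rule Cinf_on_bounded_linear[OF bounded_linear_vec_nth])
  fix x v :: "complex^'n"
  have "((\<lambda>x. x $ i) has_derivative (\<lambda>x. x $ i)) (at x)"
    by (rule bounded_linear_imp_has_derivative[OF bounded_linear_vec_nth])
  then show "\<exists>f'. ((\<lambda>x. x $ i) has_derivative f') (at x) \<and> f' (\<i> *s v) = \<i> * f' v"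
    by auto
qed

lemma holo_on_add:
  assumes "open S" "holo_on f S" "holo_on g S"
  shows "holo_on (\<lambda>x. f x + g x) S"
proof (rule holo_onI)
  show "Cinf_on (\<lambda>x. f x + g x) S" by (intro Cinf_on_add holo_on_Cinf assms)
  fix x v assume x: "x \<in> S"
  show "\<exists>f'. ((\<lambda>x. f x + g x) has_derivative f') (at x) \<and> f' (\<i> *s v) = \<i> * f' v"
    using has_derivative_add[OF holo_on_has_derivative[OF assms(2) x] holo_on_has_derivative[OF assms(3) x]]
      holo_on_i[OF assms(2) x] holo_on_i[OF assms(3) x]
    by (auto simp: algebra_simps)
qed

lemma holo_on_mult:
  assumes "open S" "holo_on f S" "holo_on g S"
  shows "holo_on (\<lambda>x. f x * g x) S"
proof (rule holo_onI)
  show "Cinf_on (\<lambda>x. f x * g x) S"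
    by (intro Cinf_on_bilinear[OF bounded_bilinear_mult] holo_on_Cinf assms)
  fix x v assume x: "x \<in> S"
  show "\<exists>f'. ((\<lambda>x. f x * g x) has_derivative f') (at x) \<and> f' (\<i> *s v) = \<i> * f' v"
    using has_derivative_mult[OF holo_on_has_derivative[OF assms(2) x] holo_on_has_derivative[OF assms(3) x]]
      holo_on_i[OF assms(2) x] holo_on_i[OF assms(3) x]
    by (auto simp: algebra_simps)
qed

lemma Cinf_on_vec:
  fixes G :: "'a::euclidean_space \<Rightarrow> complex^'n"
  assumes "open T" "\<And>i. Cinf_on (\<lambda>x. G x $ i) T"
  shows "Cinf_on G T"
proof -
  have "Cinf_on (\<lambda>x. \<Sum>i\<in>UNIV. axis i (G x $ i)) T"
    by (intro Cinf_on_sum Cinf_on_linear_image[where L = "axis i" for i] assms)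
       (auto simp: axis_def vec_eq_iff intro!: linearI simp flip: linear_conv_bounded_linear)
  moreover have "(\<Sum>i\<in>UNIV. axis i (G x $ i)) = G x" for x
    by (simp add: vec_eq_iff axis_def)
  ultimately show ?thesis by simp
qed

lemma holo_on_compose:
  fixes G :: "complex^'k \<Rightarrow> complex^'n"
  assumes "open S" "open T" "holo_on F S" "\<And>i. holo_on (\<lambda>x. G x $ i) T" "G ` T \<subseteq> S"
  shows "holo_on (\<lambda>x. F (G x)) T"
proof (rule holo_onI)
  have G: "Cinf_on G T" by (rule Cinf_on_vec[OF assms(2)]) (rule holo_on_Cinf[OF assms(4)])
  show "Cinf_on (\<lambda>x. F (G x)) T"
    by (rule Cinf_on_compose[OF assms(1,2) holo_on_Cinf[OF assms(3)] G assms(5)])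
  fix x v assume x: "x \<in> T"
  let ?G = "frechet_derivative G (at x)" and ?F = "frechet_derivative F (at (G x))"
  have dG: "(G has_derivative ?G) (at x)" by (rule Cinf_on_has_derivative[OF G x])
  have Gx: "G x \<in> S" using x assms(5) by auto
  have "?G v $ i = frechet_derivative (\<lambda>x. G x $ i) (at x) v" for i v
    using frechet_derivative_eqI[OF bounded_linear.has_derivative[OF bounded_linear_vec_nth dG]] by metis
  then have "?G (\<i> *s v) = \<i> *s ?G v"
    using holo_on_i[OF assms(4) x] by (simp add: vec_eq_iff)
  then show "\<exists>f'. ((\<lambda>x. F (G x)) has_derivative f') (at x) \<and> f' (\<i> *s v) = \<i> * f' v"
    using diff_chain_at[OF dG holo_on_has_derivative[OF assms(3) Gx]] holo_on_i[OF assms(3) Gx]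
    by (auto simp: o_def)
qed

text \<open>By symmetry of the second derivative the direction \<open>w\<close> may be
  differentiated first, where complex linearity is given; the factor \<i> then passes through the
  derivative in direction \<open>v\<close>.\<close>

lemma holo_on_frechet:
  assumes "holo_on f S" "open S"
  shows "holo_on (\<lambda>x. frechet_derivative f (at x) v) S"
proof -
  note f = holo_on_Cinf[OF assms(1)]
  have "frechet_derivative (\<lambda>x. frechet_derivative f (at x) v) (at x) (\<i> *s w) =
      \<i> * frechet_derivative (\<lambda>x. frechet_derivative f (at x) v) (at x) w" if x: "x \<in> S" for x w
  proof -
    have "frechet_derivative (\<lambda>y. frechet_derivative f (at y) (\<i> *s w)) (at x) =
        frechet_derivative (\<lambda>y. \<i> * frechet_derivative f (at y) w) (at x)"
      by (rule differentiable_cong_open(2)[OF assms(2) x, symmetric])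
         (use holo_on_i[OF assms(1)] Cinf_on_differentiable[OF Cinf_on_frechet[OF f] x] in auto)
    also have "\<dots> = (\<lambda>u. \<i> * frechet_derivative (\<lambda>y. frechet_derivative f (at y) w) (at x) u)"
      by (rule frechet_derivative_eqI)
         (rule has_derivative_mult_right[OF Cinf_on_has_derivative[OF Cinf_on_frechet[OF f] x]])
    finally show ?thesis
      unfolding second_derivative_symmetric[OF f assms(2) x, of v] by metis
  qed
  then show ?thesis using Cinf_on_frechet[OF f] unfolding holo_on_def by blast
qed

lemma Cinf_on_cnj: "open S \<Longrightarrow> Cinf_on f S \<Longrightarrow> Cinf_on (\<lambda>x. cnj (f x)) S"
  by (rule Cinf_on_linear_image[OF bounded_linear_cnj])

lemma Cinf_on_mult:
  fixes f g :: "'a::real_normed_vector \<Rightarrow> complex"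
  shows "open S \<Longrightarrow> Cinf_on f S \<Longrightarrow> Cinf_on g S \<Longrightarrow> Cinf_on (\<lambda>x. f x * g x) S"
  by (rule Cinf_on_bilinear[OF bounded_bilinear_mult])

lemma frechet_derivative_add_eq:
  "f differentiable (at x) \<Longrightarrow> g differentiable (at x) \<Longrightarrow>
   frechet_derivative (\<lambda>x. f x + g x) (at x) = (\<lambda>v. frechet_derivative f (at x) v + frechet_derivative g (at x) v)"
  by (intro frechet_derivative_eqI has_derivative_add has_frechet_derivative)

lemma frechet_derivative_mult_eq:
  fixes f g :: "'a::real_normed_vector \<Rightarrow> complex"
  shows "f differentiable (at x) \<Longrightarrow> g differentiable (at x) \<Longrightarrow>
   frechet_derivative (\<lambda>x. f x * g x) (at x) = (\<lambda>v. f x * frechet_derivative g (at x) v + frechet_derivative f (at x) v * g x)"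
  by (intro frechet_derivative_eqI has_derivative_mult has_frechet_derivative)

lemma frechet_derivative_linear_image:
  "bounded_linear L \<Longrightarrow> f differentiable (at x) \<Longrightarrow>
   frechet_derivative (\<lambda>x. L (f x)) (at x) = (\<lambda>v. L (frechet_derivative f (at x) v))"
  by (rule frechet_derivative_eqI[OF bounded_linear.has_derivative[OF _ has_frechet_derivative]])

section \<open>Functions on complex manifolds\<close>

locale cmanifold =
  fixes A :: "('m::{t2_space,second_countable_topology}, 'n::finite) atlas"
  assumes cm: "complex_manifold A"
begin

lemma chart_open: "(U,\<phi>) \<in> A \<Longrightarrow> open U" "(U,\<phi>) \<in> A \<Longrightarrow> open (\<phi> ` U)"
  using cm unfolding complex_manifold_def by fast+

lemma chart_homeo: "(U,\<phi>) \<in> A \<Longrightarrow> homeomorphism U (\<phi> ` U) \<phi> (inv_into U \<phi>)"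
  using cm unfolding complex_manifold_def by fast

lemma chart_inv[simp]: "(U,\<phi>) \<in> A \<Longrightarrow> q \<in> U \<Longrightarrow> inv_into U \<phi> (\<phi> q) = q"
  using homeomorphism_apply1[OF chart_homeo] .

lemma chart_ex: "\<exists>U \<phi>. (U,\<phi>) \<in> A \<and> p \<in> U"
proof -
  have "p \<in> (\<Union>(U, \<phi>)\<in>A. U)" using cm unfolding complex_manifold_def by blast
  then show ?thesis by auto
qed

lemma chart_transition:
  "(U,\<phi>) \<in> A \<Longrightarrow> (V,\<psi>) \<in> A \<Longrightarrow> holo_on (\<lambda>x. \<psi> (inv_into U \<phi> x) $ i) (\<phi> ` (U \<inter> V))"
  using cm unfolding complex_manifold_def by fast

lemma chart_image_eq:
  assumes "(U,\<phi>) \<in> A" shows "\<phi> ` (U \<inter> W) = {x \<in> \<phi> ` U. inv_into U \<phi> x \<in> W}"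
  using assms by auto

lemma chart_image_open:
  assumes "(U,\<phi>) \<in> A" "open W" shows "open (\<phi> ` (U \<inter> W))"
proof -
  have "continuous_on (\<phi> ` U) (inv_into U \<phi>)"
    using chart_homeo[OF assms(1)] by (simp add: homeomorphism_def)
  from continuous_open_preimage[OF this chart_open(2)[OF assms(1)] assms(2)]
  show ?thesis unfolding chart_image_eq[OF assms(1)] by (rule back_subst[where P = "open"]) auto
qed

lemma chart_preimage_open:
  assumes "(U,\<phi>) \<in> A" "open T" shows "open {q \<in> U. \<phi> q \<in> T}"
proof -
  have "continuous_on U \<phi>"
    using chart_homeo[OF assms(1)] by (simp add: homeomorphism_def)
  from continuous_open_preimage[OF this chart_open(1)[OF assms(1)] assms(2)]
  show ?thesis by (rule back_subst[where P = "open"]) auto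
qed

lemma smooth_fun_open: "smooth_fun A W f \<Longrightarrow> open W"
  by (simp add: smooth_fun_def)

lemma hol_fun_open: "hol_fun A W f \<Longrightarrow> open W"
  by (simp add: hol_fun_def)

lemma smooth_fun_Cinf:
  "smooth_fun A W f \<Longrightarrow> (U,\<phi>) \<in> A \<Longrightarrow> Cinf_on (\<lambda>x. f (inv_into U \<phi> x)) (\<phi> ` (U \<inter> W))"
  by (auto simp: smooth_fun_def)

lemma hol_fun_holo:
  "hol_fun A W f \<Longrightarrow> (U,\<phi>) \<in> A \<Longrightarrow> holo_on (\<lambda>x. f (inv_into U \<phi> x)) (\<phi> ` (U \<inter> W))"
  by (auto simp: hol_fun_def)

lemma smooth_funI:
  "open W \<Longrightarrow> (\<And>U \<phi>. (U,\<phi>) \<in> A \<Longrightarrow> open (\<phi> ` (U \<inter> W)) \<Longrightarrow> Cinf_on (\<lambda>x. f (inv_into U \<phi> x)) (\<phi> ` (U \<inter> W)))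
    \<Longrightarrow> smooth_fun A W f"
  using chart_image_open by (auto simp: smooth_fun_def)

lemma hol_funI:
  "open W \<Longrightarrow> (\<And>U \<phi>. (U,\<phi>) \<in> A \<Longrightarrow> open (\<phi> ` (U \<inter> W)) \<Longrightarrow> holo_on (\<lambda>x. f (inv_into U \<phi> x)) (\<phi> ` (U \<inter> W)))
    \<Longrightarrow> hol_fun A W f"
  using chart_image_open by (auto simp: hol_fun_def)

lemma hol_imp_smooth: "hol_fun A W f \<Longrightarrow> smooth_fun A W f"
  by (auto simp: hol_fun_def smooth_fun_def intro: holo_on_Cinf)

lemma smooth_fun_subset: "smooth_fun A W f \<Longrightarrow> open V \<Longrightarrow> V \<subseteq> W \<Longrightarrow> smooth_fun A V f"
  by (rule smooth_funI) (auto intro: Cinf_on_subset[OF smooth_fun_Cinf])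

lemma hol_fun_subset: "hol_fun A W f \<Longrightarrow> open V \<Longrightarrow> V \<subseteq> W \<Longrightarrow> hol_fun A V f"
  by (rule hol_funI) (auto intro: holo_on_subset[OF hol_fun_holo])

lemma smooth_fun_cong:
  assumes "smooth_fun A W f" "\<And>q. q \<in> W \<Longrightarrow> f q = g q" shows "smooth_fun A W g"
  by (rule smooth_funI[OF smooth_fun_open[OF assms(1)]])
     (rule Cinf_on_cong[OF _ _ smooth_fun_Cinf[OF assms(1)]], use assms(2) in auto)

lemma hol_fun_cong:
  assumes "hol_fun A W f" "\<And>q. q \<in> W \<Longrightarrow> f q = g q" shows "hol_fun A W g"
  by (rule hol_funI[OF hol_fun_open[OF assms(1)]])
     (rule holo_on_cong[OF _ _ hol_fun_holo[OF assms(1)]], use assms(2) in auto)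

lemma smooth_fun_local:
  assumes "\<And>p. p \<in> W \<Longrightarrow> \<exists>V. p \<in> V \<and> V \<subseteq> W \<and> smooth_fun A V f"
  shows "smooth_fun A W f"
proof (rule smooth_funI)
  show "open W" by (subst open_subopen) (use assms smooth_fun_open in metis)
  fix U \<phi> assume U: "(U,\<phi>) \<in> A"
  show "Cinf_on (\<lambda>x. f (inv_into U \<phi> x)) (\<phi> ` (U \<inter> W))"
  proof (rule Cinf_on_local)
    fix x assume "x \<in> \<phi> ` (U \<inter> W)"
    then obtain p where p: "p \<in> U" "p \<in> W" "x = \<phi> p" by auto
    obtain V where V: "p \<in> V" "V \<subseteq> W" "smooth_fun A V f" using assms p by blast
    show "\<exists>T. open T \<and> x \<in> T \<and> Cinf_on (\<lambda>x. f (inv_into U \<phi> x)) T"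
      using chart_image_open[OF U smooth_fun_open[OF V(3)]] smooth_fun_Cinf[OF V(3) U] p V by blast
  qed
qed

lemma smooth_fun_const: "open W \<Longrightarrow> smooth_fun A W (\<lambda>q. c)"
  by (rule smooth_funI) (auto intro: Cinf_on_const)

lemma hol_fun_const: "open W \<Longrightarrow> hol_fun A W (\<lambda>q. c)"
  by (rule hol_funI) (auto intro: holo_on_const)

lemma smooth_fun_add: "smooth_fun A W f \<Longrightarrow> smooth_fun A W g \<Longrightarrow> smooth_fun A W (\<lambda>q. f q + g q)"
  by (rule smooth_funI) (auto intro: Cinf_on_add smooth_fun_Cinf smooth_fun_open)

lemma smooth_fun_mult: "smooth_fun A W f \<Longrightarrow> smooth_fun A W g \<Longrightarrow> smooth_fun A W (\<lambda>q. f q * g q)"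
  by (rule smooth_funI) (auto intro: Cinf_on_mult smooth_fun_Cinf smooth_fun_open)

lemma smooth_fun_cnj: "smooth_fun A W f \<Longrightarrow> smooth_fun A W (\<lambda>q. cnj (f q))"
  by (rule smooth_funI) (auto intro: Cinf_on_cnj smooth_fun_Cinf smooth_fun_open)

lemma smooth_fun_sum:
  "open W \<Longrightarrow> (\<And>i. i \<in> I \<Longrightarrow> smooth_fun A W (f i)) \<Longrightarrow> smooth_fun A W (\<lambda>q. \<Sum>i\<in>I. f i q)"
  by (induction I rule: infinite_finite_induct) (auto intro: smooth_fun_const smooth_fun_add)

lemma hol_fun_add: "hol_fun A W f \<Longrightarrow> hol_fun A W g \<Longrightarrow> hol_fun A W (\<lambda>q. f q + g q)"
  by (rule hol_funI) (auto intro: holo_on_add hol_fun_holo hol_fun_open)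

lemma hol_fun_mult: "hol_fun A W f \<Longrightarrow> hol_fun A W g \<Longrightarrow> hol_fun A W (\<lambda>q. f q * g q)"
  by (rule hol_funI) (auto intro: holo_on_mult hol_fun_holo hol_fun_open)

lemma hol_fun_cmult: "hol_fun A W f \<Longrightarrow> hol_fun A W (\<lambda>q. c * f q)"
  by (intro hol_fun_mult hol_fun_const hol_fun_open)

lemma hol_fun_diff:
  assumes "hol_fun A W f" "hol_fun A W g" shows "hol_fun A W (\<lambda>q. f q - g q)"
  using hol_fun_add[OF assms(1) hol_fun_cmult[OF assms(2), of "-1"]] by simp

lemma transition_image:
  assumes "(U,\<phi>) \<in> A" "(V,\<psi>) \<in> A" "W \<subseteq> U"
  shows "(\<lambda>x. \<phi> (inv_into V \<psi> x)) ` (\<psi> ` (V \<inter> W)) \<subseteq> \<phi> ` (U \<inter> W)"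
  using assms by auto

lemma transition_Cinf:
  assumes "(U,\<phi>) \<in> A" "(V,\<psi>) \<in> A" "W \<subseteq> U" "open W"
  shows "Cinf_on (\<lambda>x. \<phi> (inv_into V \<psi> x)) (\<psi> ` (V \<inter> W))"
  by (rule Cinf_on_vec[OF chart_image_open[OF assms(2,4)]],
      rule Cinf_on_subset[OF holo_on_Cinf[OF chart_transition[OF assms(2,1)]]]) (use assms in auto)

text \<open>Smoothness is defined by all charts of the atlas, but is verified in one: the expression
  in another chart is \<open>F\<close> composed with a transition map.\<close>

lemma smooth_fun_chart:
  assumes "(U,\<phi>) \<in> A" "W \<subseteq> U" "open W" "Cinf_on F (\<phi> ` (U \<inter> W))" "\<And>q. q \<in> W \<Longrightarrow> f q = F (\<phi> q)"
  shows "smooth_fun A W f"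
proof (rule smooth_funI[OF assms(3)])
  fix V \<psi> assume V: "(V,\<psi>) \<in> A"
  show "Cinf_on (\<lambda>x. f (inv_into V \<psi> x)) (\<psi> ` (V \<inter> W))"
  proof (rule Cinf_on_cong[OF chart_image_open[OF V assms(3)]])
    show "Cinf_on (\<lambda>x. F (\<phi> (inv_into V \<psi> x))) (\<psi> ` (V \<inter> W))"
      by (rule Cinf_on_compose[OF chart_image_open[OF assms(1,3)] chart_image_open[OF V assms(3)] assms(4)
            transition_Cinf[OF assms(1) V assms(2,3)] transition_image[OF assms(1) V assms(2)]])
  qed (use V assms in auto)
qed

lemma hol_fun_chart:
  assumes "(U,\<phi>) \<in> A" "W \<subseteq> U" "open W" "holo_on F (\<phi> ` (U \<inter> W))" "\<And>q. q \<in> W \<Longrightarrow> f q = F (\<phi> q)"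
  shows "hol_fun A W f"
proof (rule hol_funI[OF assms(3)])
  fix V \<psi> assume V: "(V,\<psi>) \<in> A"
  show "holo_on (\<lambda>x. f (inv_into V \<psi> x)) (\<psi> ` (V \<inter> W))"
  proof (rule holo_on_cong[OF chart_image_open[OF V assms(3)]])
    show "holo_on (\<lambda>x. F (\<phi> (inv_into V \<psi> x))) (\<psi> ` (V \<inter> W))"
      by (rule holo_on_compose[OF chart_image_open[OF assms(1,3)] chart_image_open[OF V assms(3)] assms(4) _
            transition_image[OF assms(1) V assms(2)]],
          rule holo_on_subset[OF chart_transition[OF V assms(1)]]) (use assms in auto)
  qed (use V assms in auto)
qed

lemma hol_fun_coord: "(U,\<phi>) \<in> A \<Longrightarrow> hol_fun A U (\<lambda>q. \<phi> q $ i)"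
  by (rule hol_fun_chart[where F = "\<lambda>x. x $ i"]) (auto intro: chart_open holo_on_coord)

subsection \<open>Germs\<close>

lemma smooth_nearI: "smooth_fun A W f \<Longrightarrow> p \<in> W \<Longrightarrow> smooth_near A p f"
  by (auto simp: smooth_near_def)

lemma hol_nearI: "hol_fun A W f \<Longrightarrow> p \<in> W \<Longrightarrow> hol_near A p f"
  by (auto simp: hol_near_def)

lemma hol_near_smooth: "hol_near A p f \<Longrightarrow> smooth_near A p f"
  by (auto simp: hol_near_def smooth_near_def intro: hol_imp_smooth)

lemma smooth_near_cong:
  assumes "smooth_near A p f" "open W" "p \<in> W" "\<And>q. q \<in> W \<Longrightarrow> f q = g q"
  shows "smooth_near A p g"
proof -
  obtain V where V: "p \<in> V" "smooth_fun A V f" using assms(1) by (auto simp: smooth_near_def)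
  have "smooth_fun A (V \<inter> W) f" using V assms smooth_fun_open[OF V(2)] by (intro smooth_fun_subset[OF V(2)]) auto
  then have "smooth_fun A (V \<inter> W) g" by (rule smooth_fun_cong) (use assms in auto)
  then show ?thesis using V assms by (auto simp: smooth_near_def)
qed

lemma smooth_near2:
  assumes "smooth_near A p f" "smooth_near A p g"
  obtains W where "p \<in> W" "smooth_fun A W f" "smooth_fun A W g"
proof -
  obtain V W where V: "p \<in> V" "smooth_fun A V f" "p \<in> W" "smooth_fun A W g"
    using assms by (auto simp: smooth_near_def)
  then have "smooth_fun A (V \<inter> W) f" "smooth_fun A (V \<inter> W) g"
    using smooth_fun_open[OF V(2)] smooth_fun_open[OF V(4)]
    by (auto intro: smooth_fun_subset[OF V(2)] smooth_fun_subset[OF V(4)])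
  then show ?thesis using that V by blast
qed

lemma smooth_near_add: "smooth_near A p f \<Longrightarrow> smooth_near A p g \<Longrightarrow> smooth_near A p (\<lambda>q. f q + g q)"
  by (erule smooth_near2) (auto intro: smooth_nearI smooth_fun_add)

lemma smooth_near_mult: "smooth_near A p f \<Longrightarrow> smooth_near A p g \<Longrightarrow> smooth_near A p (\<lambda>q. f q * g q)"
  by (erule smooth_near2) (auto intro: smooth_nearI smooth_fun_mult)

lemma smooth_near_const: "smooth_near A p (\<lambda>q. c)"
  by (rule smooth_nearI[of UNIV]) (auto intro: smooth_fun_const)

lemma smooth_near_cmult: "smooth_near A p f \<Longrightarrow> smooth_near A p (\<lambda>q. c * f q)"
  by (intro smooth_near_mult smooth_near_const)

lemma smooth_near_sum:
  "(\<And>i. i \<in> I \<Longrightarrow> smooth_near A p (f i)) \<Longrightarrow> smooth_near A p (\<lambda>q. \<Sum>i\<in>I. f i q)"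
  by (induction I rule: infinite_finite_induct) (auto intro: smooth_near_const smooth_near_add)

lemma smooth_near_cnj: "smooth_near A p f \<Longrightarrow> smooth_near A p (\<lambda>q. cnj (f q))"
  by (auto simp: smooth_near_def intro: smooth_fun_cnj)

lemma smooth_near_cnj_iff[simp]: "smooth_near A p (\<lambda>q. cnj (f q)) \<longleftrightarrow> smooth_near A p f"
  using smooth_near_cnj[of p "\<lambda>q. cnj (f q)"] smooth_near_cnj[of p f] by auto

lemma smooth_near_coord: "(U,\<phi>) \<in> A \<Longrightarrow> p \<in> U \<Longrightarrow> smooth_near A p (\<lambda>q. \<phi> q $ i)"
  by (rule smooth_nearI[OF hol_imp_smooth[OF hol_fun_coord]])

lemma smooth_near_chart:
  assumes "smooth_near A p f" "(U,\<phi>) \<in> A" "p \<in> U"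
  obtains W where "open W" "p \<in> W" "W \<subseteq> U" "smooth_fun A W f" "open (\<phi> ` W)"
    "Cinf_on (\<lambda>x. f (inv_into U \<phi> x)) (\<phi> ` W)"
proof -
  obtain V where V: "p \<in> V" "smooth_fun A V f" using assms by (auto simp: smooth_near_def)
  have o: "open (U \<inter> V)" using chart_open(1)[OF assms(2)] smooth_fun_open[OF V(2)] by auto
  have "smooth_fun A (U \<inter> V) f" by (rule smooth_fun_subset[OF V(2) o]) auto
  then show ?thesis
    using that[of "U \<inter> V"] V assms o chart_image_open[OF assms(2) smooth_fun_open[OF V(2)]] smooth_fun_Cinf[OF V(2) assms(2)]
    by auto
qed

lemma hol_near_chart:
  assumes "hol_near A p f" "(U,\<phi>) \<in> A" "p \<in> U"
  obtains W where "open W" "p \<in> W" "W \<subseteq> U" "hol_fun A W f" "open (\<phi> ` W)"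
    "holo_on (\<lambda>x. f (inv_into U \<phi> x)) (\<phi> ` W)"
proof -
  obtain V where V: "p \<in> V" "hol_fun A V f" using assms by (auto simp: hol_near_def)
  have o: "open (U \<inter> V)" using chart_open(1)[OF assms(2)] hol_fun_open[OF V(2)] by auto
  have "hol_fun A (U \<inter> V) f" by (rule hol_fun_subset[OF V(2) o]) auto
  then show ?thesis
    using that[of "U \<inter> V"] V assms o chart_image_open[OF assms(2) hol_fun_open[OF V(2)]] hol_fun_holo[OF V(2) assms(2)]
    by auto
qed

end

lemma smul_apply[simp]: "(c *\<^sub>V v) f = c * v f"
  by (simp add: smul_def)

lemma smul_distribs:
  "c *\<^sub>V (v + w) = c *\<^sub>V v + c *\<^sub>V w" "c *\<^sub>V (v - w) = c *\<^sub>V v - c *\<^sub>V w"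
  "(c + d) *\<^sub>V v = c *\<^sub>V v + d *\<^sub>V v" "c *\<^sub>V (d *\<^sub>V v) = (c * d) *\<^sub>V v"
  "1 *\<^sub>V v = v" "0 *\<^sub>V v = 0" "c *\<^sub>V 0 = 0" "(-1) *\<^sub>V v = - v" "c *\<^sub>V (- v) = - (c *\<^sub>V v)"
  by (auto simp: fun_eq_iff algebra_simps)

lemma sum_fun_apply[simp]: "(\<Sum>i\<in>I. F i) x = (\<Sum>i\<in>I. (F i x :: 'b::comm_monoid_add))"
  by (induction I rule: infinite_finite_induct) auto

section \<open>Tangent vectors\<close>

context cmanifold
begin

lemma CT_zero: "v \<in> CT A p \<Longrightarrow> \<not> smooth_near A p f \<Longrightarrow> v f = 0"
  by (simp add: CT_def)

text \<open>The definition of \<open>CT\<close> speaks of equal germs only when both are smooth. If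
  one of two locally equal functions is not smooth near \<open>p\<close>, neither is the other, and
  both values are 0.\<close>

lemma CT_cong:
  assumes "v \<in> CT A p" "open W" "p \<in> W" "\<And>q. q \<in> W \<Longrightarrow> f q = g q" shows "v f = v g"
proof (cases "smooth_near A p f")
  case True
  then have "smooth_near A p g" using assms smooth_near_cong by blast
  then show ?thesis using True assms unfolding CT_def by blast
next
  case False
  then have "\<not> smooth_near A p g" using assms smooth_near_cong[of p g W f] by auto
  then show ?thesis using False assms(1) CT_zero by metis
qed

lemma CT_add:
  "v \<in> CT A p \<Longrightarrow> smooth_near A p f \<Longrightarrow> smooth_near A p g \<Longrightarrow> v (\<lambda>q. f q + g q) = v f + v g"
  by (simp add: CT_def)

lemma CT_mult:
  "v \<in> CT A p \<Longrightarrow> smooth_near A p f \<Longrightarrow> smooth_near A p g \<Longrightarrow> v (\<lambda>q. f q * g q) = v f * g p + f p * v g"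
  by (simp add: CT_def)

lemma CT_cmult: "v \<in> CT A p \<Longrightarrow> smooth_near A p f \<Longrightarrow> v (\<lambda>q. c * f q) = c * v f"
  by (simp add: CT_def)

text \<open>The product rule for 1 = 1 * 1 gives v(1) = 2 v(1).\<close>

lemma CT_const: "v \<in> CT A p \<Longrightarrow> v (\<lambda>q. c) = 0"
  using CT_mult[of v p "\<lambda>q. 1" "\<lambda>q. 1"] CT_cmult[of v p "\<lambda>q. 1" c] smooth_near_const by auto

lemma CT_diff:
  assumes "v \<in> CT A p" "smooth_near A p f" "smooth_near A p g" shows "v (\<lambda>q. f q - g q) = v f - v g"
  using CT_add[OF assms(1,2) smooth_near_cmult[OF assms(3), of "-1"]] CT_cmult[OF assms(1,3), of "-1"] by simp

lemma CT_sum: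
  assumes "v \<in> CT A p" "\<And>i. i \<in> I \<Longrightarrow> smooth_near A p (f i)"
  shows "v (\<lambda>q. \<Sum>i\<in>I. f i q) = (\<Sum>i\<in>I. v (f i))"
  using assms(2)
  by (induction I rule: infinite_finite_induct) (auto simp: CT_const[OF assms(1)] CT_add[OF assms(1)] smooth_near_sum)

lemma CT_I:
  assumes "\<And>f. \<not> smooth_near A p f \<Longrightarrow> v f = 0"
    "\<And>f g W. smooth_near A p f \<Longrightarrow> smooth_near A p g \<Longrightarrow> open W \<Longrightarrow> p \<in> W \<Longrightarrow> (\<And>q. q \<in> W \<Longrightarrow> f q = g q) \<Longrightarrow> v f = v g"
    "\<And>f g. smooth_near A p f \<Longrightarrow> smooth_near A p g \<Longrightarrow> v (\<lambda>q. f q + g q) = v f + v g"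
    "\<And>f g. smooth_near A p f \<Longrightarrow> smooth_near A p g \<Longrightarrow> v (\<lambda>q. f q * g q) = v f * g p + f p * v g"
    "\<And>c f. smooth_near A p f \<Longrightarrow> v (\<lambda>q. c * f q) = c * v f"
  shows "v \<in> CT A p"
  unfolding CT_def mem_Collect_eq
proof (intro conjI allI impI; (elim conjE exE)?)
  fix f g W assume "smooth_near A p f" "smooth_near A p g" "open W" "p \<in> W" "\<forall>q\<in>W. f q = g q"
  then show "v f = v g" by (intro assms(2)) auto
qed (rule assms; assumption)+

lemma CT_zero_vec: "0 \<in> CT A p"
  by (rule CT_I) auto

lemma CT_plus: "v \<in> CT A p \<Longrightarrow> w \<in> CT A p \<Longrightarrow> v + w \<in> CT A p"
  by (rule CT_I) (auto simp: CT_zero CT_add CT_mult CT_cmult algebra_simps intro: arg_cong2[where f = "(+)"] CT_cong)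

lemma CT_smul: "v \<in> CT A p \<Longrightarrow> c *\<^sub>V v \<in> CT A p"
  by (rule CT_I) (auto simp: CT_zero CT_add CT_mult CT_cmult algebra_simps intro: CT_cong)

lemma CT_conjv:
  assumes v: "v \<in> CT A p" shows "conjv v \<in> CT A p"
proof (rule CT_I)
  fix f g :: "'m \<Rightarrow> complex" and W assume "open W" "p \<in> W" "\<And>q. q \<in> W \<Longrightarrow> f q = g q"
  then have "v (\<lambda>q. cnj (f q)) = v (\<lambda>q. cnj (g q))" by (intro CT_cong[OF v]) auto
  then show "conjv v f = conjv v g" by (simp add: conjv_def)
qed (auto simp: conjv_def CT_zero[OF v] CT_add[OF v] CT_mult[OF v] CT_cmult[OF v])

lemma conjv_conjv[simp]: "conjv (conjv v) = v"
  by (simp add: conjv_def)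

lemma conjv_linear[simp]:
  "conjv (v + w) = conjv v + conjv w" "conjv (v - w) = conjv v - conjv w" "conjv (- v) = - conjv v"
  "conjv (c *\<^sub>V v) = cnj c *\<^sub>V conjv v" "conjv 0 = 0"
  by (auto simp: conjv_def fun_eq_iff)

lemma T10_CT: "v \<in> T10 A p \<Longrightarrow> v \<in> CT A p"
  by (simp add: T10_def)

lemma T10_cnj: "v \<in> T10 A p \<Longrightarrow> hol_near A p f \<Longrightarrow> v (\<lambda>q. cnj (f q)) = 0"
  by (simp add: T10_def)

lemma T10_zero: "0 \<in> T10 A p"
  by (simp add: T10_def CT_zero_vec)

lemma T10_plus: "v \<in> T10 A p \<Longrightarrow> w \<in> T10 A p \<Longrightarrow> v + w \<in> T10 A p"
  by (simp add: T10_def CT_plus)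

lemma T10_smul: "v \<in> T10 A p \<Longrightarrow> c *\<^sub>V v \<in> T10 A p"
  by (simp add: T10_def CT_smul)

lemma T10_uminus: "v \<in> T10 A p \<Longrightarrow> - v \<in> T10 A p"
  using T10_smul[of v p "-1"] by (simp add: smul_distribs)

lemma T10_minus: "v \<in> T10 A p \<Longrightarrow> w \<in> T10 A p \<Longrightarrow> v - w \<in> T10 A p"
  using T10_plus[of v p "- w"] T10_uminus[of w p] by simp

lemma T10_sum: "(\<And>i. i \<in> I \<Longrightarrow> F i \<in> T10 A p) \<Longrightarrow> (\<Sum>i\<in>I. F i) \<in> T10 A p"
  by (induction I rule: infinite_finite_induct) (auto intro: T10_zero T10_plus)

subsection \<open>Coordinate vectors\<close>

text \<open>The coordinate field \<open>\<partial>/\<partial>z\<^sub>i = (\<partial>/\<partial>x\<^sub>i - \<i> \<partial>/\<partial>y\<^sub>i)/2\<close> of a chart, \<open>0\<close> on non-smooth germs as required by \<^const>\<open>CT\<close>.\<close>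

definition pz :: "'m set \<Rightarrow> ('m \<Rightarrow> complex^'n) \<Rightarrow> 'n \<Rightarrow> 'm cfield" where
  "pz U \<phi> i q = (\<lambda>f. if smooth_near A q f
     then (frechet_derivative (\<lambda>x. f (inv_into U \<phi> x)) (at (\<phi> q)) (axis i 1)
           - \<i> * frechet_derivative (\<lambda>x. f (inv_into U \<phi> x)) (at (\<phi> q)) (axis i \<i>)) / 2
     else 0)"

lemma chart_differentiable:
  assumes "smooth_near A p f" "(U,\<phi>) \<in> A" "p \<in> U"
  shows "(\<lambda>x. f (inv_into U \<phi> x)) differentiable (at (\<phi> p))"
  by (rule smooth_near_chart[OF assms]) (auto intro: Cinf_on_differentiable)

lemma pz_CT:
  assumes "(U,\<phi>) \<in> A" "p \<in> U" shows "pz U \<phi> i p \<in> CT A p"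
proof (rule CT_I)
  fix f g W assume fg: "smooth_near A p f" "smooth_near A p g" "open W" "p \<in> W" "\<And>q. q \<in> W \<Longrightarrow> f q = g q"
  have "frechet_derivative (\<lambda>x. g (inv_into U \<phi> x)) (at (\<phi> p)) = frechet_derivative (\<lambda>x. f (inv_into U \<phi> x)) (at (\<phi> p))"
    by (rule differentiable_cong_open(2)[OF chart_image_open[OF assms(1) fg(3)] _ _ chart_differentiable[OF fg(1) assms]])
       (use assms fg in auto)
  then show "pz U \<phi> i p f = pz U \<phi> i p g" using fg by (simp add: pz_def)
next
  fix f g assume fg: "smooth_near A p f" "smooth_near A p g"
  note d = chart_differentiable[OF fg(1) assms] chart_differentiable[OF fg(2) assms]
  show "pz U \<phi> i p (\<lambda>q. f q + g q) = pz U \<phi> i p f + pz U \<phi> i p g"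
    using fg by (simp add: pz_def smooth_near_add frechet_derivative_add_eq[OF d] field_simps)
  show "pz U \<phi> i p (\<lambda>q. f q * g q) = pz U \<phi> i p f * g p + f p * pz U \<phi> i p g"
    using fg assms by (simp add: pz_def smooth_near_mult frechet_derivative_mult_eq[OF d] field_simps)
next
  fix c f assume f: "smooth_near A p f"
  show "pz U \<phi> i p (\<lambda>q. c * f q) = c * pz U \<phi> i p f"
    using f frechet_derivative_linear_image[OF bounded_linear_mult_right chart_differentiable[OF f assms], of c]
    by (simp add: pz_def smooth_near_cmult field_simps)
qed (simp add: pz_def)

text \<open>By the Cauchy-Riemann equation the derivative in direction \<open>axis i \<i>\<close> is
  \<i> times the one in direction \<open>axis i 1\<close>; after conjugation the two terms of
  \<open>pz\<close> cancel.\<close>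

lemma pz_cnj_hol:
  assumes "(U,\<phi>) \<in> A" "p \<in> U" "hol_near A p f" shows "pz U \<phi> i p (\<lambda>q. cnj (f q)) = 0"
proof -
  obtain W where W: "open W" "p \<in> W" "open (\<phi> ` W)" "holo_on (\<lambda>x. f (inv_into U \<phi> x)) (\<phi> ` W)"
    by (rule hol_near_chart[OF assms(3,1,2)]) blast
  have sn: "smooth_near A p f" using hol_near_smooth assms by blast
  let ?F = "frechet_derivative (\<lambda>x. f (inv_into U \<phi> x)) (at (\<phi> p))"
  have "axis i \<i> = \<i> *s (axis i 1 :: complex^'n)" by (simp add: vec_eq_iff axis_def)
  then have "?F (axis i \<i>) = \<i> * ?F (axis i 1)"
    using holo_on_i[OF W(4), of "\<phi> p" "axis i 1"] W(2) by simp
  then show ?thesis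
    using sn frechet_derivative_linear_image[OF bounded_linear_cnj chart_differentiable[OF sn assms(1,2)]]
    by (simp add: pz_def)
qed

lemma pz_T10: "(U,\<phi>) \<in> A \<Longrightarrow> p \<in> U \<Longrightarrow> pz U \<phi> i p \<in> T10 A p"
  by (simp add: T10_def pz_CT pz_cnj_hol)

lemma pz_hol:
  assumes "(U,\<phi>) \<in> A" "p \<in> U" "hol_near A p f"
  shows "pz U \<phi> i p f = frechet_derivative (\<lambda>x. f (inv_into U \<phi> x)) (at (\<phi> p)) (axis i 1)"
proof -
  obtain W where W: "open W" "p \<in> W" "open (\<phi> ` W)" "holo_on (\<lambda>x. f (inv_into U \<phi> x)) (\<phi> ` W)"
    by (rule hol_near_chart[OF assms(3,1,2)]) blast
  let ?F = "frechet_derivative (\<lambda>x. f (inv_into U \<phi> x)) (at (\<phi> p))"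
  have "axis i \<i> = \<i> *s (axis i 1 :: complex^'n)" by (simp add: vec_eq_iff axis_def)
  then have "?F (axis i \<i>) = \<i> * ?F (axis i 1)"
    using holo_on_i[OF W(4), of "\<phi> p" "axis i 1"] W(2) by simp
  then show ?thesis using hol_near_smooth[OF assms(3)] by (simp add: pz_def)
qed

lemma pz_coord:
  assumes "(U,\<phi>) \<in> A" "p \<in> U" shows "pz U \<phi> i p (\<lambda>q. \<phi> q $ j) = (if i = j then 1 else 0)"
proof -
  have "frechet_derivative (\<lambda>x. \<phi> (inv_into U \<phi> x) $ j) (at (\<phi> p)) = frechet_derivative (\<lambda>x. x $ j) (at (\<phi> p))"
    by (rule differentiable_cong_open(2)[OF chart_open(2)[OF assms(1)], symmetric, THEN sym])
       (use assms in \<open>auto intro: bounded_linear_imp_differentiable[OF bounded_linear_vec_nth]\<close>)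
  also have "\<dots> = (\<lambda>x. x $ j)"
    by (rule frechet_derivative_eqI[OF bounded_linear_imp_has_derivative[OF bounded_linear_vec_nth]])
  finally show ?thesis
    using pz_hol[OF assms hol_nearI[OF hol_fun_coord[OF assms(1)] assms(2)]] by (simp add: axis_def)
qed

lemma pz_smooth:
  assumes "(U,\<phi>) \<in> A" "smooth_fun A V f" "V \<subseteq> U" shows "smooth_fun A V (\<lambda>q. pz U \<phi> i q f)"
proof (rule smooth_fun_chart[OF assms(1,3) smooth_fun_open[OF assms(2)]])
  let ?F = "\<lambda>x. f (inv_into U \<phi> x)"
  let ?T = "\<phi> ` (U \<inter> V)"
  have T: "open ?T" by (rule chart_image_open[OF assms(1) smooth_fun_open[OF assms(2)]])
  have F: "Cinf_on (\<lambda>x. frechet_derivative ?F (at x) v) ?T" for v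
    by (rule Cinf_on_frechet[OF smooth_fun_Cinf[OF assms(2,1)]])
  show "Cinf_on (\<lambda>x. (1/2) * (frechet_derivative ?F (at x) (axis i 1)) + (- \<i> / 2) * frechet_derivative ?F (at x) (axis i \<i>)) ?T"
    by (intro Cinf_on_add Cinf_on_mult Cinf_on_const T F)
  show "pz U \<phi> i q f = (1/2) * (frechet_derivative ?F (at (\<phi> q)) (axis i 1)) + (- \<i> / 2) * frechet_derivative ?F (at (\<phi> q)) (axis i \<i>)"
    if "q \<in> V" for q
    using smooth_nearI[OF assms(2) that] by (simp add: pz_def field_simps)
qed

lemma pz_hol_fun:
  assumes "(U,\<phi>) \<in> A" "hol_fun A V f" "V \<subseteq> U" shows "hol_fun A V (\<lambda>q. pz U \<phi> i q f)"
  by (rule hol_fun_chart[OF assms(1,3) hol_fun_open[OF assms(2)]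
        holo_on_frechet[OF hol_fun_holo[OF assms(2,1)] chart_image_open[OF assms(1) hol_fun_open[OF assms(2)]]]])
     (use assms in \<open>auto intro!: pz_hol hol_nearI\<close>)

text \<open>Hadamard's lemma writes f near \<open>p\<close> as f(p) plus a sum of centred
  coordinates times smooth functions. The centred coordinates vanish at \<open>p\<close>, so the
  product rule leaves only their \<open>v\<close>-derivatives times the values of the smooth
  functions at \<open>p\<close>, which are the partial derivatives of f.\<close>

lemma CT_real_expand:
  assumes v: "v \<in> CT A p" and U: "(U,\<phi>) \<in> A" "p \<in> U" and f: "smooth_near A p f"
  shows "v f = (\<Sum>b\<in>Basis. v (\<lambda>q. complex_of_real (\<phi> q \<bullet> b)) *
    frechet_derivative (\<lambda>x. f (inv_into U \<phi> x)) (at (\<phi> p)) b)"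
proof -
  let ?F = "\<lambda>x. f (inv_into U \<phi> x)"
  obtain W where W: "open W" "p \<in> W" "W \<subseteq> U" "open (\<phi> ` W)" "Cinf_on ?F (\<phi> ` W)"
    by (rule smooth_near_chart[OF f U]) blast
  obtain r where r: "r > 0" "ball (\<phi> p) r \<subseteq> \<phi> ` W" using W(2,4) openE by blast
  have "Cinf_on ?F (ball (\<phi> p) r)" by (rule Cinf_on_subset[OF W(5) r(2)])
  from Hadamard[OF this r(1)] obtain G where
    G: "\<And>b. b \<in> Basis \<Longrightarrow> Cinf_on (G b) (ball (\<phi> p) r)"
       "\<And>b. b \<in> Basis \<Longrightarrow> G b (\<phi> p) = frechet_derivative ?F (at (\<phi> p)) b"
       "\<And>x. x \<in> ball (\<phi> p) r \<Longrightarrow> ?F x = ?F (\<phi> p) + (\<Sum>b\<in>Basis. ((x - \<phi> p) \<bullet> b) *\<^sub>R G b x)"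
    by blast
  define V where "V = {q \<in> U. \<phi> q \<in> ball (\<phi> p) r}"
  have V: "open V" "p \<in> V" "V \<subseteq> U"
    unfolding V_def using chart_preimage_open[OF U(1) open_ball] U r by auto
  have g: "smooth_near A p (\<lambda>q. G b (\<phi> q))" if "b \<in> Basis" for b
  proof (rule smooth_nearI[OF _ V(2)], rule smooth_fun_chart[OF U(1) V(3,1)])
    show "Cinf_on (G b) (\<phi> ` (U \<inter> V))"
      by (rule Cinf_on_subset[OF G(1)[OF that]]) (auto simp: V_def)
  qed simp
  have x: "smooth_near A p (\<lambda>q. complex_of_real (\<phi> q \<bullet> b))" for b
  proof (rule smooth_nearI[OF _ U(2)], rule smooth_fun_chart[OF U(1) order_refl chart_open(1)[OF U(1)]])
    show "Cinf_on (\<lambda>x. complex_of_real (x \<bullet> b)) (\<phi> ` (U \<inter> U))"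
      by (rule Cinf_on_bounded_linear)
         (rule bounded_linear_compose[OF bounded_linear_of_real bounded_linear_inner_left])
  qed simp
  let ?x = "\<lambda>b q. complex_of_real (\<phi> q \<bullet> b) - complex_of_real (\<phi> p \<bullet> b)"
  have sx: "smooth_near A p (?x b)" for b
    using smooth_near_add[OF x smooth_near_const[of p "- complex_of_real (\<phi> p \<bullet> b)"], of b] by simp
  have vx: "v (?x b) = v (\<lambda>q. complex_of_real (\<phi> q \<bullet> b))" for b
    using CT_diff[OF v x smooth_near_const] CT_const[OF v] by simp
  have "v f = v (\<lambda>q. f p + (\<Sum>b\<in>Basis. ?x b q * G b (\<phi> q)))"
  proof (rule CT_cong[OF v V(1,2)])
    fix q assume "q \<in> V"
    then have "?F (\<phi> q) = ?F (\<phi> p) + (\<Sum>b\<in>Basis. ((\<phi> q - \<phi> p) \<bullet> b) *\<^sub>R G b (\<phi> q))"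
      by (intro G(3)) (simp add: V_def)
    then show "f q = f p + (\<Sum>b\<in>Basis. ?x b q * G b (\<phi> q))"
      using \<open>q \<in> V\<close> U V_def by (simp add: inner_diff_left scaleR_conv_of_real)
  qed
  also have "\<dots> = (\<Sum>b\<in>Basis. v (\<lambda>q. ?x b q * G b (\<phi> q)))"
    using CT_const[OF v]
    by (subst CT_add[OF v smooth_near_const]) (auto intro!: smooth_near_sum smooth_near_mult sx g CT_sum[OF v])
  also have "\<dots> = (\<Sum>b\<in>Basis. v (\<lambda>q. complex_of_real (\<phi> q \<bullet> b)) * frechet_derivative ?F (at (\<phi> p)) b)"
    by (rule sum.cong) (auto simp: CT_mult[OF v sx g] vx G(2))
  finally show ?thesis .
qed

text \<open>The real expansion rewritten in Wirtinger form: real and imaginary parts of the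
  coordinates are combinations of z and its conjugate, and \<open>conjv (pz U \<phi> i p)\<close> is
  the derivative in the conjugate coordinate.\<close>

lemma CT_expand:
  assumes v: "v \<in> CT A p" and U: "(U,\<phi>) \<in> A" "p \<in> U"
  shows "v f = (\<Sum>i\<in>UNIV. v (\<lambda>q. \<phi> q $ i) * pz U \<phi> i p f + v (\<lambda>q. cnj (\<phi> q $ i)) * conjv (pz U \<phi> i p) f)"
proof (cases "smooth_near A p f")
  case True
  let ?F = "frechet_derivative (\<lambda>x. f (inv_into U \<phi> x)) (at (\<phi> p))"
  note z = smooth_near_coord[OF U]
  have re: "v (\<lambda>q. complex_of_real (Re (\<phi> q $ i))) = (v (\<lambda>q. \<phi> q $ i) + v (\<lambda>q. cnj (\<phi> q $ i))) / 2" for i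
  proof -
    have "(\<lambda>q. complex_of_real (Re (\<phi> q $ i))) = (\<lambda>q. (1/2) * (\<phi> q $ i + cnj (\<phi> q $ i)))"
      by (simp add: complex_add_cnj)
    then show ?thesis
      by (simp only: CT_cmult[OF v smooth_near_add[OF z smooth_near_cnj[OF z]]] CT_add[OF v z smooth_near_cnj[OF z]]) simp
  qed
  have im: "v (\<lambda>q. complex_of_real (Im (\<phi> q $ i))) = (- \<i> / 2) * (v (\<lambda>q. \<phi> q $ i) - v (\<lambda>q. cnj (\<phi> q $ i)))" for i
  proof -
    have "(\<lambda>q. complex_of_real (Im (\<phi> q $ i))) = (\<lambda>q. (- \<i> / 2) * (\<phi> q $ i + (-1) * cnj (\<phi> q $ i)))"
      by (simp add: fun_eq_iff complex_eq_iff)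
    then show ?thesis
      by (simp only: CT_cmult[OF v smooth_near_add[OF z smooth_near_cmult[OF smooth_near_cnj[OF z]]]]
          CT_add[OF v z smooth_near_cmult[OF smooth_near_cnj[OF z]]] CT_cmult[OF v smooth_near_cnj[OF z]]) simp
  qed
  have cj: "conjv (pz U \<phi> i p) f = (?F (axis i 1) + \<i> * ?F (axis i \<i>)) / 2" for i
    using True frechet_derivative_linear_image[OF bounded_linear_cnj chart_differentiable[OF True U]]
    by (simp add: conjv_def pz_def)
  have pzf: "pz U \<phi> i p f = (?F (axis i 1) - \<i> * ?F (axis i \<i>)) / 2" for i
    using True by (simp add: pz_def)
  have "v f = (\<Sum>i\<in>UNIV. v (\<lambda>q. complex_of_real (\<phi> q \<bullet> axis i 1)) * ?F (axis i 1)
      + v (\<lambda>q. complex_of_real (\<phi> q \<bullet> axis i \<i>)) * ?F (axis i \<i>))"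
    using CT_real_expand[OF v U True] unfolding sum_Basis_complex_vec .
  also have "\<dots> = (\<Sum>i\<in>UNIV. v (\<lambda>q. \<phi> q $ i) * pz U \<phi> i p f + v (\<lambda>q. cnj (\<phi> q $ i)) * conjv (pz U \<phi> i p) f)"
    by (intro sum.cong refl) (simp add: inner_axis re im cj pzf field_simps)
  finally show ?thesis .
next
  case False
  then show ?thesis using CT_zero[OF v] by (simp add: conjv_def pz_def)
qed

lemma CT_eqI:
  assumes "v \<in> CT A p" "w \<in> CT A p" "(U,\<phi>) \<in> A" "p \<in> U"
    "\<And>i. v (\<lambda>q. \<phi> q $ i) = w (\<lambda>q. \<phi> q $ i)" "\<And>i. v (\<lambda>q. cnj (\<phi> q $ i)) = w (\<lambda>q. cnj (\<phi> q $ i))"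
  shows "v = w"
proof
  fix f show "v f = w f"
    using CT_expand[OF assms(1,3,4), of f] CT_expand[OF assms(2,3,4), of f] assms(5,6) by simp
qed

lemma T10_cnj_coord: "v \<in> T10 A p \<Longrightarrow> (U,\<phi>) \<in> A \<Longrightarrow> p \<in> U \<Longrightarrow> v (\<lambda>q. cnj (\<phi> q $ i)) = 0"
  by (rule T10_cnj) (auto intro: hol_nearI hol_fun_coord)

lemma T10_eqI:
  assumes "v \<in> T10 A p" "w \<in> T10 A p" "(U,\<phi>) \<in> A" "p \<in> U" "\<And>i. v (\<lambda>q. \<phi> q $ i) = w (\<lambda>q. \<phi> q $ i)"
  shows "v = w"
  by (rule CT_eqI[OF T10_CT T10_CT assms(3,4)]) (use assms in \<open>auto simp: T10_cnj_coord\<close>)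

lemma T10_iff_coord:
  assumes "v \<in> CT A p" "(U,\<phi>) \<in> A" "p \<in> U"
  shows "v \<in> T10 A p \<longleftrightarrow> (\<forall>i. v (\<lambda>q. cnj (\<phi> q $ i)) = 0)"
proof
  assume "\<forall>i. v (\<lambda>q. cnj (\<phi> q $ i)) = 0"
  then have "v (\<lambda>q. cnj (f q)) = 0" if "hol_near A p f" for f
    using CT_expand[OF assms, of "\<lambda>q. cnj (f q)"] pz_cnj_hol[OF assms(2,3) that] by simp
  then show "v \<in> T10 A p" using assms(1) by (simp add: T10_def)
qed (use T10_cnj_coord assms in blast)

lemma T10_expand:
  assumes "v \<in> T10 A p" "(U,\<phi>) \<in> A" "p \<in> U"
  shows "v = (\<Sum>i\<in>UNIV. v (\<lambda>q. \<phi> q $ i) *\<^sub>V pz U \<phi> i p)"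
proof
  fix f show "v f = (\<Sum>i\<in>UNIV. v (\<lambda>q. \<phi> q $ i) *\<^sub>V pz U \<phi> i p) f"
    using CT_expand[OF T10_CT[OF assms(1)] assms(2,3), of f] T10_cnj_coord[OF assms] by simp
qed

lemma CT_decompose:
  assumes v: "v \<in> CT A p" and U: "(U,\<phi>) \<in> A" "p \<in> U"
  defines "a \<equiv> (\<Sum>i\<in>UNIV. v (\<lambda>q. \<phi> q $ i) *\<^sub>V pz U \<phi> i p)"
    and "b \<equiv> (\<Sum>i\<in>UNIV. cnj (v (\<lambda>q. cnj (\<phi> q $ i))) *\<^sub>V pz U \<phi> i p)"
  shows "a \<in> T10 A p" "b \<in> T10 A p" "v = a + conjv b"
proof -
  show "a \<in> T10 A p" "b \<in> T10 A p" unfolding a_def b_def by (intro T10_sum T10_smul pz_T10[OF U])+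
  show "v = a + conjv b"
  proof
    fix f
    have "conjv b f = (\<Sum>i\<in>UNIV. v (\<lambda>q. cnj (\<phi> q $ i)) * conjv (pz U \<phi> i p) f)"
      by (simp add: b_def conjv_def)
    then show "v f = (a + conjv b) f"
      using CT_expand[OF v U, of f] by (simp add: a_def sum.distrib)
  qed
qed

text \<open>Type (1,0) of \<open>v\<close> kills the conjugate coordinates, type (1,0) of its
  conjugate kills the coordinates themselves, and together they determine \<open>v\<close>.\<close>

lemma T10_conj_disjoint:
  assumes "v \<in> T10 A p" "conjv v \<in> T10 A p" shows "v = 0"
proof -
  obtain U \<phi> where U: "(U,\<phi>) \<in> A" "p \<in> U" using chart_ex by blast
  have "v (\<lambda>q. \<phi> q $ i) = 0" for i
    using T10_cnj_coord[OF assms(2) U, of i] by (simp add: conjv_def)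
  then show ?thesis by (intro T10_eqI[OF assms(1) T10_zero U]) auto
qed

text \<open>Makes the \<open>THE\<close> in \<open>part10\<close> well defined: the difference of
  two admissible values is of type (1,0) and also conjugate to a vector of type (1,0), hence
  0.\<close>

lemma part10_eqI:
  assumes "a \<in> T10 A p" "b \<in> T10 A p" "z = a + conjv b" shows "part10 A p z = a"
  unfolding part10_def
proof (rule the_equality)
  show "a \<in> T10 A p \<and> (\<exists>b\<in>T10 A p. z = a + conjv b)" using assms by blast
  fix a' assume "a' \<in> T10 A p \<and> (\<exists>b\<in>T10 A p. z = a' + conjv b)"
  then obtain b' where a': "a' \<in> T10 A p" "b' \<in> T10 A p" "z = a' + conjv b'" by blast
  have "a - a' = conjv (b' - b)" using assms(3) a'(3) by (simp add: algebra_simps)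
  then have "b' - b = 0"
    using T10_conj_disjoint[of "b' - b" p] T10_minus[OF a'(2) assms(2)] T10_minus[OF assms(1) a'(1)] by simp
  then show "a' = a" using \<open>a - a' = conjv (b' - b)\<close> by simp
qed

lemma part10_T10: "a \<in> T10 A p \<Longrightarrow> part10 A p a = a"
  by (rule part10_eqI[OF _ T10_zero]) auto

lemma part_props:
  assumes "v \<in> CT A p"
  shows "part10 A p v \<in> T10 A p" "conjv (part01 A p v) \<in> T10 A p" "v = part10 A p v + part01 A p v"
proof -
  obtain U \<phi> where U: "(U,\<phi>) \<in> A" "p \<in> U" using chart_ex by blast
  define a where "a = (\<Sum>i\<in>UNIV. v (\<lambda>q. \<phi> q $ i) *\<^sub>V pz U \<phi> i p)"
  define b where "b = (\<Sum>i\<in>UNIV. cnj (v (\<lambda>q. cnj (\<phi> q $ i))) *\<^sub>V pz U \<phi> i p)"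
  have d: "a \<in> T10 A p" "b \<in> T10 A p" "v = a + conjv b"
    using CT_decompose[OF assms U] unfolding a_def b_def .
  have 1: "part10 A p v = a" by (rule part10_eqI[OF d])
  show "part10 A p v \<in> T10 A p" by (simp only: 1 d(1))
  have "part01 A p v = conjv b" unfolding part01_def 1 by (simp add: d(3))
  then show "conjv (part01 A p v) \<in> T10 A p" using d(2) by simp
  show "v = part10 A p v + part01 A p v" by (simp add: part01_def)
qed

lemma part10_coord:
  assumes "v \<in> CT A p" "(U,\<phi>) \<in> A" "p \<in> U"
  shows "part10 A p v = (\<Sum>i\<in>UNIV. v (\<lambda>q. \<phi> q $ i) *\<^sub>V pz U \<phi> i p)"
  by (rule part10_eqI[OF CT_decompose[OF assms]])

end

section \<open>Vector fields\<close>

context cmanifold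
begin

lemma smooth_cvf_open: "smooth_cvf A W X \<Longrightarrow> open W"
  by (simp add: smooth_cvf_def)

lemma smooth_cvf_CT: "smooth_cvf A W X \<Longrightarrow> p \<in> W \<Longrightarrow> X p \<in> CT A p"
  by (simp add: smooth_cvf_def)

lemma smooth_cvf_fun: "smooth_cvf A W X \<Longrightarrow> smooth_fun A V f \<Longrightarrow> V \<subseteq> W \<Longrightarrow> smooth_fun A V (\<lambda>p. X p f)"
  by (simp add: smooth_cvf_def)

lemma smooth_cvfI:
  "open W \<Longrightarrow> (\<And>p. p \<in> W \<Longrightarrow> X p \<in> CT A p) \<Longrightarrow>
   (\<And>V f. V \<subseteq> W \<Longrightarrow> smooth_fun A V f \<Longrightarrow> smooth_fun A V (\<lambda>p. X p f)) \<Longrightarrow> smooth_cvf A W X"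
  by (simp add: smooth_cvf_def)

lemma smooth_vf_cvf: "smooth_vf A W X \<Longrightarrow> smooth_cvf A W X"
  by (simp add: smooth_vf_def)

lemma smooth_vf_open: "smooth_vf A W X \<Longrightarrow> open W"
  by (simp add: smooth_vf_def smooth_cvf_def)

lemma smooth_vf_T10: "smooth_vf A W X \<Longrightarrow> p \<in> W \<Longrightarrow> X p \<in> T10 A p"
  by (simp add: smooth_vf_def)

lemma hol_vf_open: "hol_vf A W X \<Longrightarrow> open W"
  by (simp add: hol_vf_def)

lemma hol_vf_T10: "hol_vf A W X \<Longrightarrow> p \<in> W \<Longrightarrow> X p \<in> T10 A p"
  by (simp add: hol_vf_def)

lemma hol_vf_fun: "hol_vf A W X \<Longrightarrow> hol_fun A V f \<Longrightarrow> V \<subseteq> W \<Longrightarrow> hol_fun A V (\<lambda>p. X p f)"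
  by (simp add: hol_vf_def)

lemma hol_vfI:
  "open W \<Longrightarrow> (\<And>p. p \<in> W \<Longrightarrow> X p \<in> T10 A p) \<Longrightarrow>
   (\<And>V f. V \<subseteq> W \<Longrightarrow> hol_fun A V f \<Longrightarrow> hol_fun A V (\<lambda>p. X p f)) \<Longrightarrow> hol_vf A W X"
  by (simp add: hol_vf_def)

lemma smooth_cvf_subset: "smooth_cvf A W X \<Longrightarrow> open V \<Longrightarrow> V \<subseteq> W \<Longrightarrow> smooth_cvf A V X"
  unfolding smooth_cvf_def by (meson subset_iff subset_trans)

lemma smooth_vf_subset: "smooth_vf A W X \<Longrightarrow> open V \<Longrightarrow> V \<subseteq> W \<Longrightarrow> smooth_vf A V X"
  unfolding smooth_vf_def using smooth_cvf_subset by blast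

lemma hol_vf_subset: "hol_vf A W X \<Longrightarrow> open V \<Longrightarrow> V \<subseteq> W \<Longrightarrow> hol_vf A V X"
  unfolding hol_vf_def by (meson subset_iff subset_trans)

lemma smooth_cvf_cong:
  assumes "smooth_cvf A W X" "\<And>q. q \<in> W \<Longrightarrow> X q = Y q" shows "smooth_cvf A W Y"
proof (rule smooth_cvfI[OF smooth_cvf_open[OF assms(1)]])
  show "Y p \<in> CT A p" if "p \<in> W" for p using smooth_cvf_CT[OF assms(1) that] assms(2)[OF that] by simp
  show "smooth_fun A V (\<lambda>p. Y p f)" if "V \<subseteq> W" "smooth_fun A V f" for V f
    by (rule smooth_fun_cong[OF smooth_cvf_fun[OF assms(1) that(2,1)]]) (use assms(2) that in auto)
qed

lemma smooth_vf_cong: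
  assumes "smooth_vf A W X" "\<And>q. q \<in> W \<Longrightarrow> X q = Y q" shows "smooth_vf A W Y"
  using assms smooth_cvf_cong[of W X Y] by (simp add: smooth_vf_def)

lemma hol_vf_cong:
  assumes "hol_vf A W X" "\<And>q. q \<in> W \<Longrightarrow> X q = Y q" shows "hol_vf A W Y"
proof (rule hol_vfI[OF hol_vf_open[OF assms(1)]])
  show "Y p \<in> T10 A p" if "p \<in> W" for p using hol_vf_T10[OF assms(1) that] assms(2)[OF that] by simp
  show "hol_fun A V (\<lambda>p. Y p f)" if "V \<subseteq> W" "hol_fun A V f" for V f
    by (rule hol_fun_cong[OF hol_vf_fun[OF assms(1) that(2,1)]]) (use assms(2) that in auto)
qed

lemma smooth_cvf_near:
  assumes "smooth_cvf A W X" "p \<in> W" "smooth_near A p f" shows "smooth_near A p (\<lambda>q. X q f)"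
proof -
  obtain V where V: "p \<in> V" "smooth_fun A V f" using assms(3) by (auto simp: smooth_near_def)
  have o: "open (V \<inter> W)" using smooth_fun_open[OF V(2)] smooth_cvf_open[OF assms(1)] by auto
  have "smooth_fun A (V \<inter> W) (\<lambda>q. X q f)"
    by (rule smooth_cvf_fun[OF assms(1) smooth_fun_subset[OF V(2) o]]) auto
  then show ?thesis by (rule smooth_nearI) (use V assms in auto)
qed

lemma smooth_near_nbhd:
  assumes "smooth_near A p f" obtains V where "open V" "p \<in> V" "\<And>q. q \<in> V \<Longrightarrow> smooth_near A q f"
proof -
  obtain V where V: "p \<in> V" "smooth_fun A V f" using assms by (auto simp: smooth_near_def)
  then show ?thesis using that[of V] smooth_nearI[OF V(2)] smooth_fun_open[OF V(2)] by auto
qed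

lemma smooth_cvf_conjf: "smooth_cvf A W X \<Longrightarrow> smooth_cvf A W (conjf X)"
proof (rule smooth_cvfI)
  assume X: "smooth_cvf A W X"
  show "open W" by (rule smooth_cvf_open[OF X])
  show "conjf X p \<in> CT A p" if "p \<in> W" for p
    unfolding conjf_def by (rule CT_conjv[OF smooth_cvf_CT[OF X that]])
  show "smooth_fun A V (\<lambda>p. conjf X p f)" if "V \<subseteq> W" "smooth_fun A V f" for V f
    unfolding conjf_def conjv_def by (intro smooth_fun_cnj smooth_cvf_fun[OF X] that)
qed

lemma conjf_conjf[simp]: "conjf (conjf X) = X"
  by (simp add: conjf_def)

lemma smooth_cvf_add:
  assumes "smooth_cvf A W X" "smooth_cvf A W Y" shows "smooth_cvf A W (\<lambda>q. X q + Y q)"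
proof (rule smooth_cvfI[OF smooth_cvf_open[OF assms(1)]])
  show "X p + Y p \<in> CT A p" if "p \<in> W" for p using assms that smooth_cvf_CT by (auto intro: CT_plus)
  show "smooth_fun A V (\<lambda>p. (X p + Y p) f)" if "V \<subseteq> W" "smooth_fun A V f" for V f
    unfolding plus_fun_apply by (intro smooth_fun_add smooth_cvf_fun[OF assms(1)] smooth_cvf_fun[OF assms(2)] that)
qed

lemma smooth_cvf_smul:
  assumes "smooth_fun A W u" "smooth_cvf A W X" shows "smooth_cvf A W (\<lambda>q. u q *\<^sub>V X q)"
proof (rule smooth_cvfI[OF smooth_cvf_open[OF assms(2)]])
  show "u p *\<^sub>V X p \<in> CT A p" if "p \<in> W" for p using assms that smooth_cvf_CT by (auto intro: CT_smul)
  show "smooth_fun A V (\<lambda>p. (u p *\<^sub>V X p) f)" if "V \<subseteq> W" "smooth_fun A V f" for V f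
    unfolding smul_apply
    by (intro smooth_fun_mult smooth_cvf_fun[OF assms(2)] smooth_fun_subset[OF assms(1)] smooth_fun_open[OF that(2)] that)
qed

lemma smooth_vf_add: "smooth_vf A W X \<Longrightarrow> smooth_vf A W Y \<Longrightarrow> smooth_vf A W (\<lambda>q. X q + Y q)"
  by (simp add: smooth_vf_def smooth_cvf_add T10_plus)

lemma smooth_vf_smul: "smooth_fun A W u \<Longrightarrow> smooth_vf A W X \<Longrightarrow> smooth_vf A W (\<lambda>q. u q *\<^sub>V X q)"
  by (simp add: smooth_vf_def smooth_cvf_smul T10_smul)

lemma smooth_vf_zero: "open W \<Longrightarrow> smooth_vf A W (\<lambda>q. 0)"
  by (auto simp: smooth_vf_def smooth_cvf_def CT_zero_vec T10_zero intro: smooth_fun_const dest: smooth_fun_open)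

lemma smooth_vf_sum:
  "open W \<Longrightarrow> (\<And>i. i \<in> I \<Longrightarrow> smooth_vf A W (F i)) \<Longrightarrow> smooth_vf A W (\<lambda>q. \<Sum>i\<in>I. F i q)"
  by (induction I rule: infinite_finite_induct) (auto intro: smooth_vf_zero smooth_vf_add)

lemma hol_vf_zero: "open W \<Longrightarrow> hol_vf A W (\<lambda>q. 0)"
  by (rule hol_vfI) (auto simp: T10_zero intro: hol_fun_const dest: hol_fun_open)

lemma hol_vf_add: "hol_vf A W X \<Longrightarrow> hol_vf A W Y \<Longrightarrow> hol_vf A W (\<lambda>q. X q + Y q)"
  by (rule hol_vfI) (auto intro: T10_plus hol_vf_T10 hol_fun_add hol_vf_fun hol_vf_open)

lemma hol_vf_smul:
  assumes "hol_fun A W u" "hol_vf A W X" shows "hol_vf A W (\<lambda>q. u q *\<^sub>V X q)"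
proof (rule hol_vfI[OF hol_vf_open[OF assms(2)]])
  show "u p *\<^sub>V X p \<in> T10 A p" if "p \<in> W" for p using assms that hol_vf_T10 by (auto intro: T10_smul)
  show "hol_fun A V (\<lambda>p. (u p *\<^sub>V X p) f)" if "V \<subseteq> W" "hol_fun A V f" for V f
    unfolding smul_apply
    by (intro hol_fun_mult hol_vf_fun[OF assms(2)] hol_fun_subset[OF assms(1)] hol_fun_open[OF that(2)] that)
qed

lemma hol_vf_sum:
  "open W \<Longrightarrow> (\<And>i. i \<in> I \<Longrightarrow> hol_vf A W (F i)) \<Longrightarrow> hol_vf A W (\<lambda>q. \<Sum>i\<in>I. F i q)"
  by (induction I rule: infinite_finite_induct) (auto intro: hol_vf_zero hol_vf_add)

lemma pz_hol_vf: "(U,\<phi>) \<in> A \<Longrightarrow> hol_vf A U (pz U \<phi> i)"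
  by (rule hol_vfI) (auto intro: chart_open pz_T10 pz_hol_fun)

lemma pz_smooth_vf: "(U,\<phi>) \<in> A \<Longrightarrow> smooth_vf A U (pz U \<phi> i)"
  unfolding smooth_vf_def smooth_cvf_def by (auto intro: chart_open pz_T10 pz_CT pz_smooth)

lemma hol_vf_coord:
  "hol_vf A W X \<Longrightarrow> (U,\<phi>) \<in> A \<Longrightarrow> hol_fun A (W \<inter> U) (\<lambda>q. X q (\<lambda>r. \<phi> r $ i))"
  by (rule hol_vf_fun) (auto intro: hol_fun_subset[OF hol_fun_coord] dest: hol_vf_open chart_open)

lemma smooth_cvf_coord:
  "smooth_cvf A W X \<Longrightarrow> (U,\<phi>) \<in> A \<Longrightarrow> smooth_fun A (W \<inter> U) (\<lambda>q. X q (\<lambda>r. \<phi> r $ i))"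
  by (rule smooth_cvf_fun) (auto intro: smooth_fun_subset[OF hol_imp_smooth[OF hol_fun_coord]] dest: smooth_cvf_open chart_open)

lemma smooth_vf_local:
  assumes "\<And>p. p \<in> W \<Longrightarrow> \<exists>V. p \<in> V \<and> V \<subseteq> W \<and> smooth_vf A V X" shows "smooth_vf A W X"
proof -
  have o: "open W" by (subst open_subopen) (use assms smooth_vf_open in metis)
  have T: "X p \<in> T10 A p" if "p \<in> W" for p using assms[OF that] smooth_vf_T10 by blast
  have "smooth_fun A V (\<lambda>p. X p f)" if V: "V \<subseteq> W" "smooth_fun A V f" for V f
  proof (rule smooth_fun_local)
    fix p assume p: "p \<in> V"
    obtain V' where V': "p \<in> V'" "V' \<subseteq> W" "smooth_vf A V' X" using assms p V by blast
    have "open (V \<inter> V')" using smooth_fun_open[OF V(2)] smooth_vf_open[OF V'(3)] by auto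
    from smooth_fun_subset[OF V(2) this]
    have "smooth_fun A (V \<inter> V') (\<lambda>p. X p f)" by (intro smooth_cvf_fun[OF smooth_vf_cvf[OF V'(3)]]) auto
    then show "\<exists>U. p \<in> U \<and> U \<subseteq> V \<and> smooth_fun A U (\<lambda>p. X p f)" using p V' by blast
  qed
  then show ?thesis using o T T10_CT by (simp add: smooth_vf_def smooth_cvf_def)
qed

lemma hol_imp_smooth_vf:
  assumes X: "hol_vf A W X" shows "smooth_vf A W X"
proof (rule smooth_vf_local)
  fix p assume p: "p \<in> W"
  obtain U \<phi> where U: "(U,\<phi>) \<in> A" "p \<in> U" using chart_ex by blast
  have o: "open (W \<inter> U)" using hol_vf_open[OF X] chart_open[OF U(1)] by auto
  have "smooth_vf A (W \<inter> U) (\<lambda>q. \<Sum>i\<in>UNIV. X q (\<lambda>r. \<phi> r $ i) *\<^sub>V pz U \<phi> i q)"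
    by (rule smooth_vf_sum[OF o], rule smooth_vf_smul[OF hol_imp_smooth[OF hol_vf_coord[OF X U(1)]]
        smooth_vf_subset[OF pz_smooth_vf[OF U(1)] o]]) auto
  then have "smooth_vf A (W \<inter> U) X"
    by (rule smooth_vf_cong) (rule T10_expand[OF hol_vf_T10[OF X] U(1), symmetric], auto)
  then show "\<exists>V. p \<in> V \<and> V \<subseteq> W \<and> smooth_vf A V X"
    by (intro exI[of _ "W \<inter> U"]) (use p U in auto)
qed

text \<open>Constant coefficients with respect to the coordinate fields of a chart. Pointwise
  statements about vectors can therefore be tested on local holomorphic fields.\<close>

lemma T10_extend:
  assumes "v \<in> T10 A p" obtains W Y where "p \<in> W" "hol_vf A W Y" "Y p = v"
proof -
  obtain U \<phi> where U: "(U,\<phi>) \<in> A" "p \<in> U" using chart_ex by blast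
  have "hol_vf A U (\<lambda>q. \<Sum>i\<in>UNIV. v (\<lambda>q. \<phi> q $ i) *\<^sub>V pz U \<phi> i q)"
    by (intro hol_vf_sum hol_vf_smul hol_fun_const pz_hol_vf chart_open[OF U(1)] U)
  then show ?thesis by (rule that[OF U(2)]) (rule T10_expand[OF assms U, symmetric])
qed

lemma part10_smooth:
  assumes Y: "smooth_cvf A W Y" shows "smooth_vf A W (\<lambda>q. part10 A q (Y q))"
proof (rule smooth_vf_local)
  fix p assume p: "p \<in> W"
  obtain U \<phi> where U: "(U,\<phi>) \<in> A" "p \<in> U" using chart_ex by blast
  have o: "open (W \<inter> U)" using smooth_cvf_open[OF Y] chart_open[OF U(1)] by auto
  have "smooth_vf A (W \<inter> U) (\<lambda>q. \<Sum>i\<in>UNIV. Y q (\<lambda>r. \<phi> r $ i) *\<^sub>V pz U \<phi> i q)"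
    by (rule smooth_vf_sum[OF o], rule smooth_vf_smul[OF smooth_cvf_coord[OF Y U(1)]
        smooth_vf_subset[OF pz_smooth_vf[OF U(1)] o]]) auto
  then have "smooth_vf A (W \<inter> U) (\<lambda>q. part10 A q (Y q))"
    by (rule smooth_vf_cong) (rule part10_coord[OF smooth_cvf_CT[OF Y] U(1), symmetric], auto)
  then show "\<exists>V. p \<in> V \<and> V \<subseteq> W \<and> smooth_vf A V (\<lambda>q. part10 A q (Y q))"
    by (intro exI[of _ "W \<inter> U"]) (use p U in auto)
qed

lemma conj_part01:
  assumes "v \<in> CT A p" shows "conjv (part01 A p v) = part10 A p (conjv v)"
proof -
  note v = part_props[OF assms]
  have "conjv v = conjv (part01 A p v) + conjv (part10 A p v)"
    by (subst v(3)) simp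
  then show ?thesis by (rule part10_eqI[OF v(2) v(1), symmetric])
qed

lemma part01_smooth:
  assumes Y: "smooth_cvf A W Y" shows "smooth_vf A W (\<lambda>q. conjv (part01 A q (Y q)))"
  by (rule smooth_vf_cong[OF part10_smooth[OF smooth_cvf_conjf[OF Y]]])
     (use conj_part01 smooth_cvf_CT[OF Y] in \<open>auto simp: conjf_def\<close>)

subsection \<open>The Lie bracket\<close>

lemma bracket_smooth: "smooth_near A p f \<Longrightarrow> bracket A X Y p f = X p (\<lambda>q. Y q f) - Y p (\<lambda>q. X q f)"
  by (simp add: bracket_def)

text \<open>In the product rule the terms containing one derivative of each factor cancel by
  antisymmetry.\<close>

lemma bracket_CT:
  assumes X: "smooth_cvf A W X" and Y: "smooth_cvf A W Y" and p: "p \<in> W"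
  shows "bracket A X Y p \<in> CT A p"
proof (rule CT_I)
  note oW = smooth_cvf_open[OF X]
  note Xp = smooth_cvf_CT[OF X p] and Yp = smooth_cvf_CT[OF Y p]
  note sX = smooth_cvf_near[OF X p] and sY = smooth_cvf_near[OF Y p]
  { fix f g V assume fg: "smooth_near A p f" "smooth_near A p g" "open V" "p \<in> V" "\<And>q. q \<in> V \<Longrightarrow> f q = g q"
    have "Z q f = Z q g" if "smooth_cvf A W Z" "q \<in> V \<inter> W" for Z q
      using CT_cong[OF smooth_cvf_CT[OF that(1)] fg(3)] fg(5) that(2) by blast
    then have "X p (\<lambda>q. Y q f) = X p (\<lambda>q. Y q g)" "Y p (\<lambda>q. X q f) = Y p (\<lambda>q. X q g)"
      using X Y fg(3,4) oW p
      by (auto intro!: CT_cong[OF Xp, of "V \<inter> W"] CT_cong[OF Yp, of "V \<inter> W"])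
    then show "bracket A X Y p f = bracket A X Y p g" using fg by (simp add: bracket_smooth) }
  { fix f g assume f: "smooth_near A p f" and g: "smooth_near A p g"
    \<comment> \<open>The inner field acts on \<open>f\<close> and \<open>g\<close> at points near
      \<open>p\<close>, so its linearity and product rule can be used only on a neighbourhood where
      both are smooth.\<close>
    obtain Vf where Vf: "open Vf" "p \<in> Vf" "\<And>q. q \<in> Vf \<Longrightarrow> smooth_near A q f" using smooth_near_nbhd[OF f] by blast
    obtain Vg where Vg: "open Vg" "p \<in> Vg" "\<And>q. q \<in> Vg \<Longrightarrow> smooth_near A q g" using smooth_near_nbhd[OF g] by blast
    let ?V = "Vf \<inter> Vg \<inter> W"
    have V: "open ?V" "p \<in> ?V" using Vf Vg oW p by auto
    have a: "z (\<lambda>q. Z q (\<lambda>r. f r + g r)) = z (\<lambda>q. Z q f + Z q g)"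
      if "smooth_cvf A W Z" "z \<in> CT A p" for Z z
      by (rule CT_cong[OF that(2) V]) (use CT_add[OF smooth_cvf_CT[OF that(1)] Vf(3) Vg(3)] in auto)
    have m: "z (\<lambda>q. Z q (\<lambda>r. f r * g r)) = z (\<lambda>q. Z q f * g q + f q * Z q g)"
      if "smooth_cvf A W Z" "z \<in> CT A p" for Z z
      by (rule CT_cong[OF that(2) V]) (use CT_mult[OF smooth_cvf_CT[OF that(1)] Vf(3) Vg(3)] in auto)
    show "bracket A X Y p (\<lambda>q. f q + g q) = bracket A X Y p f + bracket A X Y p g"
      using f g by (simp add: bracket_smooth smooth_near_add a[OF X Yp] a[OF Y Xp]
          CT_add[OF Xp sY sY] CT_add[OF Yp sX sX])
    show "bracket A X Y p (\<lambda>q. f q * g q) = bracket A X Y p f * g p + f p * bracket A X Y p g"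
      using f g
      by (simp add: bracket_smooth smooth_near_mult m[OF X Yp] m[OF Y Xp]
          CT_add[OF Xp smooth_near_mult smooth_near_mult] CT_add[OF Yp smooth_near_mult smooth_near_mult] sX sY
          CT_mult[OF Xp sY g] CT_mult[OF Xp f sY] CT_mult[OF Yp sX g] CT_mult[OF Yp f sX], simp add: algebra_simps) }
  { fix c f assume f: "smooth_near A p f"
    obtain Vf where Vf: "open Vf" "p \<in> Vf" "\<And>q. q \<in> Vf \<Longrightarrow> smooth_near A q f" using smooth_near_nbhd[OF f] by blast
    let ?V = "Vf \<inter> W"
    have V: "open ?V" "p \<in> ?V" using Vf oW p by auto
    have a: "z (\<lambda>q. Z q (\<lambda>r. c * f r)) = z (\<lambda>q. c * Z q f)"
      if "smooth_cvf A W Z" "z \<in> CT A p" for Z z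
      by (rule CT_cong[OF that(2) V]) (use CT_cmult[OF smooth_cvf_CT[OF that(1)] Vf(3)] in auto)
    show "bracket A X Y p (\<lambda>q. c * f q) = c * bracket A X Y p f"
      using f by (simp add: bracket_smooth smooth_near_cmult a[OF X Yp] a[OF Y Xp]
          CT_cmult[OF Xp sY] CT_cmult[OF Yp sX], simp add: algebra_simps) }
qed (simp add: bracket_def)

lemma bracket_cong:
  assumes X: "smooth_cvf A W X" and Y: "smooth_cvf A W Y" and p: "p \<in> W"
    and eq: "\<And>q. q \<in> W \<Longrightarrow> X q = X' q" "\<And>q. q \<in> W \<Longrightarrow> Y q = Y' q"
  shows "bracket A X Y p = bracket A X' Y' p"
proof
  fix f
  have "X p (\<lambda>q. Y q f) = X p (\<lambda>q. Y' q f)"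
    by (rule CT_cong[OF smooth_cvf_CT[OF X p] smooth_cvf_open[OF X] p]) (simp add: eq)
  moreover have "Y p (\<lambda>q. X q f) = Y p (\<lambda>q. X' q f)"
    by (rule CT_cong[OF smooth_cvf_CT[OF Y p] smooth_cvf_open[OF X] p]) (simp add: eq)
  ultimately show "bracket A X Y p f = bracket A X' Y' p f" using eq p by (simp add: bracket_def)
qed

lemma bracket_self: "bracket A X X p = 0"
  by (simp add: bracket_def fun_eq_iff)

lemma bracket_conjf: "bracket A (conjf X) (conjf Y) p = conjv (bracket A X Y p)"
  by (auto simp: bracket_def fun_eq_iff conjf_def conjv_def)

lemma bracket_add:
  assumes X: "smooth_cvf A W X" and Y: "smooth_cvf A W Y" and Z: "smooth_cvf A W Z" and p: "p \<in> W"
  shows "bracket A X (\<lambda>q. Y q + Z q) p = bracket A X Y p + bracket A X Z p"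
proof
  fix f
  show "bracket A X (\<lambda>q. Y q + Z q) p f = (bracket A X Y p + bracket A X Z p) f"
    using smooth_cvf_near[OF Y p] smooth_cvf_near[OF Z p] CT_add[OF smooth_cvf_CT[OF X p]]
    by (simp add: bracket_def)
qed

lemma bracket_smul:
  assumes X: "smooth_cvf A W X" and Y: "smooth_cvf A W Y" and u: "smooth_near A p u" and p: "p \<in> W"
  shows "bracket A X (\<lambda>q. u q *\<^sub>V Y q) p = X p u *\<^sub>V Y p + u p *\<^sub>V bracket A X Y p"
proof
  fix f
  show "bracket A X (\<lambda>q. u q *\<^sub>V Y q) p f = (X p u *\<^sub>V Y p + u p *\<^sub>V bracket A X Y p) f"
  proof (cases "smooth_near A p f")
    case True
    then show ?thesis
      by (simp add: bracket_def CT_mult[OF smooth_cvf_CT[OF X p] u smooth_cvf_near[OF Y p]], simp add: algebra_simps)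
  next
    case False
    then show ?thesis using CT_zero[OF smooth_cvf_CT[OF Y p]] by (simp add: bracket_def)
  qed
qed

lemma bracket_T10:
  assumes X: "smooth_vf A W X" and Y: "smooth_vf A W Y" and p: "p \<in> W"
  shows "bracket A X Y p \<in> T10 A p"
proof -
  have "bracket A X Y p (\<lambda>q. cnj (f q)) = 0" if f: "hol_near A p f" for f
  proof -
    obtain V where V: "p \<in> V" "hol_fun A V f" using f by (auto simp: hol_near_def)
    have "z (\<lambda>q. Z q (\<lambda>q. cnj (f q))) = 0" if "smooth_vf A W Z" "z \<in> CT A p" for Z z
    proof -
      have "z (\<lambda>q. Z q (\<lambda>q. cnj (f q))) = z (\<lambda>q. 0)"
        by (rule CT_cong[OF that(2), of "V \<inter> W"])
           (use V hol_fun_open[OF V(2)] smooth_vf_open[OF X] p T10_cnj[OF smooth_vf_T10[OF that(1)]] hol_nearI[OF V(2)] in auto)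
      then show ?thesis using CT_const[OF that(2)] by simp
    qed
    from this[OF X T10_CT[OF smooth_vf_T10[OF Y p]]] this[OF Y T10_CT[OF smooth_vf_T10[OF X p]]] hol_near_smooth[OF f]
    show ?thesis by (simp add: bracket_def)
  qed
  then show ?thesis using bracket_CT[OF smooth_vf_cvf[OF X] smooth_vf_cvf[OF Y] p] by (simp add: T10_def)
qed

lemma conjf_hol_annihilates: "hol_vf A W X \<Longrightarrow> p \<in> W \<Longrightarrow> hol_near A p f \<Longrightarrow> conjf X p f = 0"
  using T10_cnj[OF hol_vf_T10] by (simp add: conjf_def conjv_def)

lemma hol_vf_near:
  assumes "hol_vf A W X" "p \<in> W" "hol_near A p f" shows "hol_near A p (\<lambda>q. X q f)"
proof -
  obtain V where V: "p \<in> V" "hol_fun A V f" using assms(3) by (auto simp: hol_near_def)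
  have o: "open (V \<inter> W)" using hol_fun_open[OF V(2)] hol_vf_open[OF assms(1)] by auto
  have "hol_fun A (V \<inter> W) (\<lambda>q. X q f)"
    by (rule hol_vf_fun[OF assms(1) hol_fun_subset[OF V(2) o]]) auto
  then show ?thesis by (rule hol_nearI) (use V assms in auto)
qed

text \<open>Let f be holomorphic. \<open>Y\<close> kills conj f, and \<open>conjf X\<close> maps
  conj f to the conjugate of the holomorphic function X f, which \<open>Y\<close> kills too. This is
  what lets the Lie derivative along \<open>conjf X\<close> act on (1,0)-fields.\<close>

lemma bracket_conjf_T10:
  assumes X: "hol_vf A W X" and Y: "smooth_vf A W Y" and p: "p \<in> W"
  shows "bracket A (conjf X) Y p \<in> T10 A p"
proof -
  note Xs = smooth_cvf_conjf[OF smooth_vf_cvf[OF hol_imp_smooth_vf[OF X]]]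
  have "bracket A (conjf X) Y p (\<lambda>q. cnj (f q)) = 0" if f: "hol_near A p f" for f
  proof -
    obtain V where V: "p \<in> V" "hol_fun A V f" using f by (auto simp: hol_near_def)
    have "conjf X p (\<lambda>q. Y q (\<lambda>q. cnj (f q))) = conjf X p (\<lambda>q. 0)"
      by (rule CT_cong[OF smooth_cvf_CT[OF Xs p], of "V \<inter> W"])
         (use V hol_fun_open[OF V(2)] smooth_vf_open[OF Y] p T10_cnj[OF smooth_vf_T10[OF Y]] hol_nearI[OF V(2)] in auto)
    moreover have "Y p (\<lambda>q. conjf X q (\<lambda>q. cnj (f q))) = 0"
      using T10_cnj[OF smooth_vf_T10[OF Y p] hol_vf_near[OF X p f]] by (simp add: conjf_def conjv_def)
    ultimately show ?thesis
      using hol_near_smooth[OF f] CT_const[OF smooth_cvf_CT[OF Xs p]] by (simp add: bracket_def)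
  qed
  then show ?thesis using bracket_CT[OF Xs smooth_vf_cvf[OF Y] p] by (simp add: T10_def)
qed

text \<open>\<open>conjf X\<close> kills holomorphic functions, among them the coordinates and their
  derivatives along \<open>Y\<close>; hence all coordinates of the bracket vanish.\<close>

lemma bracket_conjf_hol:
  assumes X: "hol_vf A W X" and Y: "hol_vf A W Y" and p: "p \<in> W"
  shows "bracket A (conjf X) Y p = 0"
proof -
  obtain U \<phi> where U: "(U,\<phi>) \<in> A" "p \<in> U" using chart_ex by blast
  note Y' = hol_imp_smooth_vf[OF Y]
  show ?thesis
  proof (rule T10_eqI[OF bracket_conjf_T10[OF X Y' p] T10_zero U])
    fix i
    have z: "hol_near A q (\<lambda>q. \<phi> q $ i)" if "q \<in> U" for q by (rule hol_nearI[OF hol_fun_coord[OF U(1)] that])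
    have "Y p (\<lambda>q. conjf X q (\<lambda>q. \<phi> q $ i)) = Y p (\<lambda>q. 0)"
      by (rule CT_cong[OF T10_CT[OF hol_vf_T10[OF Y p]], of "U \<inter> W"])
         (use U chart_open[OF U(1)] hol_vf_open[OF Y] p z conjf_hol_annihilates[OF X] in auto)
    then show "bracket A (conjf X) Y p (\<lambda>q. \<phi> q $ i) = 0 (\<lambda>q. \<phi> q $ i)"
      using hol_near_smooth[OF z[OF U(2)]] conjf_hol_annihilates[OF X p hol_vf_near[OF Y p z[OF U(2)]]]
        CT_const[OF T10_CT[OF hol_vf_T10[OF Y p]]]
      by (simp add: bracket_def)
  qed
qed

lemma bracket_hol:
  assumes X: "hol_vf A W X" and Y: "hol_vf A W Y"
  shows "hol_vf A W (bracket A X Y)"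
proof (rule hol_vfI[OF hol_vf_open[OF X] bracket_T10[OF hol_imp_smooth_vf[OF X] hol_imp_smooth_vf[OF Y]]])
  fix V f assume V: "V \<subseteq> W" "hol_fun A V f"
  have "hol_fun A V (\<lambda>p. X p (\<lambda>q. Y q f) - Y p (\<lambda>q. X q f))"
    by (intro hol_fun_diff hol_vf_fun[OF X] hol_vf_fun[OF Y] V)
  then show "hol_fun A V (\<lambda>p. bracket A X Y p f)"
    by (rule hol_fun_cong) (use smooth_nearI[OF hol_imp_smooth[OF V(2)]] in \<open>auto simp: bracket_smooth\<close>)
qed

subsection \<open>Tensoriality\<close>

text \<open>Linearity over smooth functions at the point \<open>p\<close>. Fields are total
  functions that are meaningful only on some open set, so the last clause demands that the value
  depend on the germ.\<close>

definition tensorial :: "'m \<Rightarrow> ('m cfield \<Rightarrow> complex) \<Rightarrow> bool" where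
  "tensorial p \<Lambda> \<longleftrightarrow>
     (\<forall>W Y Z. p \<in> W \<and> smooth_vf A W Y \<and> smooth_vf A W Z \<longrightarrow> \<Lambda> (\<lambda>q. Y q + Z q) = \<Lambda> Y + \<Lambda> Z) \<and>
     (\<forall>W Y u. p \<in> W \<and> smooth_vf A W Y \<and> smooth_fun A W u \<longrightarrow> \<Lambda> (\<lambda>q. u q *\<^sub>V Y q) = u p * \<Lambda> Y) \<and>
     (\<forall>W Y Z. p \<in> W \<and> smooth_vf A W Y \<and> smooth_vf A W Z \<and> (\<forall>q\<in>W. Y q = Z q) \<longrightarrow> \<Lambda> Y = \<Lambda> Z)"

text \<open>The common shape of Lie derivatives and covariant derivatives at \<open>p\<close>, with
  \<open>w\<close> the vector that differentiates the coefficient. Two such operators with the same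
  \<open>w\<close> differ by something tensorial.\<close>

definition derivation_at :: "'m \<Rightarrow> 'm cvec \<Rightarrow> ('m cfield \<Rightarrow> 'm cvec) \<Rightarrow> bool" where
  "derivation_at p w \<Delta> \<longleftrightarrow>
     (\<forall>W Y. p \<in> W \<and> smooth_vf A W Y \<longrightarrow> \<Delta> Y \<in> T10 A p) \<and>
     (\<forall>W Y Z. p \<in> W \<and> smooth_vf A W Y \<and> smooth_vf A W Z \<longrightarrow> \<Delta> (\<lambda>q. Y q + Z q) = \<Delta> Y + \<Delta> Z) \<and>
     (\<forall>W Y u. p \<in> W \<and> smooth_vf A W Y \<and> smooth_fun A W u \<longrightarrow>
        \<Delta> (\<lambda>q. u q *\<^sub>V Y q) = w u *\<^sub>V Y p + u p *\<^sub>V \<Delta> Y) \<and>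
     (\<forall>W Y Z. p \<in> W \<and> smooth_vf A W Y \<and> smooth_vf A W Z \<and> (\<forall>q\<in>W. Y q = Z q) \<longrightarrow> \<Delta> Y = \<Delta> Z)"

lemma tensorialD:
  assumes "tensorial p \<Lambda>" "p \<in> W" "smooth_vf A W Y"
  shows "smooth_vf A W Z \<Longrightarrow> \<Lambda> (\<lambda>q. Y q + Z q) = \<Lambda> Y + \<Lambda> Z"
    "smooth_fun A W u \<Longrightarrow> \<Lambda> (\<lambda>q. u q *\<^sub>V Y q) = u p * \<Lambda> Y"
    "smooth_vf A W Z \<Longrightarrow> (\<And>q. q \<in> W \<Longrightarrow> Y q = Z q) \<Longrightarrow> \<Lambda> Y = \<Lambda> Z"
proof -
  note t = assms(1)[unfolded tensorial_def]
  show "smooth_vf A W Z \<Longrightarrow> \<Lambda> (\<lambda>q. Y q + Z q) = \<Lambda> Y + \<Lambda> Z"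
    using t[THEN conjunct1, rule_format, of W Y Z] assms by simp
  show "smooth_fun A W u \<Longrightarrow> \<Lambda> (\<lambda>q. u q *\<^sub>V Y q) = u p * \<Lambda> Y"
    using t[THEN conjunct2, THEN conjunct1, rule_format, of W Y u] assms by simp
  show "smooth_vf A W Z \<Longrightarrow> (\<And>q. q \<in> W \<Longrightarrow> Y q = Z q) \<Longrightarrow> \<Lambda> Y = \<Lambda> Z"
    using t[THEN conjunct2, THEN conjunct2, rule_format, of W Y Z] assms by simp
qed

lemma derivation_atD:
  assumes "derivation_at p w \<Delta>" "p \<in> W" "smooth_vf A W Y"
  shows "\<Delta> Y \<in> T10 A p"
    "smooth_vf A W Z \<Longrightarrow> \<Delta> (\<lambda>q. Y q + Z q) = \<Delta> Y + \<Delta> Z"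
    "smooth_fun A W u \<Longrightarrow> \<Delta> (\<lambda>q. u q *\<^sub>V Y q) = w u *\<^sub>V Y p + u p *\<^sub>V \<Delta> Y"
    "smooth_vf A W Z \<Longrightarrow> (\<And>q. q \<in> W \<Longrightarrow> Y q = Z q) \<Longrightarrow> \<Delta> Y = \<Delta> Z"
proof -
  note t = assms(1)[unfolded derivation_at_def]
  show "\<Delta> Y \<in> T10 A p"
    using t[THEN conjunct1, rule_format, of W Y] assms by simp
  note t = t[THEN conjunct2]
  show "smooth_vf A W Z \<Longrightarrow> \<Delta> (\<lambda>q. Y q + Z q) = \<Delta> Y + \<Delta> Z"
    using t[THEN conjunct1, rule_format, of W Y Z] assms by simp
  show "smooth_fun A W u \<Longrightarrow> \<Delta> (\<lambda>q. u q *\<^sub>V Y q) = w u *\<^sub>V Y p + u p *\<^sub>V \<Delta> Y"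
    using t[THEN conjunct2, THEN conjunct1, rule_format, of W Y u] assms by simp
  show "smooth_vf A W Z \<Longrightarrow> (\<And>q. q \<in> W \<Longrightarrow> Y q = Z q) \<Longrightarrow> \<Delta> Y = \<Delta> Z"
    using t[THEN conjunct2, THEN conjunct2, rule_format, of W Y Z] assms by simp
qed

lemma tensorial_sum:
  assumes \<Lambda>: "tensorial p \<Lambda>" and W: "open W" "p \<in> W"
    and F: "\<And>i. i \<in> I \<Longrightarrow> smooth_fun A W (u i)" "\<And>i. i \<in> I \<Longrightarrow> smooth_vf A W (F i)" and I: "finite I"
  shows "\<Lambda> (\<lambda>q. \<Sum>i\<in>I. u i q *\<^sub>V F i q) = (\<Sum>i\<in>I. u i p * \<Lambda> (F i))"
  using I F
proof (induction I rule: finite_induct)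
  case empty
  \<comment> \<open>The value on the zero field is obtained from homogeneity with factor 0.\<close>
  have "\<Lambda> (\<lambda>q. 0 *\<^sub>V (\<lambda>q. 0) q) = 0 * \<Lambda> (\<lambda>q. 0)"
    by (rule tensorialD(2)[OF \<Lambda> W(2) smooth_vf_zero[OF W(1)] smooth_fun_const[OF W(1)]])
  then show ?case by (simp add: smul_distribs zero_fun_def)
next
  case (insert i I)
  have 1: "smooth_vf A W (\<lambda>q. u i q *\<^sub>V F i q)" using insert by (intro smooth_vf_smul) auto
  have 2: "smooth_vf A W (\<lambda>q. \<Sum>i\<in>I. u i q *\<^sub>V F i q)" using insert by (intro smooth_vf_sum W smooth_vf_smul) auto
  have "\<Lambda> (\<lambda>q. u i q *\<^sub>V F i q + (\<Sum>i\<in>I. u i q *\<^sub>V F i q)) = \<Lambda> (\<lambda>q. u i q *\<^sub>V F i q) + \<Lambda> (\<lambda>q. \<Sum>i\<in>I. u i q *\<^sub>V F i q)"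
    by (rule tensorialD(1)[OF \<Lambda> W(2) 1 2])
  moreover have "\<Lambda> (\<lambda>q. u i q *\<^sub>V F i q) = u i p * \<Lambda> (F i)"
    by (rule tensorialD(2)[OF \<Lambda> W(2)]) (use insert in auto)
  moreover have "(\<lambda>q. \<Sum>i\<in>insert i I. u i q *\<^sub>V F i q) = (\<lambda>q. u i q *\<^sub>V F i q + (\<Sum>i\<in>I. u i q *\<^sub>V F i q))"
    by (rule ext) (rule sum.insert[OF insert(1,2)])
  moreover have "\<Lambda> (\<lambda>q. \<Sum>i\<in>I. u i q *\<^sub>V F i q) = (\<Sum>i\<in>I. u i p * \<Lambda> (F i))"
    by (rule insert.IH) (use insert(4,5) in auto)
  ultimately show ?case by (simp only: sum.insert[OF insert(1,2)])
qed

lemma tensorial_expand: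
  assumes \<Lambda>: "tensorial p \<Lambda>" and Y: "smooth_vf A W Y" "p \<in> W" and U: "(U,\<phi>) \<in> A" "p \<in> U"
  shows "\<Lambda> Y = (\<Sum>i\<in>UNIV. Y p (\<lambda>q. \<phi> q $ i) * \<Lambda> (pz U \<phi> i))"
proof -
  let ?V = "W \<inter> U"
  have o: "open ?V" using smooth_vf_open[OF Y(1)] chart_open[OF U(1)] by auto
  have u: "smooth_fun A ?V (\<lambda>q. Y q (\<lambda>r. \<phi> r $ i))" for i by (rule smooth_cvf_coord[OF smooth_vf_cvf[OF Y(1)] U(1)])
  have z: "smooth_vf A ?V (pz U \<phi> i)" for i by (rule smooth_vf_subset[OF pz_smooth_vf[OF U(1)] o]) auto
  have eq: "Y q = (\<Sum>i\<in>UNIV. Y q (\<lambda>r. \<phi> r $ i) *\<^sub>V pz U \<phi> i q)" if "q \<in> ?V" for q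
    using T10_expand[OF smooth_vf_T10[OF Y(1)] U(1)] that by auto
  have s1: "smooth_vf A ?V Y" by (rule smooth_vf_subset[OF Y(1) o]) auto
  have s2: "smooth_vf A ?V (\<lambda>q. \<Sum>i\<in>UNIV. Y q (\<lambda>r. \<phi> r $ i) *\<^sub>V pz U \<phi> i q)"
    by (intro smooth_vf_sum smooth_vf_smul o u z)
  have "\<Lambda> Y = \<Lambda> (\<lambda>q. \<Sum>i\<in>UNIV. Y q (\<lambda>r. \<phi> r $ i) *\<^sub>V pz U \<phi> i q)"
    by (rule tensorialD(3)[OF \<Lambda> _ s1 s2 eq]) (use Y U in auto)
  also have "\<dots> = (\<Sum>i\<in>UNIV. Y p (\<lambda>q. \<phi> q $ i) * \<Lambda> (pz U \<phi> i))"
    using Y U by (intro tensorial_sum[OF \<Lambda> o]) (auto intro: u z)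
  finally show ?thesis .
qed

text \<open>The coordinate fields are holomorphic and span the smooth (1,0)-fields over the smooth
  functions.\<close>

lemma tensorial_zero:
  assumes \<Lambda>: "tensorial p \<Lambda>" and "\<And>W Y. hol_vf A W Y \<Longrightarrow> p \<in> W \<Longrightarrow> \<Lambda> Y = 0"
    and Y: "smooth_vf A W Y" "p \<in> W"
  shows "\<Lambda> Y = 0"
proof -
  obtain U \<phi> where U: "(U,\<phi>) \<in> A" "p \<in> U" using chart_ex by blast
  show ?thesis using tensorial_expand[OF \<Lambda> Y U] assms(2)[OF pz_hol_vf[OF U(1)] U(2)] by simp
qed

lemma tensorial_diff:
  assumes "derivation_at p w \<Delta>" "derivation_at p w \<Delta>'"
  shows "tensorial p (\<lambda>Y. (\<Delta> Y - \<Delta>' Y) f)"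
  unfolding tensorial_def
proof (intro conjI allI impI; elim conjE)
  fix W Y Z assume W: "p \<in> W" "smooth_vf A W Y" "smooth_vf A W Z"
  note d = derivation_atD[OF assms(1) W(1,2)] derivation_atD[OF assms(2) W(1,2)]
  show "(\<Delta> (\<lambda>q. Y q + Z q) - \<Delta>' (\<lambda>q. Y q + Z q)) f = (\<Delta> Y - \<Delta>' Y) f + (\<Delta> Z - \<Delta>' Z) f"
    by (simp add: d(2)[OF W(3)] d(6)[OF W(3)])
  assume eq: "\<forall>q\<in>W. Y q = Z q"
  have "\<Delta> Y = \<Delta> Z" by (rule d(4)[OF W(3)]) (use eq in simp)
  moreover have "\<Delta>' Y = \<Delta>' Z" by (rule d(8)[OF W(3)]) (use eq in simp)
  ultimately show "(\<Delta> Y - \<Delta>' Y) f = (\<Delta> Z - \<Delta>' Z) f" by simp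
next
  fix W Y u assume W: "p \<in> W" "smooth_vf A W Y" "smooth_fun A W u"
  note d = derivation_atD(3)[OF assms(1) W] derivation_atD(3)[OF assms(2) W]
  show "(\<Delta> (\<lambda>q. u q *\<^sub>V Y q) - \<Delta>' (\<lambda>q. u q *\<^sub>V Y q)) f = u p * (\<Delta> Y - \<Delta>' Y) f"
    by (simp add: d algebra_simps)
qed

text \<open>The difference of two derivations over the same vector is tensorial, hence determined by
  holomorphic fields. This reduction carries the comparisons of \<open>D\<close> with Lie
  derivatives from holomorphic to smooth fields.\<close>

lemma derivations_eq:
  assumes "derivation_at p w \<Delta>" "derivation_at p w \<Delta>'"
    and "\<And>W Y. hol_vf A W Y \<Longrightarrow> p \<in> W \<Longrightarrow> \<Delta> Y = \<Delta>' Y" and Y: "smooth_vf A W Y" "p \<in> W"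
  shows "\<Delta> Y = \<Delta>' Y"
proof
  fix f
  have "(\<Delta> Y - \<Delta>' Y) f = 0"
    by (rule tensorial_zero[OF tensorial_diff[OF assms(1,2)] _ Y]) (simp add: assms(3))
  then show "\<Delta> Y f = \<Delta>' Y f" by simp
qed

lemma derivation_at_bracketI:
  assumes X: "smooth_cvf A V X" "p \<in> V"
    and T: "\<And>W Y. p \<in> W \<Longrightarrow> smooth_vf A W Y \<Longrightarrow> bracket A X Y p \<in> T10 A p"
  shows "derivation_at p (X p) (\<lambda>Y. bracket A X Y p)"
  unfolding derivation_at_def
proof (intro conjI allI impI; elim conjE)
  fix W Y Z assume W: "p \<in> W" "smooth_vf A W Y" "smooth_vf A W Z"
  have o: "open (W \<inter> V)" using smooth_vf_open[OF W(2)] smooth_cvf_open[OF X(1)] by auto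
  have s: "smooth_cvf A (W \<inter> V) X" "smooth_cvf A (W \<inter> V) Y" "smooth_cvf A (W \<inter> V) Z"
    using smooth_cvf_subset[OF X(1) o] smooth_cvf_subset[OF smooth_vf_cvf[OF W(2)] o] smooth_cvf_subset[OF smooth_vf_cvf[OF W(3)] o]
    by auto
  show "bracket A X (\<lambda>q. Y q + Z q) p = bracket A X Y p + bracket A X Z p"
    by (rule bracket_add[OF s]) (use W X in auto)
  assume "\<forall>q\<in>W. Y q = Z q"
  then show "bracket A X Y p = bracket A X Z p"
    by (intro bracket_cong[OF s(1,2)]) (use W X in auto)
next
  fix W Y u assume W: "p \<in> W" "smooth_vf A W Y" "smooth_fun A W u"
  have o: "open (W \<inter> V)" using smooth_vf_open[OF W(2)] smooth_cvf_open[OF X(1)] by auto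
  have s: "smooth_cvf A (W \<inter> V) X" "smooth_cvf A (W \<inter> V) Y"
    using smooth_cvf_subset[OF X(1) o] smooth_cvf_subset[OF smooth_vf_cvf[OF W(2)] o] by auto
  show "bracket A X (\<lambda>q. u q *\<^sub>V Y q) p = X p u *\<^sub>V Y p + u p *\<^sub>V bracket A X Y p"
    by (rule bracket_smul[OF s smooth_nearI[OF W(3,1)]]) (use W X in auto)
qed (use T in auto)

lemma derivation_bracket:
  assumes X: "hol_vf A V X" "p \<in> V" shows "derivation_at p (X p) (\<lambda>Y. bracket A X Y p)"
proof (rule derivation_at_bracketI[OF smooth_vf_cvf[OF hol_imp_smooth_vf[OF X(1)]] X(2)])
  fix W Y assume W: "p \<in> W" "smooth_vf A W Y"
  have o: "open (W \<inter> V)" using smooth_vf_open[OF W(2)] hol_vf_open[OF X(1)] by auto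
  show "bracket A X Y p \<in> T10 A p"
    by (rule bracket_T10[OF smooth_vf_subset[OF hol_imp_smooth_vf[OF X(1)] o] smooth_vf_subset[OF W(2) o]]) (use W X in auto)
qed

lemma derivation_bracket_conjf:
  assumes X: "hol_vf A V X" "p \<in> V" shows "derivation_at p (conjf X p) (\<lambda>Y. bracket A (conjf X) Y p)"
proof (rule derivation_at_bracketI[OF smooth_cvf_conjf[OF smooth_vf_cvf[OF hol_imp_smooth_vf[OF X(1)]]] X(2)])
  fix W Y assume W: "p \<in> W" "smooth_vf A W Y"
  have o: "open (W \<inter> V)" using smooth_vf_open[OF W(2)] hol_vf_open[OF X(1)] by auto
  show "bracket A (conjf X) Y p \<in> T10 A p"
    by (rule bracket_conjf_T10[OF hol_vf_subset[OF X(1) o] smooth_vf_subset[OF W(2) o]]) (use W X in auto)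
qed

lemma derivation_uminus:
  assumes \<Delta>: "derivation_at p w \<Delta>" and w: "w \<in> CT A p" and Y: "p \<in> W" "smooth_vf A W Y"
  shows "\<Delta> (\<lambda>q. - Y q) = - \<Delta> Y"
  using derivation_atD(3)[OF \<Delta> Y smooth_fun_const[OF smooth_vf_open[OF Y(2)], of "-1"]] CT_const[OF w]
  by (simp add: smul_distribs)

lemma smooth_vf_uminus: "smooth_vf A W Y \<Longrightarrow> smooth_vf A W (\<lambda>q. - Y q)"
  using smooth_vf_smul[OF smooth_fun_const[OF smooth_vf_open, of W Y "-1"], of Y] by (simp add: smul_distribs)

text \<open>For bundle maps known only through their action on holomorphic fields, such as
  multiplication by a holomorphic field: a smooth field is locally a combination of coordinate
  fields with smooth coefficients, and linearity does the rest.\<close>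

lemma smooth_vf_linear_image:
  assumes lin: "\<And>q a b c. q \<in> W \<Longrightarrow> a \<in> T10 A q \<Longrightarrow> b \<in> T10 A q \<Longrightarrow> T q (a + b) = T q a + T q b \<and> T q (c *\<^sub>V a) = c *\<^sub>V T q a"
    and hol: "\<And>V Y. V \<subseteq> W \<Longrightarrow> hol_vf A V Y \<Longrightarrow> smooth_vf A V (\<lambda>q. T q (Y q))"
    and Y: "smooth_vf A W Y"
  shows "smooth_vf A W (\<lambda>q. T q (Y q))"
proof (rule smooth_vf_local)
  fix p assume p: "p \<in> W"
  obtain U \<phi> where U: "(U,\<phi>) \<in> A" "p \<in> U" using chart_ex by blast
  have o: "open (W \<inter> U)" using smooth_vf_open[OF Y] chart_open[OF U(1)] by auto
  have z: "hol_vf A (W \<inter> U) (pz U \<phi> i)" for i by (rule hol_vf_subset[OF pz_hol_vf[OF U(1)] o]) auto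
  have lin_sum: "T q (\<Sum>i\<in>I. c i *\<^sub>V F i) = (\<Sum>i\<in>I. c i *\<^sub>V T q (F i))"
    if q: "q \<in> W" and I: "finite I" and F: "\<And>i. F i \<in> T10 A q" for q c F and I :: "'n set"
    using I
  proof (induction I rule: finite_induct)
    case empty
    have "T q (0 *\<^sub>V 0) = 0 *\<^sub>V T q 0" using lin[OF q T10_zero T10_zero] by blast
    then show ?case by (simp only: smul_distribs sum.empty)
  next
    case (insert i I)
    have "T q (c i *\<^sub>V F i + (\<Sum>i\<in>I. c i *\<^sub>V F i)) = T q (c i *\<^sub>V F i) + T q (\<Sum>i\<in>I. c i *\<^sub>V F i)"
      by (rule lin[OF q T10_smul[OF F] T10_sum[OF T10_smul[OF F]], THEN conjunct1])
    also have "T q (c i *\<^sub>V F i) = c i *\<^sub>V T q (F i)" using lin[OF q F F] by blast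
    finally show ?case by (simp only: sum.insert[OF insert(1,2)] insert.IH)
  qed
  have "smooth_vf A (W \<inter> U) (\<lambda>q. \<Sum>i\<in>UNIV. Y q (\<lambda>r. \<phi> r $ i) *\<^sub>V T q (pz U \<phi> i q))"
    by (rule smooth_vf_sum[OF o], rule smooth_vf_smul[OF smooth_cvf_coord[OF smooth_vf_cvf[OF Y] U(1)] hol[OF _ z]]) auto
  then have "smooth_vf A (W \<inter> U) (\<lambda>q. T q (Y q))"
  proof (rule smooth_vf_cong)
    fix q assume q: "q \<in> W \<inter> U"
    have "T q (\<Sum>i\<in>UNIV. Y q (\<lambda>r. \<phi> r $ i) *\<^sub>V pz U \<phi> i q) = (\<Sum>i\<in>UNIV. Y q (\<lambda>r. \<phi> r $ i) *\<^sub>V T q (pz U \<phi> i q))"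
      by (rule lin_sum) (use q pz_T10[OF U(1)] in auto)
    moreover have "Y q = (\<Sum>i\<in>UNIV. Y q (\<lambda>r. \<phi> r $ i) *\<^sub>V pz U \<phi> i q)"
      by (rule T10_expand[OF smooth_vf_T10[OF Y] U(1)]) (use q in auto)
    ultimately show "(\<Sum>i\<in>UNIV. Y q (\<lambda>r. \<phi> r $ i) *\<^sub>V T q (pz U \<phi> i q)) = T q (Y q)" by metis
  qed
  then show "\<exists>V. p \<in> V \<and> V \<subseteq> W \<and> smooth_vf A V (\<lambda>q. T q (Y q))"
    by (intro exI[of _ "W \<inter> U"]) (use p U in auto)
qed

end

section \<open>CV-structures\<close>

locale cv_structure =
  fixes A :: "('m::{t2_space,second_countable_topology}, 'n::finite) atlas"
    and C m :: "'m \<Rightarrow> 'm cvec \<Rightarrow> 'm cvec \<Rightarrow> 'm cvec"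
    and \<U> \<kappa> \<Q> :: "'m \<Rightarrow> 'm cvec \<Rightarrow> 'm cvec"
    and g h :: "'m \<Rightarrow> 'm cvec \<Rightarrow> 'm cvec \<Rightarrow> complex"
    and D :: "'m conn"
    and e E :: "'m cfield"
  assumes CV: "CV_structure A C \<U> g \<kappa> h D \<Q>"
    and unf: "unfolding_condition A C"
    and mult_unf: "\<And>p x y z. x \<in> T10 A p \<Longrightarrow> y \<in> T10 A p \<Longrightarrow> z \<in> T10 A p \<Longrightarrow>
           m p x y \<in> T10 A p \<and> C p (m p x y) z = - C p x (C p y z)"
    and mult_C: "\<And>p x y. x \<in> T10 A p \<Longrightarrow> y \<in> T10 A p \<Longrightarrow> C p x y = - m p x y"
    and e: "hol_vf A UNIV e" "\<And>p x. x \<in> T10 A p \<Longrightarrow> C p (e p) x = - x"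
    and E: "hol_vf A UNIV E" "\<And>p x. x \<in> T10 A p \<Longrightarrow> C p (E p) x = - \<U> p x"
begin

lemma manifold: "complex_manifold A"
  using CV unfolding CV_structure_def by (elim conjE)

sublocale cmanifold A
  by unfold_locales (rule manifold)

lemmas cv2 = CV[unfolded CV_structure_def, THEN conjunct2]
lemmas cv3 = cv2[THEN conjunct2]
lemmas cv4 = cv3[THEN conjunct2]
lemmas cv5 = cv4[THEN conjunct2]
lemmas cv6 = cv5[THEN conjunct2]
lemmas cv7 = cv6[THEN conjunct2]
lemmas cv8 = cv7[THEN conjunct2]
lemmas cv9 = cv8[THEN conjunct2]
lemmas cv10 = cv9[THEN conjunct2]
lemmas cv11 = cv10[THEN conjunct2]
lemmas cv12 = cv11[THEN conjunct2]
lemmas cv14 = cv12[THEN conjunct2, THEN conjunct2]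
lemmas cv15 = cv14[THEN conjunct2]
lemmas cv16 = cv15[THEN conjunct2]

lemmas C_hol = cv2[THEN conjunct1]
lemmas g_hol = cv4[THEN conjunct1]
lemmas C_U_g = cv5[THEN conjunct1, rule_format]
lemmas \<kappa>_anti = cv6[THEN conjunct1]
lemmas \<kappa>_real = cv7[THEN conjunct1, rule_format]
lemmas h_g = cv8[THEN conjunct1, rule_format]
lemmas h_herm = cv9[THEN conjunct1]
lemmas D_chern = cv10[THEN conjunct1]
lemmas D_\<kappa> = cv11[THEN conjunct1, rule_format]
lemmas C_torsion = cv12[THEN conjunct1, rule_format]
lemmas Q_smooth_endo = cv14[THEN conjunct1]
lemmas Q_sym = cv15[THEN conjunct1, rule_format]
lemmas U_Q = cv16[rule_format]

subsection \<open>The multiplication\<close>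

lemma m_T10: "x \<in> T10 A p \<Longrightarrow> y \<in> T10 A p \<Longrightarrow> m p x y \<in> T10 A p"
  using mult_unf by blast

lemma m_C: "x \<in> T10 A p \<Longrightarrow> y \<in> T10 A p \<Longrightarrow> m p x y = - C p x y"
  by (simp add: mult_C)

lemma C_lin:
  assumes "a \<in> T10 A p" "b \<in> T10 A p" "x \<in> T10 A p"
  shows "C p a x \<in> T10 A p" "C p (a + b) x = C p a x + C p b x" "C p (c *\<^sub>V a) x = c *\<^sub>V C p a x"
    "C p x (a + b) = C p x a + C p x b" "C p x (c *\<^sub>V a) = c *\<^sub>V C p x a"
  using C_hol assms unfolding hol_mult_def by blast+

lemma m_add_left: "a \<in> T10 A p \<Longrightarrow> b \<in> T10 A p \<Longrightarrow> x \<in> T10 A p \<Longrightarrow> m p (a + b) x = m p a x + m p b x"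
  by (simp add: m_C T10_plus C_lin)

lemma m_add_right: "a \<in> T10 A p \<Longrightarrow> b \<in> T10 A p \<Longrightarrow> x \<in> T10 A p \<Longrightarrow> m p x (a + b) = m p x a + m p x b"
  by (simp add: m_C T10_plus C_lin)

lemma m_smul_left: "a \<in> T10 A p \<Longrightarrow> x \<in> T10 A p \<Longrightarrow> m p (c *\<^sub>V a) x = c *\<^sub>V m p a x"
  by (simp add: m_C T10_smul C_lin smul_distribs)

lemma m_smul_right: "a \<in> T10 A p \<Longrightarrow> x \<in> T10 A p \<Longrightarrow> m p x (c *\<^sub>V a) = c *\<^sub>V m p x a"
  by (simp add: m_C T10_smul C_lin smul_distribs)

lemma m_uminus_left: "a \<in> T10 A p \<Longrightarrow> x \<in> T10 A p \<Longrightarrow> m p (- a) x = - m p a x"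
  using m_smul_left[of a p x "-1"] by (simp add: smul_distribs)

lemma m_uminus_right: "a \<in> T10 A p \<Longrightarrow> x \<in> T10 A p \<Longrightarrow> m p x (- a) = - m p x a"
  using m_smul_right[of a p x "-1"] by (simp add: smul_distribs)

lemma m_diff_left: "a \<in> T10 A p \<Longrightarrow> b \<in> T10 A p \<Longrightarrow> x \<in> T10 A p \<Longrightarrow> m p (a - b) x = m p a x - m p b x"
  using m_add_left[of a p "- b" x] m_uminus_left[of b p x] T10_uminus[of b p] by simp

lemma m_diff_right: "a \<in> T10 A p \<Longrightarrow> b \<in> T10 A p \<Longrightarrow> x \<in> T10 A p \<Longrightarrow> m p x (a - b) = m p x a - m p x b"
  using m_add_right[of a p "- b" x] m_uminus_right[of b p x] T10_uminus[of b p] by simp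

lemma m_assoc:
  assumes "x \<in> T10 A p" "y \<in> T10 A p" "z \<in> T10 A p" shows "m p (m p x y) z = m p x (m p y z)"
  using conjunct2[OF mult_unf[OF assms]] assms by (simp add: mult_C m_T10 T10_uminus m_uminus_right)

lemma m_left_commute:
  assumes "x \<in> T10 A p" "y \<in> T10 A p" "z \<in> T10 A p" shows "m p x (m p y z) = m p y (m p x z)"
  using C_U_g[OF assms(1,2,3,3)] assms
  by (simp add: mult_C m_T10 T10_uminus m_uminus_right)

text \<open>The operators \<open>C p x\<close> and \<open>C p y\<close> commute, so the
  endomorphisms attached to the two products agree; applied to \<zeta>, the injectivity in the
  unfolding condition turns this into equality of the products.\<close>

lemma m_commute:
  assumes x: "x \<in> T10 A p" and y: "y \<in> T10 A p" shows "m p x y = m p y x"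
proof -
  obtain \<zeta> where \<zeta>: "hol_vf A UNIV \<zeta>" "bij_betw (\<lambda>x. - C p x (\<zeta> p)) (T10 A p) (T10 A p)"
    using unf unfolding unfolding_condition_def by blast
  have z: "\<zeta> p \<in> T10 A p" by (rule hol_vf_T10[OF \<zeta>(1)]) simp
  have "- C p (m p x y) (\<zeta> p) = - C p (m p y x) (\<zeta> p)"
    using m_left_commute[OF x y z] by (simp add: mult_C m_T10 x y z m_assoc)
  then show ?thesis
    using bij_betw_imp_inj_on[OF \<zeta>(2)] m_T10 x y unfolding inj_on_def by blast
qed

lemma e_T10: "e p \<in> T10 A p"
  by (rule hol_vf_T10[OF e(1)]) simp

lemma E_T10: "E p \<in> T10 A p"
  by (rule hol_vf_T10[OF E(1)]) simp

lemma m_e: "x \<in> T10 A p \<Longrightarrow> m p (e p) x = x" "x \<in> T10 A p \<Longrightarrow> m p x (e p) = x"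
  using e(2) m_C e_T10 m_commute by auto

lemma U_m: "x \<in> T10 A p \<Longrightarrow> \<U> p x = m p (E p) x"
  using E(2) m_C E_T10 by auto

lemma m_hol_vf: "hol_vf A W X \<Longrightarrow> hol_vf A W Y \<Longrightarrow> hol_vf A W (\<lambda>q. m q (X q) (Y q))"
proof -
  assume X: "hol_vf A W X" and Y: "hol_vf A W Y"
  have "hol_vf A W (\<lambda>q. C q (X q) (Y q))" using C_hol X Y unfolding hol_mult_def by blast
  from hol_vf_smul[OF hol_fun_const[OF hol_vf_open[OF X]] this, of "-1"]
  show ?thesis
    by (rule hol_vf_cong) (use hol_vf_T10[OF X] hol_vf_T10[OF Y] in \<open>simp add: m_C smul_distribs\<close>)
qed

lemma m_smooth_vf:
  assumes X: "hol_vf A W X" and Y: "smooth_vf A W Y" shows "smooth_vf A W (\<lambda>q. m q (X q) (Y q))"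
proof (rule smooth_vf_linear_image[OF _ _ Y, where T = "\<lambda>q. m q (X q)"])
  show "m q (X q) (a + b) = m q (X q) a + m q (X q) b \<and> m q (X q) (c *\<^sub>V a) = c *\<^sub>V m q (X q) a"
    if "q \<in> W" "a \<in> T10 A q" "b \<in> T10 A q" for q a b c
    using m_add_right m_smul_right hol_vf_T10[OF X] that by simp
  show "smooth_vf A V (\<lambda>q. m q (X q) (Y q))" if V: "V \<subseteq> W" and Y: "hol_vf A V Y" for V Y
    by (rule hol_imp_smooth_vf[OF m_hol_vf[OF hol_vf_subset[OF X hol_vf_open[OF Y] V] Y]])
qed

lemma hol_mult_m: "hol_mult A m"
  unfolding hol_mult_def
  by (auto simp: m_T10 m_add_left m_add_right m_smul_left m_smul_right m_hol_vf)

subsection \<open>The forms\<close>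

lemma g_add_left: "a \<in> T10 A p \<Longrightarrow> b \<in> T10 A p \<Longrightarrow> x \<in> T10 A p \<Longrightarrow> g p (a + b) x = g p a x + g p b x"
  using g_hol unfolding hol_metric_def by blast

lemma g_smul_left: "a \<in> T10 A p \<Longrightarrow> x \<in> T10 A p \<Longrightarrow> g p (c *\<^sub>V a) x = c * g p a x"
  using g_hol unfolding hol_metric_def by blast

lemma g_sym: "a \<in> T10 A p \<Longrightarrow> b \<in> T10 A p \<Longrightarrow> g p a b = g p b a"
  using g_hol unfolding hol_metric_def by blast

lemma g_add_right: "a \<in> T10 A p \<Longrightarrow> b \<in> T10 A p \<Longrightarrow> x \<in> T10 A p \<Longrightarrow> g p x (a + b) = g p x a + g p x b"
  using g_add_left g_sym T10_plus by metis

lemma g_uminus_left: "a \<in> T10 A p \<Longrightarrow> x \<in> T10 A p \<Longrightarrow> g p (- a) x = - g p a x"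
  using g_smul_left[of a p x "-1"] by (simp add: smul_distribs)

lemma g_diff_left: "a \<in> T10 A p \<Longrightarrow> b \<in> T10 A p \<Longrightarrow> x \<in> T10 A p \<Longrightarrow> g p (a - b) x = g p a x - g p b x"
  using g_add_left[of a p "- b" x] g_uminus_left[of b p x] T10_uminus[of b p] by simp

lemma g_uminus_right: "a \<in> T10 A p \<Longrightarrow> x \<in> T10 A p \<Longrightarrow> g p x (- a) = - g p x a"
  using g_uminus_left g_sym T10_uminus by metis

lemma g_diff_right: "a \<in> T10 A p \<Longrightarrow> b \<in> T10 A p \<Longrightarrow> x \<in> T10 A p \<Longrightarrow> g p x (a - b) = g p x a - g p x b"
  using g_diff_left g_sym T10_minus by metis

lemma g_eqI:
  assumes "a \<in> T10 A p" "b \<in> T10 A p" "\<And>x. x \<in> T10 A p \<Longrightarrow> g p a x = g p b x" shows "a = b"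
proof -
  have "\<forall>x\<in>T10 A p. g p (a - b) x = 0" using assms g_diff_left by simp
  then have "a - b = 0" using g_hol T10_minus[OF assms(1,2)] unfolding hol_metric_def by blast
  then show ?thesis by simp
qed

lemma g_m: "x \<in> T10 A p \<Longrightarrow> a \<in> T10 A p \<Longrightarrow> b \<in> T10 A p \<Longrightarrow> g p (m p x a) b = g p a (m p x b)"
  using C_U_g[of x p x a b] by (simp add: mult_C m_T10 g_uminus_left g_uminus_right)

lemma \<kappa>_T10: "a \<in> T10 A p \<Longrightarrow> \<kappa> p a \<in> T10 A p"
  using \<kappa>_anti unfolding antilinear_map_def by blast

lemma \<kappa>_add: "a \<in> T10 A p \<Longrightarrow> b \<in> T10 A p \<Longrightarrow> \<kappa> p (a + b) = \<kappa> p a + \<kappa> p b"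
  using \<kappa>_anti unfolding antilinear_map_def by blast

lemma \<kappa>_smul: "a \<in> T10 A p \<Longrightarrow> \<kappa> p (c *\<^sub>V a) = cnj c *\<^sub>V \<kappa> p a"
  using \<kappa>_anti unfolding antilinear_map_def by blast

lemma \<kappa>_uminus: "a \<in> T10 A p \<Longrightarrow> \<kappa> p (- a) = - \<kappa> p a"
  using \<kappa>_smul[of a p "-1"] by (simp add: smul_distribs)

lemma \<kappa>_diff: "a \<in> T10 A p \<Longrightarrow> b \<in> T10 A p \<Longrightarrow> \<kappa> p (a - b) = \<kappa> p a - \<kappa> p b"
  using \<kappa>_add[of a p "- b"] \<kappa>_uminus[of b p] T10_uminus[of b p] by simp

lemma \<kappa>_smooth: "smooth_vf A W Y \<Longrightarrow> smooth_vf A W (\<lambda>q. \<kappa> q (Y q))"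
  using \<kappa>_anti unfolding antilinear_map_def by blast

lemma \<kappa>_\<kappa>: "a \<in> T10 A p \<Longrightarrow> \<kappa> p (\<kappa> p a) = a"
  using \<kappa>_real by blast

lemma h_add_left: "a \<in> T10 A p \<Longrightarrow> b \<in> T10 A p \<Longrightarrow> x \<in> T10 A p \<Longrightarrow> h p (a + b) x = h p a x + h p b x"
  using h_herm unfolding nondeg_hermitian_def by blast

lemma h_smul_left: "a \<in> T10 A p \<Longrightarrow> x \<in> T10 A p \<Longrightarrow> h p (c *\<^sub>V a) x = c * h p a x"
  using h_herm unfolding nondeg_hermitian_def by blast

lemma h_cnj: "a \<in> T10 A p \<Longrightarrow> b \<in> T10 A p \<Longrightarrow> h p b a = cnj (h p a b)"
  using h_herm unfolding nondeg_hermitian_def by blast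

lemma h_uminus_left: "a \<in> T10 A p \<Longrightarrow> x \<in> T10 A p \<Longrightarrow> h p (- a) x = - h p a x"
  using h_smul_left[of a p x "-1"] by (simp add: smul_distribs)

lemma h_diff_left: "a \<in> T10 A p \<Longrightarrow> b \<in> T10 A p \<Longrightarrow> x \<in> T10 A p \<Longrightarrow> h p (a - b) x = h p a x - h p b x"
  using h_add_left[of a p "- b" x] h_uminus_left[of b p x] T10_uminus[of b p] by simp

lemma h_add_right: "a \<in> T10 A p \<Longrightarrow> b \<in> T10 A p \<Longrightarrow> x \<in> T10 A p \<Longrightarrow> h p x (a + b) = h p x a + h p x b"
  using h_cnj[of "a + b" p x] h_cnj[of a p x] h_cnj[of b p x] by (simp add: T10_plus h_add_left)

lemma h_smul_right: "a \<in> T10 A p \<Longrightarrow> x \<in> T10 A p \<Longrightarrow> h p x (c *\<^sub>V a) = cnj c * h p x a"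
  using h_cnj[of "c *\<^sub>V a" p x] h_cnj[of a p x] by (simp add: T10_smul h_smul_left)

lemma h_uminus_right: "a \<in> T10 A p \<Longrightarrow> x \<in> T10 A p \<Longrightarrow> h p x (- a) = - h p x a"
  using h_smul_right[of a p x "-1"] by (simp add: smul_distribs)

lemma h_diff_right: "a \<in> T10 A p \<Longrightarrow> b \<in> T10 A p \<Longrightarrow> x \<in> T10 A p \<Longrightarrow> h p x (a - b) = h p x a - h p x b"
  using h_add_right[of a p "- b" x] h_uminus_right[of b p x] T10_uminus[of b p] by simp

lemma h_eqI:
  assumes "a \<in> T10 A p" "b \<in> T10 A p" "\<And>x. x \<in> T10 A p \<Longrightarrow> h p a x = h p b x" shows "a = b"
proof -
  have "\<forall>x\<in>T10 A p. h p (a - b) x = 0" using assms h_diff_left by simp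
  then have "a - b = 0" using h_herm T10_minus[OF assms(1,2)] unfolding nondeg_hermitian_def by blast
  then show ?thesis by simp
qed

lemma Q_T10: "a \<in> T10 A p \<Longrightarrow> \<Q> p a \<in> T10 A p"
  using Q_smooth_endo unfolding smooth_endo_def clinear_endo_def by blast

lemma Q_add: "a \<in> T10 A p \<Longrightarrow> b \<in> T10 A p \<Longrightarrow> \<Q> p (a + b) = \<Q> p a + \<Q> p b"
  using Q_smooth_endo unfolding smooth_endo_def clinear_endo_def by blast

lemma Q_smul: "a \<in> T10 A p \<Longrightarrow> \<Q> p (c *\<^sub>V a) = c *\<^sub>V \<Q> p a"
  using Q_smooth_endo unfolding smooth_endo_def clinear_endo_def by blast

lemma Q_smooth: "smooth_vf A W Y \<Longrightarrow> smooth_vf A W (\<lambda>q. \<Q> q (Y q))"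
  using Q_smooth_endo unfolding smooth_endo_def by blast

lemma Q_uminus: "a \<in> T10 A p \<Longrightarrow> \<Q> p (- a) = - \<Q> p a"
  using Q_smul[of a p "-1"] by (simp add: smul_distribs)

lemma Q_diff: "a \<in> T10 A p \<Longrightarrow> b \<in> T10 A p \<Longrightarrow> \<Q> p (a - b) = \<Q> p a - \<Q> p b"
  using Q_add[of a p "- b"] Q_uminus[of b p] T10_uminus[of b p] by simp

lemma Q_h: "a \<in> T10 A p \<Longrightarrow> b \<in> T10 A p \<Longrightarrow> h p (\<Q> p a) b = h p a (\<Q> p b)"
  using Q_sym by blast

lemma Q_g: "a \<in> T10 A p \<Longrightarrow> b \<in> T10 A p \<Longrightarrow> g p (\<Q> p a) b = - g p a (\<Q> p b)"
  using Q_sym by blast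

lemma U_T10: "a \<in> T10 A p \<Longrightarrow> \<U> p a \<in> T10 A p"
  by (simp add: U_m m_T10 E_T10)

subsection \<open>The connection\<close>

lemma conn: "connection A D"
  using D_chern unfolding chern_connection_def by blast

lemma conn_vector:
  assumes "smooth_vf A W Y" "p \<in> W" "v \<in> CT A p" "w \<in> CT A p"
  shows "D p v Y \<in> T10 A p" "D p (v + w) Y = D p v Y + D p w Y" "D p (c *\<^sub>V v) Y = c *\<^sub>V D p v Y"
  using conn[unfolded connection_def, THEN conjunct2, THEN conjunct1, rule_format, OF assms(2,3,4,1)] by auto

lemma D_derivation:
  assumes v: "v \<in> CT A p" shows "derivation_at p v (D p v)"
proof -
  note c = conn[unfolded connection_def, THEN conjunct2, THEN conjunct2]
  show ?thesis
    unfolding derivation_at_def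
  proof (intro conjI allI impI; elim conjE)
    fix W Y Z u assume W: "p \<in> W" "smooth_vf A W Y"
    show "D p v Y \<in> T10 A p" by (rule conn_vector(1)[OF W(2,1) v v])
    show "D p v (\<lambda>q. u q *\<^sub>V Y q) = v u *\<^sub>V Y p + u p *\<^sub>V D p v Y" if "smooth_fun A W u"
      using c[THEN conjunct1, rule_format, OF W(1) v, of Y Y u] W that by auto
    assume Z: "smooth_vf A W Z"
    show "D p v (\<lambda>q. Y q + Z q) = D p v Y + D p v Z"
      using c[THEN conjunct1, rule_format, OF W(1) v, of Y Z "\<lambda>q. 0"] W Z smooth_fun_const[OF smooth_vf_open[OF Z], of 0] by auto
    show "D p v Y = D p v Z" if "\<forall>q\<in>W. Y q = Z q"
      using c[THEN conjunct2, rule_format, OF W(1) v, of Y Z] W Z that by auto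
  qed
qed

lemma D_T10: "smooth_vf A W Y \<Longrightarrow> p \<in> W \<Longrightarrow> v \<in> CT A p \<Longrightarrow> D p v Y \<in> T10 A p"
  by (rule conn_vector(1))

lemma D_cong:
  assumes "v \<in> CT A p" "smooth_vf A W Y" "p \<in> W" "\<And>q. q \<in> W \<Longrightarrow> Y q = Z q"
  shows "D p v Y = D p v Z"
  using derivation_atD(4)[OF D_derivation[OF assms(1)] assms(3,2) smooth_vf_cong[OF assms(2,4)] assms(4)] .

lemma D_uminus: "v \<in> CT A p \<Longrightarrow> smooth_vf A W Y \<Longrightarrow> p \<in> W \<Longrightarrow> D p v (\<lambda>q. - Y q) = - D p v Y"
  by (rule derivation_uminus[OF D_derivation])

lemma D_conj_hol: "hol_vf A W Y \<Longrightarrow> p \<in> W \<Longrightarrow> v \<in> T10 A p \<Longrightarrow> D p (conjv v) Y = 0"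
  using D_chern unfolding chern_connection_def by blast

lemma D_h:
  "v \<in> CT A p \<Longrightarrow> smooth_vf A W Y \<Longrightarrow> smooth_vf A W Z \<Longrightarrow> p \<in> W \<Longrightarrow>
   v (\<lambda>q. h q (Y q) (Z q)) = h p (D p v Y) (Z p) + h p (Y p) (D p (conjv v) Z)"
  using D_chern[unfolded chern_connection_def, THEN conjunct2, THEN conjunct2, rule_format, of p W v Y Z] by blast

text \<open>Since g(Y,Z) = h(Y,\<kappa>Z), metricity for \<open>g\<close> follows from metricity for
  \<open>h\<close> together with D(\<kappa>) = 0; the two conjugations of the direction
  \<open>v\<close> undo each other.\<close>

lemma D_g:
  assumes v: "v \<in> CT A p" and Y: "smooth_vf A W Y" and Z: "smooth_vf A W Z" and p: "p \<in> W"
  shows "v (\<lambda>q. g q (Y q) (Z q)) = g p (D p v Y) (Z p) + g p (Y p) (D p v Z)"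
proof -
  note Yp = smooth_vf_T10[OF Y] and Zp = smooth_vf_T10[OF Z]
  have "v (\<lambda>q. g q (Y q) (Z q)) = v (\<lambda>q. h q (Y q) (\<kappa> q (Z q)))"
    by (rule CT_cong[OF v smooth_vf_open[OF Y] p]) (simp add: h_g Yp Zp \<kappa>_T10 \<kappa>_\<kappa>)
  also have "\<dots> = h p (D p v Y) (\<kappa> p (Z p)) + h p (Y p) (D p (conjv v) (\<lambda>q. \<kappa> q (Z q)))"
    by (rule D_h[OF v Y \<kappa>_smooth[OF Z] p])
  also have "D p (conjv v) (\<lambda>q. \<kappa> q (Z q)) = \<kappa> p (D p v Z)"
    using D_\<kappa>[OF p CT_conjv[OF v] Z] by simp
  finally show ?thesis
    by (simp add: h_g D_T10[OF Y p v] D_T10[OF Z p v] Yp[OF p] Zp[OF p] \<kappa>_T10 \<kappa>_\<kappa>)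
qed

text \<open>Both are derivations over \<open>conjf X\<close>, and both vanish on holomorphic fields:
  the bracket by \<open>bracket_conjf_hol\<close>, \<open>D\<close> because it is a Chern
  connection.\<close>

lemma lie_conj_eq_D:
  assumes X: "hol_vf A V X" "p \<in> V" and Y: "smooth_vf A W Y" "p \<in> W"
  shows "bracket A (conjf X) Y p = D p (conjf X p) Y"
proof (rule derivations_eq[OF derivation_bracket_conjf[OF X] D_derivation _ Y])
  show "conjf X p \<in> CT A p" unfolding conjf_def by (rule CT_conjv[OF T10_CT[OF hol_vf_T10[OF X]]])
  fix W' Z assume Z: "hol_vf A W' Z" "p \<in> W'"
  have o: "open (V \<inter> W')" using hol_vf_open[OF X(1)] hol_vf_open[OF Z(1)] by auto
  have "bracket A (conjf X) Z p = 0"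
    by (rule bracket_conjf_hol[OF hol_vf_subset[OF X(1) o] hol_vf_subset[OF Z(1) o]]) (use X Z in auto)
  then show "bracket A (conjf X) Z p = D p (conjf X p) Z"
    using D_conj_hol[OF Z hol_vf_T10[OF X]] by (simp add: conjf_def)
qed

subsection \<open>Derivatives of the multiplication operators\<close>

text \<open>The operator \<open>D\<^sub>v(\<mu>\<^sub>X)\<close>, applied to \<open>Z\<close> at \<open>p\<close>.\<close>

definition dm :: "'m \<Rightarrow> 'm cvec \<Rightarrow> 'm cfield \<Rightarrow> 'm cfield \<Rightarrow> 'm cvec" where
  "dm p v X Z = D p v (\<lambda>q. m q (X q) (Z q)) - m p (X p) (D p v Z)"

lemma dm_T10:
  assumes "v \<in> CT A p" "hol_vf A W X" "smooth_vf A W Z" "p \<in> W" shows "dm p v X Z \<in> T10 A p"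
  unfolding dm_def
  by (intro T10_minus m_T10 D_T10[OF m_smooth_vf[OF assms(2,3)] assms(4,1)] D_T10[OF assms(3,4,1)] hol_vf_T10[OF assms(2,4)])

lemma dm_cong:
  assumes "v \<in> CT A p" "hol_vf A W X" "smooth_vf A W Z" "p \<in> W" "\<And>q. q \<in> W \<Longrightarrow> Z q = Z' q"
  shows "dm p v X Z = dm p v X Z'"
proof -
  have "D p v (\<lambda>q. m q (X q) (Z q)) = D p v (\<lambda>q. m q (X q) (Z' q))"
    by (rule D_cong[OF assms(1) m_smooth_vf[OF assms(2,3)] assms(4)]) (simp add: assms(5))
  moreover have "D p v Z = D p v Z'" by (rule D_cong[OF assms(1,3,4,5)])
  ultimately show ?thesis by (simp add: dm_def)
qed

text \<open>Associativity makes multiplication by a product a composition of two multiplications,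
  and \<open>D\<close> obeys the product rule for compositions.\<close>

lemma dm_mult:
  assumes v: "v \<in> CT A p" and X: "hol_vf A W X" and Y: "hol_vf A W Y" and Z: "smooth_vf A W Z" and p: "p \<in> W"
  shows "dm p v (\<lambda>q. m q (X q) (Y q)) Z = dm p v X (\<lambda>q. m q (Y q) (Z q)) + m p (X p) (dm p v Y Z)"
proof -
  note XT = hol_vf_T10[OF X] and YT = hol_vf_T10[OF Y] and ZT = smooth_vf_T10[OF Z]
  note YZ = m_smooth_vf[OF Y Z]
  have "D p v (\<lambda>q. m q (m q (X q) (Y q)) (Z q)) = D p v (\<lambda>q. m q (X q) (m q (Y q) (Z q)))"
    by (rule D_cong[OF v m_smooth_vf[OF m_hol_vf[OF X Y] Z] p]) (simp add: m_assoc XT YT ZT)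
  moreover have "m p (X p) (dm p v Y Z) = m p (X p) (D p v (\<lambda>q. m q (Y q) (Z q))) - m p (m p (X p) (Y p)) (D p v Z)"
    unfolding dm_def
    by (simp add: m_diff_right m_assoc m_T10 XT[OF p] YT[OF p] D_T10[OF YZ p v] D_T10[OF Z p v])
  ultimately show ?thesis by (simp add: dm_def)
qed

lemma D_C:
  assumes X: "hol_vf A W X" and Z: "smooth_vf A W Z" and p: "p \<in> W" and v: "v \<in> CT A p"
  shows "D p v (\<lambda>q. C q (X q) (Z q)) - C p (X p) (D p v Z) = - dm p v X Z"
proof -
  have "D p v (\<lambda>q. C q (X q) (Z q)) = D p v (\<lambda>q. - m q (X q) (Z q))"
    by (rule D_cong[OF v _ p, symmetric])
       (simp_all add: smooth_vf_uminus[OF m_smooth_vf[OF X Z]] mult_C hol_vf_T10[OF X] smooth_vf_T10[OF Z])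
  also have "\<dots> = - D p v (\<lambda>q. m q (X q) (Z q))"
    by (rule D_uminus[OF v m_smooth_vf[OF X Z] p])
  finally show ?thesis
    using mult_C[OF hol_vf_T10[OF X p] D_T10[OF Z p v]] by (simp add: dm_def)
qed

text \<open>Potentiality of \<open>C\<close>, whose three terms change sign together under C =
  -\<mu>. Through this identity brackets of holomorphic fields turn into derivatives of
  multiplication operators.\<close>

lemma dm_commutator:
  assumes X: "hol_vf A W X" and Y: "hol_vf A W Y" and Z: "smooth_vf A W Z" and p: "p \<in> W"
  shows "dm p (X p) Y Z - dm p (Y p) X Z = m p (bracket A X Y p) (Z p)"
proof -
  note Xp = T10_CT[OF hol_vf_T10[OF X p]] and Yp = T10_CT[OF hol_vf_T10[OF Y p]]
  have "bracket A X Y p \<in> T10 A p" by (rule hol_vf_T10[OF bracket_hol[OF X Y] p])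
  then have "C p (bracket A X Y p) (Z p) = - m p (bracket A X Y p) (Z p)"
    using smooth_vf_T10[OF Z p] by (simp add: mult_C)
  then have "- dm p (X p) Y Z - (- dm p (Y p) X Z) - (- m p (bracket A X Y p) (Z p)) = 0"
    using C_torsion[of p W X Y Z] X Y Z p D_C[OF Y Z p Xp] D_C[OF X Z p Yp]
    unfolding deriv_endo_def cov_def by simp
  then show ?thesis by (simp add: algebra_simps)
qed

text \<open>The Lie derivative of the multiplication, expressed as an operator through \<open>D\<close>.
  Only derivatives of multiplication by \<open>X\<close> survive.\<close>

lemma lie_mult:
  assumes X: "hol_vf A W X" and Y: "hol_vf A W Y" and Z: "hol_vf A W Z" and T: "smooth_vf A W T" and p: "p \<in> W"
  shows "m p (deriv_mult (bracket A X) m Y Z p) (T p) =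
    dm p (Y p) X (\<lambda>q. m q (Z q) (T q)) + m p (Y p) (dm p (Z p) X T) - dm p (m p (Y p) (Z p)) X T"
proof -
  note YZ = m_hol_vf[OF Y Z] and ZT = m_smooth_vf[OF Z T]
  note Xp = hol_vf_T10[OF X p] and Yp = hol_vf_T10[OF Y p] and Zp = hol_vf_T10[OF Z p] and Tp = smooth_vf_T10[OF T p]
  note bXY = hol_vf_T10[OF bracket_hol[OF X Y] p] and bXZ = hol_vf_T10[OF bracket_hol[OF X Z] p]
    and bXYZ = hol_vf_T10[OF bracket_hol[OF X YZ] p]
  note Xv = T10_CT[OF Xp]
  \<comment> \<open>Potentiality for \<open>X\<close> and the product of \<open>Y\<close> and
    \<open>Z\<close>, then the product rule for the derivative in direction
    \<open>X\<close>.\<close>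
  have 1: "m p (bracket A X (\<lambda>q. m q (Y q) (Z q)) p) (T p) =
      dm p (X p) Y (\<lambda>q. m q (Z q) (T q)) + m p (Y p) (dm p (X p) Z T) - dm p (m p (Y p) (Z p)) X T"
    using dm_commutator[OF X YZ T p] dm_mult[OF Xv Y Z T p] by simp
  have 2: "m p (m p (bracket A X Y p) (Z p)) (T p) =
      dm p (X p) Y (\<lambda>q. m q (Z q) (T q)) - dm p (Y p) X (\<lambda>q. m q (Z q) (T q))"
    using dm_commutator[OF X Y ZT p] by (simp add: m_assoc bXY Zp Tp)
  have 3: "m p (m p (Y p) (bracket A X Z p)) (T p) = m p (Y p) (dm p (X p) Z T) - m p (Y p) (dm p (Z p) X T)"
  proof -
    have "m p (m p (Y p) (bracket A X Z p)) (T p) = m p (Y p) (dm p (X p) Z T - dm p (Z p) X T)"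
      by (simp add: m_assoc Yp bXZ Tp dm_commutator[OF X Z T p])
    then show ?thesis
      by (simp add: m_diff_right Yp dm_T10[OF Xv Z T p] dm_T10[OF T10_CT[OF Zp] X T p])
  qed
  have "m p (deriv_mult (bracket A X) m Y Z p) (T p) =
      m p (bracket A X (\<lambda>q. m q (Y q) (Z q)) p) (T p) - m p (m p (bracket A X Y p) (Z p)) (T p)
        - m p (m p (Y p) (bracket A X Z p)) (T p)"
    unfolding deriv_mult_def by (simp add: m_diff_left T10_minus m_T10 bXYZ bXY bXZ Yp Zp Tp)
  then show ?thesis unfolding 1 2 3 by (simp add: algebra_simps)
qed

lemma lie_mult_T10:
  assumes X: "hol_vf A W X" and Y: "hol_vf A W Y" and Z: "hol_vf A W Z" and p: "p \<in> W"
  shows "deriv_mult (bracket A X) m Y Z p \<in> T10 A p"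
  unfolding deriv_mult_def
  by (intro T10_minus m_T10 hol_vf_T10[OF bracket_hol[OF X m_hol_vf[OF Y Z]] p]
      hol_vf_T10[OF bracket_hol[OF X Y] p] hol_vf_T10[OF bracket_hol[OF X Z] p] hol_vf_T10[OF Y p] hol_vf_T10[OF Z p])

lemma e_hol: "open W \<Longrightarrow> hol_vf A W e"
  by (rule hol_vf_subset[OF e(1)]) auto

lemma E_hol: "open W \<Longrightarrow> hol_vf A W E"
  by (rule hol_vf_subset[OF E(1)]) auto

text \<open>Both sides are tested on \<open>e\<close>, where multiplication returns its other
  factor. The product rule splits every derivative of multiplication by X \<circ> Y in
  \<open>lie_mult\<close>; the terms differentiating \<mu> of X and those differentiating \<mu> of Y
  regroup into \<open>lie_mult\<close> for \<open>X\<close> and for \<open>Y\<close>.\<close>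

lemma F_manifold_identity:
  assumes X: "hol_vf A W X" and Y: "hol_vf A W Y" and Z: "hol_vf A W Z" and Z': "hol_vf A W Z'" and p: "p \<in> W"
  shows "deriv_mult (bracket A (\<lambda>q. m q (X q) (Y q))) m Z Z' p =
          m p (X p) (deriv_mult (bracket A Y) m Z Z' p) + m p (Y p) (deriv_mult (bracket A X) m Z Z' p)"
proof -
  note XY = m_hol_vf[OF X Y]
  note es = hol_imp_smooth_vf[OF e_hol[OF hol_vf_open[OF X]]]
  note Xp = hol_vf_T10[OF X p] and Yp = hol_vf_T10[OF Y p] and Zp = hol_vf_T10[OF Z p] and Z'p = hol_vf_T10[OF Z' p]
  note Zv = T10_CT[OF Zp] and Z'v = T10_CT[OF Z'p] and ZZ'v = T10_CT[OF m_T10[OF Zp Z'p]]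
  note Ye = m_smooth_vf[OF Y es] and Z'e = m_smooth_vf[OF Z' es]
  let ?ZZ' = "m p (Z p) (Z' p)"
  let ?Ye = "\<lambda>q. m q (Y q) (e q)" and ?Z'e = "\<lambda>q. m q (Z' q) (e q)"
  have L: "m p (deriv_mult (bracket A (\<lambda>q. m q (X q) (Y q))) m Z Z' p) (e p) =
      (dm p (Z p) X (\<lambda>q. m q (Y q) (?Z'e q)) + m p (X p) (dm p (Z p) Y ?Z'e))
      + m p (Z p) (dm p (Z' p) X ?Ye + m p (X p) (dm p (Z' p) Y e))
      - (dm p ?ZZ' X ?Ye + m p (X p) (dm p ?ZZ' Y e))"
    using lie_mult[OF XY Z Z' es p] dm_mult[OF Zv X Y Z'e p] dm_mult[OF Z'v X Y es p] dm_mult[OF ZZ'v X Y es p]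
    by simp
  \<comment> \<open>Evaluation on \<open>?Ye\<close> instead of \<open>e\<close> reproduces, up to
    commuting \<open>Y\<close> past \<open>Z'\<close>, exactly the terms of \<open>L\<close> that
    differentiate multiplication by \<open>X\<close>, and supplies the factor \<open>Y\<close> of
    the claim.\<close>
  have "m p (deriv_mult (bracket A X) m Z Z' p) (?Ye p) =
      dm p (Z p) X (\<lambda>q. m q (Z' q) (?Ye q)) + m p (Z p) (dm p (Z' p) X ?Ye) - dm p ?ZZ' X ?Ye"
    by (rule lie_mult[OF X Z Z' Ye p])
  moreover have "dm p (Z p) X (\<lambda>q. m q (Z' q) (?Ye q)) = dm p (Z p) X (\<lambda>q. m q (Y q) (?Z'e q))"
    by (rule dm_cong[OF Zv X m_smooth_vf[OF Z' Ye] p])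
       (rule m_left_commute[OF hol_vf_T10[OF Z'] hol_vf_T10[OF Y] e_T10])
  moreover have "m p (deriv_mult (bracket A X) m Z Z' p) (?Ye p) = m p (Y p) (deriv_mult (bracket A X) m Z Z' p)"
    by (simp add: m_e Yp m_commute[OF Yp lie_mult_T10[OF X Z Z' p]])
  ultimately have R1: "m p (Y p) (deriv_mult (bracket A X) m Z Z' p) =
      dm p (Z p) X (\<lambda>q. m q (Y q) (?Z'e q)) + m p (Z p) (dm p (Z' p) X ?Ye) - dm p ?ZZ' X ?Ye"
    by simp
  have "deriv_mult (bracket A Y) m Z Z' p =
      dm p (Z p) Y ?Z'e + m p (Z p) (dm p (Z' p) Y e) - dm p ?ZZ' Y e"
    using lie_mult[OF Y Z Z' es p] m_e(2)[OF lie_mult_T10[OF Y Z Z' p]] by simp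
  then have R2: "m p (X p) (deriv_mult (bracket A Y) m Z Z' p) =
      m p (X p) (dm p (Z p) Y ?Z'e) + m p (Z p) (m p (X p) (dm p (Z' p) Y e)) - m p (X p) (dm p ?ZZ' Y e)"
    using dm_T10[OF Zv Y Z'e p] dm_T10[OF Z'v Y es p] dm_T10[OF ZZ'v Y es p] Xp Zp
    by (simp add: m_diff_right m_add_right T10_plus m_T10 m_left_commute[OF Xp Zp])
  have "m p (deriv_mult (bracket A (\<lambda>q. m q (X q) (Y q))) m Z Z' p) (e p) =
      m p (X p) (deriv_mult (bracket A Y) m Z Z' p) + m p (Y p) (deriv_mult (bracket A X) m Z Z' p)"
    unfolding L R1 R2
    using dm_T10[OF Z'v X Ye p] m_T10[OF Xp dm_T10[OF Z'v Y es p]] Zp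
    by (simp add: m_add_right algebra_simps)
  then show ?thesis using m_e(2)[OF lie_mult_T10[OF XY Z Z' p]] by simp
qed

lemma F_manifold: "F_manifold A m e"
  unfolding F_manifold_def
proof (intro conjI allI ballI impI; (elim conjE)?)
  fix p a b c assume T: "a \<in> T10 A p" "b \<in> T10 A p" "c \<in> T10 A p"
  show "m p a b = m p b a" by (rule m_commute[OF T(1,2)])
  show "m p (m p a b) c = m p a (m p b c)" by (rule m_assoc[OF T])
  show "m p (e p) a = a" by (rule m_e(1)[OF T(1)])
qed (rule manifold hol_mult_m e(1) | rule F_manifold_identity, assumption+)+

subsection \<open>The difference of the connection and the Lie derivative\<close>

text \<open>At the unit, potentiality reads \<open>[F,X] = D\<^sub>F X - X \<circ> D\<^sub>F e -
  D\<^sub>X(\<mu>\<^sub>F) e\<close>, and \<open>H\<close> supplies the last term. As both sides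
  come from derivations over \<open>F\<close>, the formula passes from holomorphic to smooth fields.
  It is used for \<open>E\<close> with \<open>B\<close> = \<Q>, \<open>l\<close> = 1, and for
  \<open>e\<close> with \<open>B\<close> = 0, \<open>l\<close> = 0.\<close>

lemma D_minus_lie:
  assumes F: "hol_vf A UNIV F"
    and B: "\<And>a b c. a \<in> T10 A p \<Longrightarrow> b \<in> T10 A p \<Longrightarrow> B a \<in> T10 A p \<and> B (a + b) = B a + B b \<and> B (c *\<^sub>V a) = c *\<^sub>V B a"
    and H: "\<And>W X. hol_vf A W X \<Longrightarrow> p \<in> W \<Longrightarrow> dm p (X p) F e = l *\<^sub>V X p - m p (X p) (B (e p)) + B (X p)"
    and Y: "smooth_vf A W Y" "p \<in> W"
  shows "D p (F p) Y - bracket A F Y p = B (Y p) + m p (D p (F p) e + l *\<^sub>V e p - B (e p)) (Y p)"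
proof -
  let ?s = "D p (F p) e + l *\<^sub>V e p - B (e p)"
  have Fp: "F p \<in> T10 A p" by (rule hol_vf_T10[OF F]) simp
  note Fv = T10_CT[OF Fp]
  have De: "D p (F p) e \<in> T10 A p" by (rule D_T10[OF hol_imp_smooth_vf[OF e(1)] UNIV_I Fv])
  have Be: "B (e p) \<in> T10 A p" using B[OF e_T10 e_T10] by blast
  have s: "?s \<in> T10 A p" by (intro T10_minus T10_plus T10_smul De Be e_T10)
  \<comment> \<open>Subtracting a fibrewise linear map leaves the derivation rule intact, so
    \<open>?\<Delta>\<close> can be compared with the bracket on holomorphic fields alone.\<close>
  let ?\<Delta> = "\<lambda>Y. D p (F p) Y - (B (Y p) + m p ?s (Y p))"
  note d = derivation_atD[OF D_derivation[OF Fv]]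
  have 1: "derivation_at p (F p) ?\<Delta>"
    unfolding derivation_at_def
  proof (intro conjI allI impI; elim conjE)
    fix W Y Z assume W: "p \<in> W" "smooth_vf A W Y"
    note Yp = smooth_vf_T10[OF W(2,1)]
    note BY = B[OF Yp Yp]
    show "?\<Delta> Y \<in> T10 A p" by (intro T10_minus T10_plus m_T10 s Yp d(1)[OF W]) (use BY in blast)
    show "?\<Delta> (\<lambda>q. u q *\<^sub>V Y q) = F p u *\<^sub>V Y p + u p *\<^sub>V ?\<Delta> Y" if u: "smooth_fun A W u" for u
      using BY by (simp add: d(3)[OF W u] m_smul_right[OF Yp s] smul_distribs)
    assume Z: "smooth_vf A W Z"
    note Zp = smooth_vf_T10[OF Z W(1)]
    show "?\<Delta> (\<lambda>q. Y q + Z q) = ?\<Delta> Y + ?\<Delta> Z"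
      using B[OF Yp Zp] by (simp add: d(2)[OF W Z] m_add_right[OF Yp Zp s])
    assume eq: "\<forall>q\<in>W. Y q = Z q"
    have "D p (F p) Y = D p (F p) Z" by (rule d(4)[OF W Z]) (use eq in simp)
    then show "?\<Delta> Y = ?\<Delta> Z" using eq W(1) by simp
  qed
  have "?\<Delta> Y = bracket A F Y p"
  proof (rule derivations_eq[OF 1 derivation_bracket[OF F UNIV_I] _ Y])
    fix V X assume X: "hol_vf A V X" "p \<in> V"
    note Xp = hol_vf_T10[OF X]
    have FV: "hol_vf A V F" by (rule hol_vf_subset[OF F hol_vf_open[OF X(1)]]) simp
    note es = hol_imp_smooth_vf[OF e_hol[OF hol_vf_open[OF X(1)]]]
    have "D p (F p) (\<lambda>q. m q (X q) (e q)) = D p (F p) X"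
      by (rule D_cong[OF Fv m_smooth_vf[OF X(1) es] X(2)]) (simp add: m_e hol_vf_T10[OF X(1)])
    then have "dm p (F p) X e = D p (F p) X - m p (X p) (D p (F p) e)" by (simp add: dm_def)
    moreover have "m p (bracket A F X p) (e p) = bracket A F X p"
      by (rule m_e(2)[OF hol_vf_T10[OF bracket_hol[OF FV X(1)] X(2)]])
    ultimately have b1: "bracket A F X p = D p (F p) X - m p (X p) (D p (F p) e) - (l *\<^sub>V X p - m p (X p) (B (e p)) + B (X p))"
      using dm_commutator[OF FV X(1) es X(2)] H[OF X] by simp
    have b2: "m p ?s (X p) = m p (X p) (D p (F p) e) + l *\<^sub>V X p - m p (X p) (B (e p))"
      by (simp add: m_commute[OF s Xp] m_diff_right m_add_right m_smul_right m_e T10_plus T10_smul De Be Xp e_T10)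
    show "?\<Delta> X = bracket A F X p" unfolding b1 b2 by (simp add: algebra_simps)
  qed
  then show ?thesis by (simp add: algebra_simps)
qed

text \<open>The given equation for D(\<U>), with \<U> read as multiplication by \<open>E\<close> and
  \<open>C\<close> as minus multiplication.\<close>

lemma dm_E:
  assumes X: "hol_vf A W X" and Z: "smooth_vf A W Z" and p: "p \<in> W"
  shows "dm p (X p) E Z = m p (X p) (Z p) - m p (X p) (\<Q> p (Z p)) + \<Q> p (m p (X p) (Z p))"
proof -
  note Xp = hol_vf_T10[OF X p] and Zp = smooth_vf_T10[OF Z p]
  note Xv = T10_CT[OF Xp]
  have "smooth_vf A W (\<lambda>q. m q (E q) (Z q))" by (rule m_smooth_vf[OF E_hol[OF smooth_vf_open[OF Z]] Z])
  then have "D p (X p) (\<lambda>q. m q (E q) (Z q)) = D p (X p) (\<lambda>q. \<U> q (Z q))"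
    by (rule D_cong[OF Xv _ p]) (simp add: U_m smooth_vf_T10[OF Z])
  then have "deriv_endo (cov D X) \<U> Z p = dm p (X p) E Z"
    by (simp add: deriv_endo_def cov_def dm_def U_m D_T10[OF Z p Xv])
  then have "dm p (X p) E Z - (C p (X p) (\<Q> p (Z p)) - \<Q> p (C p (X p) (Z p))) + C p (X p) (Z p) = 0"
    using conjunct1[OF U_Q[of p W X Z]] X Z p by simp
  then show ?thesis by (simp add: mult_C Xp Zp Q_T10 Q_uminus m_T10 algebra_simps)
qed

text \<open>Multiplication by \<open>e\<close> is the identity, hence parallel.\<close>

lemma dm_e:
  assumes Z: "smooth_vf A W Z" and p: "p \<in> W" and v: "v \<in> CT A p"
  shows "dm p v e Z = 0"
proof -
  have "D p v (\<lambda>q. m q (e q) (Z q)) = D p v Z"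
    by (rule D_cong[OF v Z p, symmetric]) (simp add: m_e smooth_vf_T10[OF Z])
  then show ?thesis unfolding dm_def by (simp only: m_e(1)[OF D_T10[OF Z p v]] diff_self)
qed

text \<open>Inserting \<open>dm_E\<close> into \<open>lie_mult\<close> at \<open>e\<close> makes all
  \<Q>-terms cancel; of the three products Z \<circ> Z', with signs +, + and -, one is left.\<close>

lemma Euler_field: "Euler_field A m E"
  unfolding Euler_field_def
proof (intro conjI allI ballI impI; (elim conjE)?)
  fix W Z Z' p assume p: "p \<in> W" and Z: "hol_vf A W Z" and Z': "hol_vf A W Z'"
  note EW = E_hol[OF hol_vf_open[OF Z]]
  note es = hol_imp_smooth_vf[OF e_hol[OF hol_vf_open[OF Z]]]
  note Zp = hol_vf_T10[OF Z p] and Z'p = hol_vf_T10[OF Z' p]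
  note Qe = Q_T10[OF e_T10]
  have "m p (deriv_mult (bracket A E) m Z Z' p) (e p) = m p (Z p) (Z' p)"
    unfolding lie_mult[OF EW Z Z' es p] dm_E[OF Z m_smooth_vf[OF Z' es] p] dm_E[OF Z' es p]
      dm_E[OF m_hol_vf[OF Z Z'] es p]
    by (simp add: m_e Zp Z'p m_T10 m_add_right m_diff_right Q_T10 T10_minus T10_plus Qe m_assoc algebra_simps)
  then show "deriv_mult (bracket A E) m Z Z' p = m p (Z p) (Z' p)"
    using m_e(2)[OF lie_mult_T10[OF EW Z Z' p]] by simp
qed (rule E(1))

text \<open>\<open>D\<^sub>E - L\<^sub>E - \<Q>\<close> is multiplication by \<open>nE\<close>, and \<open>D\<^sub>e - L\<^sub>e\<close> is multiplication by \<open>ne\<close>.\<close>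

definition nE :: "'m cfield" where
  "nE p = D p (E p) e + 1 *\<^sub>V e p - \<Q> p (e p)"

definition ne :: "'m cfield" where
  "ne p = D p (e p) e"

lemma ne_T10: "ne p \<in> T10 A p"
  unfolding ne_def by (rule D_T10[OF hol_imp_smooth_vf[OF e(1)] UNIV_I T10_CT[OF e_T10]])

lemma nE_T10: "nE p \<in> T10 A p"
  unfolding nE_def
  by (intro T10_minus T10_plus T10_smul Q_T10 e_T10 D_T10[OF hol_imp_smooth_vf[OF e(1)] UNIV_I T10_CT[OF E_T10]])

lemma lie_E:
  assumes Y: "smooth_vf A W Y" "p \<in> W"
  shows "bracket A E Y p = D p (E p) Y - \<Q> p (Y p) - m p (nE p) (Y p)"
proof -
  have "D p (E p) Y - bracket A E Y p = \<Q> p (Y p) + m p (D p (E p) e + 1 *\<^sub>V e p - \<Q> p (e p)) (Y p)"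
  proof (rule D_minus_lie[OF E(1) _ _ Y])
    show "\<Q> p a \<in> T10 A p \<and> \<Q> p (a + b) = \<Q> p a + \<Q> p b \<and> \<Q> p (c *\<^sub>V a) = c *\<^sub>V \<Q> p a"
      if "a \<in> T10 A p" "b \<in> T10 A p" for a b c using that by (simp add: Q_T10 Q_add Q_smul)
    show "dm p (X p) E e = 1 *\<^sub>V X p - m p (X p) (\<Q> p (e p)) + \<Q> p (X p)" if "hol_vf A V X" "p \<in> V" for V X
      using dm_E[OF that(1) hol_imp_smooth_vf[OF e_hol[OF hol_vf_open[OF that(1)]]] that(2)] hol_vf_T10[OF that]
      by (simp add: m_e smul_distribs)
  qed
  then show ?thesis by (simp add: nE_def algebra_simps)
qed

lemma lie_e:
  assumes Y: "smooth_vf A W Y" "p \<in> W"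
  shows "bracket A e Y p = D p (e p) Y - m p (ne p) (Y p)"
proof -
  have "D p (e p) Y - bracket A e Y p = 0 + m p (D p (e p) e + 0 *\<^sub>V e p - 0) (Y p)"
  proof (rule D_minus_lie[OF e(1) _ _ Y, where B = "\<lambda>a. 0"])
    show "dm p (X p) e e = 0 *\<^sub>V X p - m p (X p) 0 + 0" if X: "hol_vf A V X" "p \<in> V" for V X
      using dm_e[OF hol_imp_smooth_vf[OF e_hol[OF hol_vf_open[OF X(1)]]] X(2) T10_CT[OF hol_vf_T10[OF X]]]
        m_diff_right[OF e_T10 e_T10 hol_vf_T10[OF X]]
      by (simp add: smul_distribs)
  qed (simp add: T10_zero smul_distribs)
  then show ?thesis by (simp add: ne_def smul_distribs algebra_simps)
qed

subsection \<open>The endomorphism \<open>\<Q>\<close>\<close>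

lemma e_CT: "e p \<in> CT A p" and E_CT: "E p \<in> CT A p"
  by (rule T10_CT[OF e_T10], rule T10_CT[OF E_T10])

lemma conjf_e_CT: "conjf e p \<in> CT A p" and conjf_E_CT: "conjf E p \<in> CT A p"
  unfolding conjf_def by (rule CT_conjv[OF e_CT], rule CT_conjv[OF E_CT])

lemma conjv_conjf: "conjv (conjf X p) = X p" "conjf X p = conjv (X p)"
  by (simp_all add: conjf_def)

lemma lie_conj_e: "smooth_vf A W Y \<Longrightarrow> p \<in> W \<Longrightarrow> bracket A (conjf e) Y p = D p (conjf e p) Y"
  and lie_conj_E: "smooth_vf A W Y \<Longrightarrow> p \<in> W \<Longrightarrow> bracket A (conjf E) Y p = D p (conjf E p) Y"
  by (rule lie_conj_eq_D[OF e(1) UNIV_I], assumption+) (rule lie_conj_eq_D[OF E(1) UNIV_I], assumption+)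

text \<open>D - L along \<open>E\<close> is \<Q> plus multiplication by \<open>nE\<close>.
  Multiplications are g-symmetric and \<Q> is g-skew, so its adjoint \<open>w\<close> has the sign
  of \<Q> reversed, and half the difference is \<Q>. Uniqueness of the adjoint comes from
  nondegeneracy of \<open>g\<close> and the extension of vectors to fields.\<close>

lemma Q_skew_part:
  assumes Y: "smooth_vf A W Y" and p: "p \<in> W"
  shows "\<Q> p (Y p) = skew_part A g (\<lambda>Z q. cov D E Z q - bracket A E Z q) Y p"
proof -
  note Yp = smooth_vf_T10[OF Y p]
  define w where "w = m p (nE p) (Y p) - \<Q> p (Y p)"
  have w: "w \<in> T10 A p" unfolding w_def by (intro T10_minus m_T10 nE_T10 Yp Q_T10)
  have B: "cov D E Z p - bracket A E Z p = \<Q> p (Z p) + m p (nE p) (Z p)"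
    if "smooth_vf A V Z" "p \<in> V" for V Z
    using lie_E[OF that] by (simp add: cov_def)
  have adj: "g p w (Z p) = g p (Y p) (cov D E Z p - bracket A E Z p)" if Z: "smooth_vf A V Z" "p \<in> V" for V Z
    unfolding B[OF Z] w_def using smooth_vf_T10[OF Z] Yp
    by (simp add: g_diff_left g_add_right m_T10 nE_T10 Q_T10 g_m Q_g)
  have "g_adjoint A g (\<lambda>Z q. cov D E Z q - bracket A E Z q) Y p = w"
    unfolding g_adjoint_def
  proof (rule the_equality)
    show "w \<in> T10 A p \<and> (\<forall>W Z. p \<in> W \<and> smooth_vf A W Z \<longrightarrow>
        g p w (Z p) = g p (Y p) (cov D E Z p - bracket A E Z p))"
      using w adj by blast
    fix w' assume w': "w' \<in> T10 A p \<and> (\<forall>W Z. p \<in> W \<and> smooth_vf A W Z \<longrightarrow>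
        g p w' (Z p) = g p (Y p) (cov D E Z p - bracket A E Z p))"
    show "w' = w"
    proof (rule g_eqI[OF conjunct1[OF w'] w])
      fix x assume "x \<in> T10 A p"
      then obtain V Z where Z: "p \<in> V" "hol_vf A V Z" "Z p = x" by (rule T10_extend)
      note Zs = hol_imp_smooth_vf[OF Z(2)]
      show "g p w' x = g p w x"
        using conjunct2[OF w', rule_format, of V Z] adj[OF Zs Z(1)] Z Zs by simp
    qed
  qed
  then show ?thesis
    unfolding skew_part_def B[OF Y p] by (simp add: w_def fun_eq_iff)
qed

lemma h_zero_left: assumes "x \<in> T10 A p" shows "h p 0 x = 0"
  using h_smul_left[OF T10_zero assms, of 0] by (simp add: smul_distribs)

lemma h_zero_right: assumes "x \<in> T10 A p" shows "h p x 0 = 0"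
  using h_smul_right[OF T10_zero assms, of 0] by (simp add: smul_distribs)

lemma g_zero_left: assumes "x \<in> T10 A p" shows "g p 0 x = 0"
  using g_smul_left[OF T10_zero assms, of 0] by (simp add: smul_distribs)

lemma m_zero_left: assumes "x \<in> T10 A p" shows "m p 0 x = 0"
  using m_smul_left[OF T10_zero assms, of 0] by (simp add: smul_distribs)

text \<open>Differentiate h(\<Q>Y,Z) = h(Y,\<Q>Z) along \<open>v\<close>; the second argument of
  \<open>h\<close> is differentiated along the conjugate direction.\<close>

lemma D_Q_adjoint:
  assumes Y: "smooth_vf A W Y" and Z: "smooth_vf A W Z" and p: "p \<in> W" and v: "v \<in> CT A p"
  shows "h p (D p v (\<lambda>q. \<Q> q (Y q)) - \<Q> p (D p v Y)) (Z p) =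
    h p (Y p) (D p (conjv v) (\<lambda>q. \<Q> q (Z q)) - \<Q> p (D p (conjv v) Z))"
proof -
  note v' = CT_conjv[OF v]
  note QY = Q_smooth[OF Y] and QZ = Q_smooth[OF Z]
  note Yp = smooth_vf_T10[OF Y] and Zp = smooth_vf_T10[OF Z]
  have "v (\<lambda>q. h q (\<Q> q (Y q)) (Z q)) = v (\<lambda>q. h q (Y q) (\<Q> q (Z q)))"
    by (rule CT_cong[OF v smooth_vf_open[OF Y] p]) (simp add: Q_h Yp Zp)
  then show ?thesis
    unfolding D_h[OF v QY Z p] D_h[OF v Y QZ p]
    by (simp add: h_diff_left h_diff_right Q_T10 D_T10[OF QY p v] D_T10[OF Y p v] D_T10[OF QZ p v'] D_T10[OF Z p v']
        Yp[OF p] Zp[OF p] Q_h algebra_simps)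
qed

text \<open>The structure equations give D(\<Q>) only in (1,0) directions. Its value in a (0,1)
  direction is read off as the h-adjoint of the known one, by nondegeneracy of
  \<open>h\<close>.\<close>

lemma D_conj_Q_eqI:
  assumes Y: "smooth_vf A W Y" and p: "p \<in> W" and v: "v \<in> T10 A p" and b: "b \<in> T10 A p"
    and H: "\<And>V Z. smooth_vf A V Z \<Longrightarrow> p \<in> V \<Longrightarrow>
      h p (Y p) (D p v (\<lambda>q. \<Q> q (Z q)) - \<Q> p (D p v Z)) = h p b (Z p)"
  shows "D p (conjv v) (\<lambda>q. \<Q> q (Y q)) - \<Q> p (D p (conjv v) Y) = b"
proof (rule h_eqI[OF _ b])
  note v' = CT_conjv[OF T10_CT[OF v]]
  show "D p (conjv v) (\<lambda>q. \<Q> q (Y q)) - \<Q> p (D p (conjv v) Y) \<in> T10 A p"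
    by (intro T10_minus Q_T10 D_T10[OF Y p v'] D_T10[OF Q_smooth[OF Y] p v'])
  fix x assume "x \<in> T10 A p"
  then obtain V Z where Z: "p \<in> V" "hol_vf A V Z" "Z p = x" by (rule T10_extend)
  have o: "open (V \<inter> W)" using hol_vf_open[OF Z(2)] smooth_vf_open[OF Y] by auto
  have Zs: "smooth_vf A (V \<inter> W) Z" by (rule smooth_vf_subset[OF hol_imp_smooth_vf[OF Z(2)] o]) auto
  have Ys: "smooth_vf A (V \<inter> W) Y" by (rule smooth_vf_subset[OF Y o]) auto
  have pVW: "p \<in> V \<inter> W" using p Z by auto
  show "h p (D p (conjv v) (\<lambda>q. \<Q> q (Y q)) - \<Q> p (D p (conjv v) Y)) x = h p b x"
    using D_Q_adjoint[OF Ys Zs pVW v'] H[OF Zs pVW] Z(3) by simp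
qed

text \<open>In the equation for D(\<Q>) along \<open>e\<close> the endomorphism C is minus the
  identity, so the commutator vanishes.\<close>

lemma D_e_Q:
  assumes Y: "smooth_vf A W Y" and p: "p \<in> W"
  shows "D p (e p) (\<lambda>q. \<Q> q (Y q)) - \<Q> p (D p (e p) Y) = 0"
proof -
  note Yp = smooth_vf_T10[OF Y p]
  have T: "\<kappa> p (\<U> p (\<kappa> p (Y p))) \<in> T10 A p" by (intro \<kappa>_T10 U_T10 Yp)
  have "\<kappa> p (\<U> p (\<kappa> p (- Y p))) = - \<kappa> p (\<U> p (\<kappa> p (Y p)))"
    by (simp add: \<kappa>_uminus Yp U_m \<kappa>_T10 T10_uminus m_uminus_right E_T10 m_T10)
  then show ?thesis
    using conjunct2[OF U_Q[of p W e Y]] e_hol[OF smooth_vf_open[OF Y]] Y p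
    by (simp add: deriv_endo_def cov_def e(2) Yp T)
qed

lemma D_conj_e_Q:
  assumes Y: "smooth_vf A W Y" and p: "p \<in> W"
  shows "D p (conjf e p) (\<lambda>q. \<Q> q (Y q)) - \<Q> p (D p (conjf e p) Y) = 0"
  unfolding conjf_def
  by (rule D_conj_Q_eqI[OF Y p e_T10 T10_zero])
     (simp add: D_e_Q h_zero_left h_zero_right smooth_vf_T10[OF Y p] smooth_vf_T10)

lemma e_derivatives_Q:
  assumes Y: "smooth_vf A W Y" and p: "p \<in> W"
  shows "deriv_endo (bracket A (conjf e)) \<Q> Y p = 0" "deriv_endo (cov D (conjf e)) \<Q> Y p = 0"
    "deriv_endo (cov D e) \<Q> Y p = 0"
  using D_e_Q[OF Y p] D_conj_e_Q[OF Y p] lie_conj_e[OF Y p] lie_conj_e[OF Q_smooth[OF Y] p]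
  by (simp_all add: deriv_endo_def cov_def)

subsection \<open>The flatness of the unit field\<close>

lemma T10_field:
  assumes "x \<in> T10 A p" obtains W Y where "p \<in> W" "smooth_vf A W Y" "Y p = x"
  using T10_extend[OF assms] hol_imp_smooth_vf by metis

lemma e_smooth: "open W \<Longrightarrow> smooth_vf A W e"
  by (rule hol_imp_smooth_vf[OF e_hol])

text \<open>\<open>D\<close> annihilates \<open>h\<close>. L and D agree along
  \<open>conjf e\<close> and differ along \<open>e\<close> by multiplication by \<open>ne\<close>,
  so only that multiplication is left, in the argument that is differentiated along
  \<open>e\<close>.\<close>

lemma lie_e_h:
  assumes Y: "smooth_vf A W Y" and Z: "smooth_vf A W Z" and p: "p \<in> W"
  shows "deriv_form e (bracket A e) (bracket A (conjf e)) h Y Z p = h p (m p (ne p) (Y p)) (Z p)"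
    "deriv_form (conjf e) (bracket A (conjf e)) (bracket A e) h Y Z p = h p (Y p) (m p (ne p) (Z p))"
proof -
  note Yp = smooth_vf_T10[OF Y p] and Zp = smooth_vf_T10[OF Z p]
  note DY = D_T10[OF Y p e_CT] and DZ = D_T10[OF Z p e_CT]
  note D'Y = D_T10[OF Y p conjf_e_CT] and D'Z = D_T10[OF Z p conjf_e_CT]
  show "deriv_form e (bracket A e) (bracket A (conjf e)) h Y Z p = h p (m p (ne p) (Y p)) (Z p)"
    unfolding deriv_form_def D_h[OF e_CT Y Z p] lie_e[OF Y p] lie_conj_e[OF Z p] conjv_conjf
    by (simp add: h_diff_left DY m_T10 ne_T10 Yp Zp)
  show "deriv_form (conjf e) (bracket A (conjf e)) (bracket A e) h Y Z p = h p (Y p) (m p (ne p) (Z p))"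
    unfolding deriv_form_def D_h[OF conjf_e_CT Y Z p] lie_e[OF Z p] lie_conj_e[OF Y p]
    by (simp add: h_diff_right DZ m_T10 ne_T10 Yp Zp conjv_conjf)
qed

text \<open>The same comparison with D(\<kappa>) = 0: the multiplier appears outside or inside
  \<kappa> according to which side is differentiated along \<open>e\<close>.\<close>

lemma lie_e_\<kappa>:
  assumes Y: "smooth_vf A W Y" and p: "p \<in> W"
  shows "deriv_anti (bracket A e) (bracket A (conjf e)) \<kappa> Y p = - m p (ne p) (\<kappa> p (Y p))"
    "deriv_anti (bracket A (conjf e)) (bracket A e) \<kappa> Y p = \<kappa> p (m p (ne p) (Y p))"
proof -
  note Yp = smooth_vf_T10[OF Y p] and K = \<kappa>_smooth[OF Y]
  note DY = D_T10[OF Y p e_CT]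
  show "deriv_anti (bracket A e) (bracket A (conjf e)) \<kappa> Y p = - m p (ne p) (\<kappa> p (Y p))"
    unfolding deriv_anti_def lie_e[OF K p] lie_conj_e[OF Y p] D_\<kappa>[OF p e_CT Y] by (simp add: conjv_conjf)
  show "deriv_anti (bracket A (conjf e)) (bracket A e) \<kappa> Y p = \<kappa> p (m p (ne p) (Y p))"
    unfolding deriv_anti_def lie_conj_e[OF K p] lie_e[OF Y p] D_\<kappa>[OF p conjf_e_CT Y]
    by (simp add: conjv_conjf \<kappa>_diff DY m_T10 ne_T10 Yp)
qed

text \<open>Here both arguments are differentiated along \<open>e\<close>, and the two multiplier
  terms are equal because multiplication is g-symmetric; hence the factor 2.\<close>

lemma lie_e_g:
  assumes Y: "smooth_vf A W Y" and Z: "smooth_vf A W Z" and p: "p \<in> W"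
  shows "deriv_form e (bracket A e) (bracket A e) g Y Z p = 2 * g p (m p (ne p) (Y p)) (Z p)"
proof -
  note Yp = smooth_vf_T10[OF Y p] and Zp = smooth_vf_T10[OF Z p]
  note DY = D_T10[OF Y p e_CT] and DZ = D_T10[OF Z p e_CT]
  show ?thesis
    unfolding deriv_form_def D_g[OF e_CT Y Z p] lie_e[OF Y p] lie_e[OF Z p]
    by (simp add: g_diff_left g_diff_right DY DZ m_T10 ne_T10 Yp Zp g_m)
qed

lemma lie_e_Q:
  assumes Y: "smooth_vf A W Y" and p: "p \<in> W" and "ne p = 0"
  shows "deriv_endo (bracket A e) \<Q> Y p = 0"
  unfolding deriv_endo_def lie_e[OF Y p] lie_e[OF Q_smooth[OF Y] p] assms(3)
  using D_e_Q[OF Y p] smooth_vf_T10[OF Y p] by (simp add: m_zero_left Q_T10)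

text \<open>\<open>e\<close> is of type (1,0), so the conjugate half of \<open>covC\<close>
  differentiates the zero field.\<close>

lemma covC_e_e: "covC A D e e p = ne p"
proof -
  have "D p (e p) (\<lambda>q. part10 A q (e q)) = D p (e p) e"
    by (rule D_cong[OF e_CT e_smooth[OF open_UNIV] UNIV_I, symmetric]) (simp add: part10_T10 e_T10)
  moreover have "D p (conjv (e p)) (\<lambda>q. conjv (part01 A q (e q))) = 0"
  proof -
    have "D p (conjv (e p)) (\<lambda>q. conjv (part01 A q (e q))) = D p (conjv (e p)) (\<lambda>q. 0)"
      by (rule D_cong[OF CT_conjv[OF e_CT] smooth_vf_zero[OF open_UNIV] UNIV_I, symmetric])
         (simp add: part01_def part10_T10 e_T10)
    also have "\<dots> = 0" by (rule D_conj_hol[OF hol_vf_zero[OF open_UNIV] UNIV_I e_T10])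
    finally show ?thesis .
  qed
  ultimately show ?thesis by (simp add: covC_def ne_def)
qed

text \<open>Coordinate one-forms evaluated on \<open>e\<close> detect the difference: the bracket of
  \<open>e\<close> with itself is 0, while the connection yields \<open>ne\<close>.\<close>

lemma agree_imp_flat:
  assumes ag: "agree_on_tensors A e (covC A D e) (bracket A e)" shows "ne p = 0"
proof -
  obtain U \<phi> where U: "(U,\<phi>) \<in> A" "p \<in> U" using chart_ex by blast
  have "ne p (\<lambda>q. \<phi> q $ i) = 0" for i
  proof -
    \<comment> \<open>The i-th holomorphic coordinate differential, as a tensor with one vector
      argument and no covector argument.\<close>
    define T :: "'m \<Rightarrow> 'm cvec list \<Rightarrow> 'm covec list \<Rightarrow> complex" where "T = (\<lambda>q vs \<alpha>s. (vs ! 0) (\<lambda>r. \<phi> r $ i))"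
    have z: "smooth_fun A V (\<lambda>r. \<phi> r $ i)" if "open V" "V \<subseteq> U" for V
      by (rule smooth_fun_subset[OF hol_imp_smooth[OF hol_fun_coord[OF U(1)]] that])
    have T: "smooth_tensor A U 1 0 T"
      unfolding smooth_tensor_def
    proof (intro conjI ballI allI impI; (elim conjE)?)
      show "open U" by (rule chart_open(1)[OF U(1)])
      fix V and Ys :: "'m cfield list" and \<omega>s :: "('m \<Rightarrow> 'm covec) list"
      assume V: "V \<subseteq> U" "open V" and Ys: "length Ys = 1" "\<forall>Y\<in>set Ys. smooth_cvf A V Y"
      then have "smooth_cvf A V (Ys ! 0)" by simp
      from smooth_cvf_fun[OF this z[OF V(2,1)]]
      show "smooth_fun A V (\<lambda>p. T p (map (\<lambda>Y. Y p) Ys) (map (\<lambda>\<omega>. \<omega> p) \<omega>s))"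
        using Ys(1) by (simp add: T_def)
    qed (auto simp: T_def)
    have ag': "deriv_tensor A e (covC A D e) T [e] [] p = deriv_tensor A e (bracket A e) T [e] [] p"
      using ag[unfolded agree_on_tensors_def, rule_format, of U 1 0 T "[e]" "[]" p] T U(2)
        smooth_vf_cvf[OF e_smooth[OF chart_open(1)[OF U(1)]]] by simp
    then show ?thesis by (simp add: deriv_tensor_def T_def covC_e_e bracket_self)
  qed
  then show ?thesis by (intro T10_eqI[OF ne_T10 T10_zero U]) auto
qed

text \<open>Split \<open>Y\<close> into types. On the (1,0)-part \<open>lie_e\<close> applies with
  vanishing multiplier; the (0,1)-part is conjugated, which turns \<open>e\<close> into
  \<open>conjf e\<close>, where Lie and covariant derivative always agree.\<close>

lemma flat_imp_covC_eq:
  assumes n: "\<And>p. ne p = 0" and Y: "smooth_cvf A W Y" and p: "p \<in> W"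
  shows "covC A D e Y p = bracket A e Y p"
proof -
  note Y1 = part10_smooth[OF Y] and Y2 = part01_smooth[OF Y]
  note eW = smooth_vf_cvf[OF e_smooth[OF smooth_cvf_open[OF Y]]]
  let ?Z = "\<lambda>q. conjv (part01 A q (Y q))"
  have Y01: "conjf ?Z = (\<lambda>q. part01 A q (Y q))" by (simp add: conjf_def)
  have "bracket A e Y p = bracket A e (\<lambda>q. part10 A q (Y q) + conjf ?Z q) p"
    unfolding Y01 by (simp add: part01_def)
  also have "\<dots> = bracket A e (\<lambda>q. part10 A q (Y q)) p + bracket A e (conjf ?Z) p"
    by (rule bracket_add[OF eW smooth_vf_cvf[OF Y1] smooth_cvf_conjf[OF smooth_vf_cvf[OF Y2]] p])
  also have "bracket A e (conjf ?Z) p = conjv (bracket A (conjf e) ?Z p)"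
    using bracket_conjf[of "conjf e" ?Z p] by simp
  also have "bracket A (conjf e) ?Z p = D p (conjv (e p)) ?Z"
    unfolding lie_conj_e[OF Y2 p] conjv_conjf(2) ..
  also have "bracket A e (\<lambda>q. part10 A q (Y q)) p = D p (e p) (\<lambda>q. part10 A q (Y q))"
    using lie_e[OF Y1 p] m_zero_left[OF smooth_vf_T10[OF Y1 p]] by (simp add: n)
  finally show ?thesis by (simp only: covC_def)
qed

text \<open>By the Leibniz rule the derivative of a tensor involves the operator only through its
  values on smooth vector fields, also in the covector arguments.\<close>

lemma agree_on_tensorsI:
  assumes eq: "\<And>W Y p. smooth_cvf A W Y \<Longrightarrow> p \<in> W \<Longrightarrow> \<delta> Y p = \<epsilon> Y p"
  shows "agree_on_tensors A X \<delta> \<epsilon>"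
  unfolding agree_on_tensors_def
proof (intro allI impI ballI; elim conjE)
  fix k l W T and Ys :: "'m cfield list" and \<omega>s :: "('m \<Rightarrow> 'm covec) list" and p
  assume Ys: "\<forall>Y\<in>set Ys. smooth_cvf A W Y" and p: "p \<in> W"
  have 1: "\<delta> (Ys ! i) p = \<epsilon> (Ys ! i) p" if "i < length Ys" for i
    using eq[OF _ p] Ys that by simp
  \<comment> \<open>The predicates under \<open>THE\<close> in \<open>deriv_covec\<close> coincide
    for both operators, hence so do the covectors they describe.\<close>
  have cov: "(\<exists>W Y. p \<in> W \<and> smooth_cvf A W Y \<and> Y p = v \<and> c = X p (\<lambda>q. \<omega> q (Y q)) - \<omega> p (\<delta> Y p)) \<longleftrightarrow>
      (\<exists>W Y. p \<in> W \<and> smooth_cvf A W Y \<and> Y p = v \<and> c = X p (\<lambda>q. \<omega> q (Y q)) - \<omega> p (\<epsilon> Y p))" for v c \<omega>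
    using eq by (intro ex_cong1 conj_cong refl) auto
  have 2: "deriv_covec A X \<delta> \<omega> p = deriv_covec A X \<epsilon> \<omega> p" for \<omega>
    unfolding deriv_covec_def cov ..
  show "deriv_tensor A X \<delta> T Ys \<omega>s p = deriv_tensor A X \<epsilon> T Ys \<omega>s p"
    unfolding deriv_tensor_def 2 using 1 by simp
qed

text \<open>Each formula for a derivative of h, \<kappa> or g contains multiplication by
  \<open>ne\<close>. Evaluated where this acts on the unit, it exhibits \<open>ne\<close> itself,
  and nondegeneracy of the form or invertibility of \<kappa> forces \<open>ne\<close> to vanish.
  Conversely \<open>ne\<close> = 0 makes these formulas vanish.\<close>

lemma flat_unit_iff:
  shows "agree_on_tensors A e (covC A D e) (bracket A e) \<longleftrightarrow> (\<forall>p. ne p = 0)"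
    "(\<forall>W Y Z. \<forall>p\<in>W. smooth_vf A W Y \<and> smooth_vf A W Z \<longrightarrow>
        deriv_form e (bracket A e) (bracket A (conjf e)) h Y Z p = 0) \<longleftrightarrow> (\<forall>p. ne p = 0)"
    "(\<forall>W Y Z. \<forall>p\<in>W. smooth_vf A W Y \<and> smooth_vf A W Z \<longrightarrow>
        deriv_form (conjf e) (bracket A (conjf e)) (bracket A e) h Y Z p = 0) \<longleftrightarrow> (\<forall>p. ne p = 0)"
    "(\<forall>W Y. \<forall>p\<in>W. smooth_vf A W Y \<longrightarrow>
        deriv_anti (bracket A e) (bracket A (conjf e)) \<kappa> Y p = 0) \<longleftrightarrow> (\<forall>p. ne p = 0)"
    "(\<forall>W Y. \<forall>p\<in>W. smooth_vf A W Y \<longrightarrow>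
        deriv_anti (bracket A (conjf e)) (bracket A e) \<kappa> Y p = 0) \<longleftrightarrow> (\<forall>p. ne p = 0)"
    "(\<forall>W Y Z. \<forall>p\<in>W. smooth_vf A W Y \<and> smooth_vf A W Z \<longrightarrow>
        deriv_form e (bracket A e) (bracket A e) g Y Z p = 0) \<longleftrightarrow> (\<forall>p. ne p = 0)" (is "?S7 \<longleftrightarrow> _")
proof -
  show "agree_on_tensors A e (covC A D e) (bracket A e) \<longleftrightarrow> (\<forall>p. ne p = 0)"
    using agree_imp_flat flat_imp_covC_eq agree_on_tensorsI[of "covC A D e" "bracket A e" e] by blast
  show "(\<forall>W Y Z. \<forall>p\<in>W. smooth_vf A W Y \<and> smooth_vf A W Z \<longrightarrow>
        deriv_form e (bracket A e) (bracket A (conjf e)) h Y Z p = 0) \<longleftrightarrow> (\<forall>p. ne p = 0)" (is "?S \<longleftrightarrow> _")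
  proof (intro iffI allI)
    fix p assume S: ?S
    show "ne p = 0"
    proof (rule h_eqI[OF ne_T10 T10_zero])
      fix x assume x: "x \<in> T10 A p"
      then obtain W Z where Z: "p \<in> W" "smooth_vf A W Z" "Z p = x" by (rule T10_field)
      note ee = e_smooth[OF smooth_vf_open[OF Z(2)]]
      have "h p (m p (ne p) (e p)) (Z p) = 0"
        using S[rule_format, OF Z(1) conjI[OF ee Z(2)]] lie_e_h(1)[OF ee Z(2,1)] by simp
      then show "h p (ne p) x = h p 0 x" using Z x by (simp add: m_e ne_T10 h_zero_left)
    qed
  qed (auto simp: lie_e_h m_zero_left h_zero_left smooth_vf_T10)
  show "(\<forall>W Y Z. \<forall>p\<in>W. smooth_vf A W Y \<and> smooth_vf A W Z \<longrightarrow>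
        deriv_form (conjf e) (bracket A (conjf e)) (bracket A e) h Y Z p = 0) \<longleftrightarrow> (\<forall>p. ne p = 0)" (is "?S \<longleftrightarrow> _")
  proof (intro iffI allI)
    fix p assume S: ?S
    show "ne p = 0"
    proof (rule h_eqI[OF ne_T10 T10_zero])
      fix x assume x: "x \<in> T10 A p"
      then obtain W Z where Z: "p \<in> W" "smooth_vf A W Z" "Z p = x" by (rule T10_field)
      note ee = e_smooth[OF smooth_vf_open[OF Z(2)]]
      have "h p (Z p) (m p (ne p) (e p)) = 0"
        using S[rule_format, OF Z(1) conjI[OF Z(2) ee]] lie_e_h(2)[OF Z(2) ee Z(1)] by simp
      then show "h p (ne p) x = h p 0 x" using Z x h_cnj[OF x ne_T10] by (simp add: m_e ne_T10 h_zero_left)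
    qed
  qed (auto simp: lie_e_h m_zero_left h_zero_right smooth_vf_T10)
  show "(\<forall>W Y. \<forall>p\<in>W. smooth_vf A W Y \<longrightarrow>
        deriv_anti (bracket A e) (bracket A (conjf e)) \<kappa> Y p = 0) \<longleftrightarrow> (\<forall>p. ne p = 0)" (is "?S \<longleftrightarrow> _")
  proof (intro iffI allI)
    fix p assume S: ?S
    \<comment> \<open>The test field is \<kappa>e, because the formula multiplies \<kappa>Y and
      \<kappa> is an involution.\<close>
    note K = \<kappa>_smooth[OF e_smooth[OF open_UNIV]]
    have "m p (ne p) (\<kappa> p (\<kappa> p (e p))) = 0"
      using S[rule_format, OF UNIV_I K, of p] lie_e_\<kappa>(1)[OF K UNIV_I, of p] by simp
    then show "ne p = 0" by (simp add: \<kappa>_\<kappa> e_T10 m_e ne_T10)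
  qed (auto simp: lie_e_\<kappa> m_zero_left \<kappa>_T10 smooth_vf_T10)
  have \<kappa>0: "\<kappa> p 0 = 0" for p using \<kappa>_smul[OF T10_zero, of p 0] by (simp add: smul_distribs)
  show "(\<forall>W Y. \<forall>p\<in>W. smooth_vf A W Y \<longrightarrow>
        deriv_anti (bracket A (conjf e)) (bracket A e) \<kappa> Y p = 0) \<longleftrightarrow> (\<forall>p. ne p = 0)" (is "?S \<longleftrightarrow> _")
  proof (intro iffI allI)
    fix p assume S: ?S
    note ee = e_smooth[OF open_UNIV]
    have "\<kappa> p (\<kappa> p (m p (ne p) (e p))) = 0"
      using S[rule_format, OF UNIV_I ee, of p] lie_e_\<kappa>(2)[OF ee UNIV_I, of p] by (simp add: \<kappa>0)
    then show "ne p = 0" by (simp add: \<kappa>_\<kappa> e_T10 m_e ne_T10)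
  qed (auto simp: lie_e_\<kappa> m_zero_left \<kappa>0 smooth_vf_T10)
  show "?S7 \<longleftrightarrow> (\<forall>p. ne p = 0)"
  proof (intro iffI allI)
    fix p assume S: ?S7
    show "ne p = 0"
    proof (rule g_eqI[OF ne_T10 T10_zero])
      fix x assume x: "x \<in> T10 A p"
      then obtain W Z where Z: "p \<in> W" "smooth_vf A W Z" "Z p = x" by (rule T10_field)
      note ee = e_smooth[OF smooth_vf_open[OF Z(2)]]
      have "g p (m p (ne p) (e p)) (Z p) = 0"
        using S[rule_format, OF Z(1) conjI[OF ee Z(2)]] lie_e_g[OF ee Z(2,1)] by simp
      then show "g p (ne p) x = g p 0 x"
        using Z x by (simp add: m_e ne_T10 g_zero_left)
    qed
  qed (auto simp: lie_e_g m_zero_left g_zero_left smooth_vf_T10)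
qed

subsection \<open>Homogeneity\<close>

lemma U_uminus: "a \<in> T10 A p \<Longrightarrow> \<U> p (- a) = - \<U> p a"
  by (simp add: U_m T10_uminus m_uminus_right E_T10)

text \<open>Write h as g with \<kappa> in the second argument, move \<U> across by g-symmetry and
  insert \<kappa>\<kappa> = id.\<close>

lemma U_h_adjoint:
  assumes a: "a \<in> T10 A p" and b: "b \<in> T10 A p" shows "h p (\<U> p a) b = h p a (\<kappa> p (\<U> p (\<kappa> p b)))"
  using C_U_g[OF a a a \<kappa>_T10[OF b]] by (simp add: h_g a b U_T10 \<kappa>_T10 \<kappa>_\<kappa>)

lemma U_h_adjoint':
  assumes a: "a \<in> T10 A p" and b: "b \<in> T10 A p" shows "h p (\<kappa> p (\<U> p (\<kappa> p a))) b = h p a (\<U> p b)"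
  using U_h_adjoint[OF b a] h_cnj[of "\<U> p b" p a] h_cnj[of b p "\<kappa> p (\<U> p (\<kappa> p a))"]
  by (simp add: a b U_T10 \<kappa>_T10)

text \<open>The commutator of \<open>\<U>\<close> with its h-adjoint \<open>\<kappa> \<U> \<kappa>\<close>, hence h-self-adjoint.\<close>

definition UU :: "'m \<Rightarrow> 'm cvec \<Rightarrow> 'm cvec" where
  "UU p a = \<U> p (\<kappa> p (\<U> p (\<kappa> p a))) - \<kappa> p (\<U> p (\<kappa> p (\<U> p a)))"

lemma UU_T10: "a \<in> T10 A p \<Longrightarrow> UU p a \<in> T10 A p"
  by (simp add: UU_def T10_minus U_T10 \<kappa>_T10)

lemma UU_h: "a \<in> T10 A p \<Longrightarrow> b \<in> T10 A p \<Longrightarrow> h p (UU p a) b = h p a (UU p b)"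
  by (simp add: UU_def h_diff_left h_diff_right U_T10 \<kappa>_T10 U_h_adjoint U_h_adjoint')

text \<open>C along \<open>E\<close> is -\<U>, so the equation for D(\<Q>) has the commutator of
  \<U> with \<kappa>\<U>\<kappa> on its right side.\<close>

lemma D_E_Q:
  assumes Y: "smooth_vf A W Y" and p: "p \<in> W"
  shows "D p (E p) (\<lambda>q. \<Q> q (Y q)) - \<Q> p (D p (E p) Y) = UU p (Y p)"
proof -
  note Yp = smooth_vf_T10[OF Y p]
  have "deriv_endo (cov D E) \<Q> Y p
      + (C p (E p) (\<kappa> p (\<U> p (\<kappa> p (Y p)))) - \<kappa> p (\<U> p (\<kappa> p (C p (E p) (Y p))))) = 0"
    using conjunct2[OF U_Q[of p W E Y]] E_hol[OF smooth_vf_open[OF Y]] Y p by simp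
  then show ?thesis
    by (simp add: deriv_endo_def cov_def UU_def E(2) Yp U_T10 \<kappa>_T10 U_uminus \<kappa>_uminus T10_uminus algebra_simps)
qed

text \<open>\<open>UU\<close> is h-self-adjoint, so taking adjoints to reach the conjugate direction
  does not change it.\<close>

lemma D_conj_E_Q:
  assumes Y: "smooth_vf A W Y" and p: "p \<in> W"
  shows "D p (conjf E p) (\<lambda>q. \<Q> q (Y q)) - \<Q> p (D p (conjf E p) Y) = UU p (Y p)"
  unfolding conjf_def
  by (rule D_conj_Q_eqI[OF Y p E_T10 UU_T10[OF smooth_vf_T10[OF Y p]]])
     (simp add: D_E_Q UU_h smooth_vf_T10[OF Y p] smooth_vf_T10)

end

text \<open>The constant \<open>c\<close> stands for (2 - d)/2. It is assumed real because it has to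
  pass unchanged through the conjugate-linear argument of \<open>h\<close>.\<close>

locale homogeneous_cv_structure = cv_structure +
  fixes c :: complex
  assumes real_c: "cnj c = c"
    and lie_g: "\<And>W Y Z p. p \<in> W \<Longrightarrow> smooth_vf A W Y \<Longrightarrow> smooth_vf A W Z \<Longrightarrow>
          deriv_form E (bracket A E) (bracket A E) g Y Z p = 2 * c * g p (Y p) (Z p)"
begin

text \<open>As \<open>D\<close> annihilates g, the Lie derivative of g along \<open>E\<close>
  consists of a \<Q>-part and a multiplication part. The \<Q>-terms of the two arguments cancel by
  skewness, the multiplications add up to twice g(nE \<circ> Y,Z), and nondegeneracy identifies the
  multiplier.\<close>

lemma nE_eq:
  assumes a: "a \<in> T10 A p" shows "m p (nE p) a = c *\<^sub>V a"
proof (rule g_eqI[OF m_T10[OF nE_T10 a] T10_smul[OF a]])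
  fix b assume b: "b \<in> T10 A p"
  obtain W Y where Y: "p \<in> W" "smooth_vf A W Y" "Y p = a" by (rule T10_field[OF a])
  obtain V Z where Z: "p \<in> V" "smooth_vf A V Z" "Z p = b" by (rule T10_field[OF b])
  have o: "open (V \<inter> W)" using smooth_vf_open[OF Z(2)] smooth_vf_open[OF Y(2)] by auto
  have Zs: "smooth_vf A (V \<inter> W) Z" by (rule smooth_vf_subset[OF Z(2) o]) auto
  have Ys: "smooth_vf A (V \<inter> W) Y" by (rule smooth_vf_subset[OF Y(2) o]) auto
  have p: "p \<in> V \<inter> W" using Y Z by auto
  have "deriv_form E (bracket A E) (bracket A E) g Y Z p = 2 * g p (m p (nE p) a) b"
    unfolding deriv_form_def D_g[OF E_CT Ys Zs p] lie_E[OF Ys p] lie_E[OF Zs p]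
    using a b Y(3) Z(3)
    by (simp add: g_diff_left g_diff_right D_T10[OF Ys p E_CT] D_T10[OF Zs p E_CT] m_T10 nE_T10 Q_T10 T10_minus g_m Q_g)
  then show "g p (m p (nE p) a) b = g p (c *\<^sub>V a) b"
    using lie_g[OF p Ys Zs] Y(3) Z(3) a b by (simp add: g_smul_left)
qed

lemma lie_E_homogeneous:
  assumes Y: "smooth_vf A W Y" and p: "p \<in> W"
  shows "bracket A E Y p = D p (E p) Y - \<Q> p (Y p) - c *\<^sub>V Y p"
  using lie_E[OF Y p] nE_eq[OF smooth_vf_T10[OF Y p]] by simp

text \<open>The two Lie derivatives are h(\<Q>Y,Z) and h(Y,\<Q>Z), each plus \<open>c\<close> times
  h(Y,Z). They agree since \<Q> is h-self-adjoint and \<open>c\<close> is real.\<close>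

lemma lie_E_h:
  assumes Y: "smooth_vf A W Y" and Z: "smooth_vf A W Z" and p: "p \<in> W"
  shows "deriv_form E (bracket A E) (bracket A (conjf E)) h Y Z p
            - deriv_form (conjf E) (bracket A (conjf E)) (bracket A E) h Y Z p = 0"
proof -
  note Yp = smooth_vf_T10[OF Y p] and Zp = smooth_vf_T10[OF Z p]
  note DY = D_T10[OF Y p E_CT] and DZ = D_T10[OF Z p E_CT]
  have "deriv_form E (bracket A E) (bracket A (conjf E)) h Y Z p = h p (\<Q> p (Y p)) (Z p) + c * h p (Y p) (Z p)"
    unfolding deriv_form_def D_h[OF E_CT Y Z p] lie_E_homogeneous[OF Y p] lie_conj_E[OF Z p] conjv_conjf
    by (simp add: h_diff_left h_smul_left DY Q_T10 T10_smul T10_minus Yp Zp)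
  moreover have "deriv_form (conjf E) (bracket A (conjf E)) (bracket A E) h Y Z p = h p (\<Q> p (Y p)) (Z p) + c * h p (Y p) (Z p)"
    unfolding deriv_form_def D_h[OF conjf_E_CT Y Z p] lie_E_homogeneous[OF Z p] lie_conj_E[OF Y p]
    by (simp add: h_diff_right h_smul_right DZ Q_T10 T10_smul T10_minus Yp Zp conjv_conjf Q_h real_c)
  ultimately show ?thesis by simp
qed

text \<open>L and D along \<open>E\<close> differ by \<Q> and a scalar, both of which commute with
  \<Q>; along \<open>conjf E\<close> they agree anyway.\<close>

lemma E_derivatives_Q:
  assumes Y: "smooth_vf A W Y" and p: "p \<in> W"
  shows "deriv_endo (bracket A E) \<Q> Y p = UU p (Y p)" "deriv_endo (bracket A (conjf E)) \<Q> Y p = UU p (Y p)"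
    "deriv_endo (cov D E) \<Q> Y p = UU p (Y p)" "deriv_endo (cov D (conjf E)) \<Q> Y p = UU p (Y p)"
proof -
  note Yp = smooth_vf_T10[OF Y p] and QY = Q_smooth[OF Y]
  show 1: "deriv_endo (cov D E) \<Q> Y p = UU p (Y p)" "deriv_endo (cov D (conjf E)) \<Q> Y p = UU p (Y p)"
    using D_E_Q[OF Y p] D_conj_E_Q[OF Y p] by (simp_all add: deriv_endo_def cov_def)
  show "deriv_endo (bracket A (conjf E)) \<Q> Y p = UU p (Y p)"
    using D_conj_E_Q[OF Y p] by (simp add: deriv_endo_def lie_conj_E[OF Y p] lie_conj_E[OF QY p])
  have "deriv_endo (bracket A E) \<Q> Y p = D p (E p) (\<lambda>q. \<Q> q (Y q)) - \<Q> p (D p (E p) Y)"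
    unfolding deriv_endo_def lie_E_homogeneous[OF Y p] lie_E_homogeneous[OF QY p]
    by (simp add: Q_diff Q_smul Q_T10 T10_smul T10_minus Yp D_T10[OF Y p E_CT])
  then show "deriv_endo (bracket A E) \<Q> Y p = UU p (Y p)" using D_E_Q[OF Y p] by simp
qed

end

section \<open>Flows\<close>

lemma linear_growth_zero:
  fixes u :: "real \<Rightarrow> 'a::real_inner"
  assumes u: "\<And>s. s \<in> {a<..<b} \<Longrightarrow> (u has_vector_derivative u' s) (at s)"
    and K: "\<And>s. s \<in> {a<..<b} \<Longrightarrow> norm (u' s) \<le> K * norm (u s)"
    and s0: "s0 \<in> {a<..<b}" "u s0 = 0" and s: "s \<in> {a<..<b}"
  shows "u s = 0"
proof -
  \<comment> \<open>Gronwall weights: the square of the norm satisfies a growth bound with constant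
    2K in both time directions, and the exponential factor turns this bound into
    monotonicity.\<close>
  define G where "G c r = (u r \<bullet> u r) * exp (c * r)" for c r
  define G' where "G' c r = (2 * (u r \<bullet> u' r) + c * (u r \<bullet> u r)) * exp (c * r)" for c r
  have d: "(G c has_real_derivative G' c r) (at r)" if "r \<in> {a<..<b}" for c r
  proof -
    have "((\<lambda>r. u r \<bullet> u r) has_vector_derivative (u r \<bullet> u' r + u' r \<bullet> u r)) (at r)"
      by (rule bounded_bilinear.has_vector_derivative[OF bounded_bilinear_inner u[OF that] u[OF that]])
    then have "((\<lambda>r. u r \<bullet> u r) has_real_derivative (2 * (u r \<bullet> u' r))) (at r)"
      by (simp add: has_real_derivative_iff_has_vector_derivative inner_commute)
    then show ?thesis unfolding G_def G'_def
      by (auto intro!: derivative_eq_intros simp: algebra_simps)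
  qed
  have bnd: "\<bar>2 * (u r \<bullet> u' r)\<bar> \<le> 2 * K * (u r \<bullet> u r)" if "r \<in> {a<..<b}" for r
  proof -
    have "\<bar>u r \<bullet> u' r\<bar> \<le> norm (u r) * norm (u' r)" by (rule Cauchy_Schwarz_ineq2)
    also have "\<dots> \<le> norm (u r) * (K * norm (u r))" by (rule mult_left_mono[OF K[OF that]]) simp
    also have "\<dots> = K * (u r \<bullet> u r)" by (simp add: dot_square_norm power2_eq_square)
    finally show ?thesis by simp
  qed
  \<comment> \<open>The sign of the exponent depends on the side of \<open>s0\<close>, so that
    \<open>G c\<close> is never larger at \<open>s\<close> than at \<open>s0\<close>, where it is
    0.\<close>
  have "G c s \<le> 0" if c: "c = (if s0 \<le> s then - 2 * K else 2 * K)" for c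
  proof (cases "s0 \<le> s")
    case True
    have "G c s \<le> G c s0"
    proof (rule DERIV_nonpos_imp_nonincreasing[where f = "G c", OF True])
      fix r assume "s0 \<le> r" "r \<le> s"
      then have r: "r \<in> {a<..<b}" using s s0 by auto
      have "G' c r \<le> 0" unfolding G'_def using bnd[OF r] c True
        by (intro mult_nonpos_nonneg) (auto simp: abs_le_iff)
      then show "\<exists>y. (G c has_real_derivative y) (at r) \<and> y \<le> 0" using d[OF r] by blast
    qed
    then show ?thesis using s0(2) by (simp add: G_def)
  next
    case False
    have "G c s \<le> G c s0"
    proof (rule DERIV_nonneg_imp_nondecreasing[where f = "G c"])
      show "s \<le> s0" using False by simp
      fix r assume "s \<le> r" "r \<le> s0"
      then have r: "r \<in> {a<..<b}" using s s0 by auto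
      have "0 \<le> G' c r" unfolding G'_def using bnd[OF r] c False
        by (intro mult_nonneg_nonneg) (auto simp: abs_le_iff)
      then show "\<exists>y. (G c has_real_derivative y) (at r) \<and> 0 \<le> y" using d[OF r] by blast
    qed
    then show ?thesis using s0(2) by (simp add: G_def)
  qed
  then have "G (if s0 \<le> s then - 2 * K else 2 * K) s \<le> 0" by blast
  then have "u s \<bullet> u s \<le> 0" unfolding G_def by (simp add: mult_le_0_iff)
  then show ?thesis by (metis inner_ge_zero inner_eq_zero_iff order_antisym)
qed

text \<open>The components are bundled into one vector \<open>w\<close>; its derivative is bounded
  by n * n * K times its norm, with n the dimension, so the scalar growth estimate applies.\<close>

lemma linear_system_zero:
  fixes u :: "'n::finite \<Rightarrow> real \<Rightarrow> complex"
  assumes u: "\<And>i s. s \<in> {a<..<b} \<Longrightarrow> (u i has_vector_derivative (\<Sum>j\<in>UNIV. M i j s * u j s)) (at s)"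
    and K: "\<And>i j s. s \<in> {a<..<b} \<Longrightarrow> norm (M i j s) \<le> K"
    and s0: "s0 \<in> {a<..<b}" "\<And>i. u i s0 = 0" and s: "s \<in> {a<..<b}"
  shows "u i s = 0"
proof -
  define w :: "real \<Rightarrow> complex^'n" where "w r = (\<Sum>i\<in>UNIV. axis i (u i r))" for r
  have bl: "bounded_linear (axis i :: complex \<Rightarrow> complex^'n)" for i
    by (auto simp: axis_def vec_eq_iff intro!: linearI simp flip: linear_conv_bounded_linear)
  have nth: "(\<Sum>i\<in>UNIV. axis i (x i)) $ j = x j" for x :: "'n \<Rightarrow> complex" and j
    by (simp add: axis_def)
  have norm_axis: "norm (axis i x :: complex^'n) = norm x" for i x
    by (simp add: norm_vec_def L2_set_def axis_def if_distrib[where f = norm] if_distrib[where f = "\<lambda>x. x^2"] cong: if_cong)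
  have "w s = 0"
  proof (rule linear_growth_zero[OF _ _ s0(1) _ s])
    fix r assume r: "r \<in> {a<..<b}"
    show "(w has_vector_derivative (\<Sum>i\<in>UNIV. axis i (\<Sum>j\<in>UNIV. M i j r * u j r))) (at r)"
      unfolding w_def by (intro has_vector_derivative_sum bounded_linear.has_vector_derivative[OF bl] u r)
    have uw: "norm (u j r) \<le> norm (w r)" for j
      using Finite_Cartesian_Product.norm_nth_le[of "w r" j] unfolding w_def nth .
    have K0: "0 \<le> K" using order_trans[OF norm_ge_zero K[OF r]] by blast
    have "norm (\<Sum>i\<in>UNIV. axis i (\<Sum>j\<in>UNIV. M i j r * u j r) :: complex^'n) \<le> (\<Sum>i\<in>(UNIV::'n set). \<Sum>j\<in>(UNIV::'n set). K * norm (w r))"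
    proof (rule sum_norm_le)
      fix i :: 'n
      show "norm (axis i (\<Sum>j\<in>UNIV. M i j r * u j r) :: complex^'n) \<le> (\<Sum>j\<in>(UNIV::'n set). K * norm (w r))"
        unfolding norm_axis
      proof (rule sum_norm_le)
        fix j :: 'n
        show "norm (M i j r * u j r) \<le> K * norm (w r)"
          unfolding norm_mult by (rule mult_mono[OF K[OF r] uw K0]) simp
      qed
    qed
    then show "norm (\<Sum>i\<in>UNIV. axis i (\<Sum>j\<in>UNIV. M i j r * u j r) :: complex^'n) \<le> (real CARD('n) * real CARD('n) * K) * norm (w r)"
      by (simp add: mult_ac)
  qed (simp add: w_def s0 vec_eq_iff axis_def)
  then have "w s $ i = 0" by simp
  then show ?thesis unfolding w_def nth .
qed

context cmanifold
begin

lemma smooth_fun_continuous: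
  assumes "smooth_fun A W f" shows "continuous_on W f"
proof -
  have "\<exists>T. open T \<and> p \<in> T \<and> continuous_on T f" if p: "p \<in> W" for p
  proof -
    obtain U \<phi> where U: "(U,\<phi>) \<in> A" "p \<in> U" using chart_ex by blast
    have "continuous_on U \<phi>" using chart_homeo[OF U(1)] by (simp add: homeomorphism_def)
    then have c1: "continuous_on (U \<inter> W) \<phi>" by (rule continuous_on_subset) auto
    have "continuous_on (U \<inter> W) (\<lambda>q. f (inv_into U \<phi> (\<phi> q)))"
      by (rule continuous_on_compose2[OF Cinf_on_continuous[OF smooth_fun_Cinf[OF assms U(1)]] c1]) auto
    then have "continuous_on (U \<inter> W) f"
      by (rule continuous_on_eq) (use U in auto)
    then show ?thesis
      by (intro exI[of _ "U \<inter> W"]) (use p U chart_open[OF U(1)] smooth_fun_open[OF assms] in auto)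
  qed
  then have "isCont f p" if "p \<in> W" for p using that by (meson continuous_on_eq_continuous_at)
  then show ?thesis by (simp add: continuous_at_imp_continuous_on)
qed

end

section \<open>Transport of tangent vectors along a local flow\<close>

locale flow = cmanifold A for A :: "('m::{t2_space,second_countable_topology}, 'n::finite) atlas" +
  fixes \<xi> :: "'m cfield" and J :: "real set" and V :: "'m set" and \<Phi> :: "real \<Rightarrow> 'm \<Rightarrow> 'm"
  assumes vf: "smooth_cvf A UNIV \<xi>" and lf: "local_flow A \<xi> J V \<Phi>"
begin

lemma J_open: "open J" and J_connected: "connected J" and J0: "0 \<in> J" and V_open: "open V"
  and \<Phi>_cont: "continuous_on (J \<times> V) (\<lambda>(t, p). \<Phi> t p)" and \<Phi>0: "p \<in> V \<Longrightarrow> \<Phi> 0 p = p"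
  using lf unfolding local_flow_def by (auto simp: is_interval_connected)

lemmas lf_smooth = lf[unfolded local_flow_def, THEN conjunct2, THEN conjunct2, THEN conjunct2, THEN conjunct2, THEN conjunct2]

lemma \<Phi>_smooth:
  assumes "smooth_fun A W f" "(U,\<phi>) \<in> A"
  shows "Cinf_on (\<lambda>z. f (\<Phi> (fst z) (inv_into U \<phi> (snd z))))
    {z. fst z \<in> J \<and> snd z \<in> \<phi> ` (U \<inter> V) \<and> \<Phi> (fst z) (inv_into U \<phi> (snd z)) \<in> W}"
  using lf_smooth[THEN conjunct1, rule_format, OF assms] by (simp add: case_prod_unfold)

lemma \<Phi>_deriv:
  "p \<in> V \<Longrightarrow> t \<in> J \<Longrightarrow> smooth_near A (\<Phi> t p) f \<Longrightarrow>
   ((\<lambda>s. f (\<Phi> s p)) has_vector_derivative \<xi> (\<Phi> t p) f) (at t)"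
  using lf_smooth[THEN conjunct2, THEN conjunct2, rule_format, of p t f] by simp

lemma \<Phi>_domain_open:
  assumes "(U,\<phi>) \<in> A" "open W"
  shows "open {z. fst z \<in> J \<and> snd z \<in> \<phi> ` (U \<inter> V) \<and> \<Phi> (fst z) (inv_into U \<phi> (snd z)) \<in> W}"
proof -
  have "continuous_on (\<phi> ` U) (inv_into U \<phi>)" using chart_homeo[OF assms(1)] by (simp add: homeomorphism_def)
  then have c: "continuous_on (\<phi> ` (U \<inter> V)) (inv_into U \<phi>)" by (rule continuous_on_subset) auto
  have "continuous_on (J \<times> \<phi> ` (U \<inter> V)) (\<lambda>z. (\<lambda>(t, p). \<Phi> t p) (fst z, inv_into U \<phi> (snd z)))"
  proof (rule continuous_on_compose2[OF \<Phi>_cont])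
    show "continuous_on (J \<times> \<phi> ` (U \<inter> V)) (\<lambda>z. (fst z, inv_into U \<phi> (snd z)))"
      by (intro continuous_intros continuous_on_compose2[OF c]) auto
  qed (use assms in auto)
  then have "continuous_on (J \<times> \<phi> ` (U \<inter> V)) (\<lambda>z. \<Phi> (fst z) (inv_into U \<phi> (snd z)))" by simp
  from continuous_open_preimage[OF this open_Times[OF J_open chart_image_open[OF assms(1) V_open]] assms(2)]
  show ?thesis by (rule back_subst[where P = "open"]) auto
qed

lemma \<Phi>_time_cont: assumes "p \<in> V" shows "continuous_on J (\<lambda>s. \<Phi> s p)"
proof -
  have "continuous_on J (\<lambda>s. (\<lambda>(t, p). \<Phi> t p) (s, p))"
    by (rule continuous_on_compose2[OF \<Phi>_cont]) (use assms in \<open>auto intro!: continuous_intros\<close>)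
  then show ?thesis by simp
qed

lemma \<Phi>_space_cont: assumes "t \<in> J" shows "continuous_on V (\<Phi> t)"
proof -
  have "continuous_on V (\<lambda>q. (\<lambda>(t, p). \<Phi> t p) (t, q))"
    by (rule continuous_on_compose2[OF \<Phi>_cont]) (use assms in \<open>auto intro!: continuous_intros\<close>)
  then show ?thesis by simp
qed

lemma \<Phi>_preimage_open: assumes "t \<in> J" "open W" shows "open {q \<in> V. \<Phi> t q \<in> W}"
  using continuous_open_preimage[OF \<Phi>_space_cont[OF assms(1)] V_open assms(2)]
  by (rule back_subst[where P = "open"]) auto

lemma \<Phi>_time_preimage_open: assumes "p \<in> V" "open W" shows "open {s \<in> J. \<Phi> s p \<in> W}"
  using continuous_open_preimage[OF \<Phi>_time_cont[OF assms(1)] J_open assms(2)]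
  by (rule back_subst[where P = "open"]) auto

lemma pullback_smooth:
  assumes f: "smooth_fun A W f" and t: "t \<in> J"
  shows "smooth_fun A {q \<in> V. \<Phi> t q \<in> W} (\<lambda>q. f (\<Phi> t q))"
proof (rule smooth_funI[OF \<Phi>_preimage_open[OF t smooth_fun_open[OF f]]])
  fix U \<phi> assume U: "(U,\<phi>) \<in> A" and o: "open (\<phi> ` (U \<inter> {q \<in> V. \<Phi> t q \<in> W}))"
  let ?S = "{z. fst z \<in> J \<and> snd z \<in> \<phi> ` (U \<inter> V) \<and> \<Phi> (fst z) (inv_into U \<phi> (snd z)) \<in> W}"
  \<comment> \<open>The embedding of space at the fixed time \<open>t\<close>, written as a constant
    plus a bounded linear map so that its smoothness is immediate.\<close>
  let ?G = "\<lambda>x. (t, 0) + (0, x) :: real \<times> (complex^'n)"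
  have G: "Cinf_on ?G (\<phi> ` (U \<inter> {q \<in> V. \<Phi> t q \<in> W}))"
    by (intro Cinf_on_add o Cinf_on_const Cinf_on_bounded_linear bounded_linear_Pair bounded_linear_zero bounded_linear_ident)
  have "Cinf_on (\<lambda>x. (\<lambda>z. f (\<Phi> (fst z) (inv_into U \<phi> (snd z)))) (?G x)) (\<phi> ` (U \<inter> {q \<in> V. \<Phi> t q \<in> W}))"
    by (rule Cinf_on_compose[OF \<Phi>_domain_open[OF U smooth_fun_open[OF f]] o \<Phi>_smooth[OF f U] G])
       (use U t in auto)
  then show "Cinf_on (\<lambda>x. f (\<Phi> t (inv_into U \<phi> x))) (\<phi> ` (U \<inter> {q \<in> V. \<Phi> t q \<in> W}))" by simp
qed

lemma pullback_near:
  assumes "t \<in> J" "p \<in> V" "smooth_near A (\<Phi> t p) f" shows "smooth_near A p (\<lambda>q. f (\<Phi> t q))"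
proof -
  obtain W where W: "\<Phi> t p \<in> W" "smooth_fun A W f" using assms(3) by (auto simp: smooth_near_def)
  show ?thesis by (rule smooth_nearI[OF pullback_smooth[OF W(2) assms(1)]]) (use assms W in auto)
qed

abbreviation pf where "pf s p v \<equiv> pushforward A (\<Phi> s) p v"

lemma pf_smooth: "smooth_near A (\<Phi> s p) f \<Longrightarrow> pf s p v f = v (\<lambda>q. f (\<Phi> s q))"
  by (simp add: pushforward_def)

lemma pf_CT:
  assumes t: "t \<in> J" and p: "p \<in> V" and v: "v \<in> CT A p" shows "pf t p v \<in> CT A (\<Phi> t p)"
proof (rule CT_I)
  fix f g W assume fg: "smooth_near A (\<Phi> t p) f" "smooth_near A (\<Phi> t p) g" "open W" "\<Phi> t p \<in> W"
    "\<And>q. q \<in> W \<Longrightarrow> f q = g q"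
  have "v (\<lambda>q. f (\<Phi> t q)) = v (\<lambda>q. g (\<Phi> t q))"
    by (rule CT_cong[OF v \<Phi>_preimage_open[OF t fg(3)]]) (use p fg in auto)
  then show "pf t p v f = pf t p v g" using fg by (simp add: pf_smooth)
next
  fix f g assume f: "smooth_near A (\<Phi> t p) f" and g: "smooth_near A (\<Phi> t p) g"
  note f' = pullback_near[OF t p f] and g' = pullback_near[OF t p g]
  show "pf t p v (\<lambda>q. f q + g q) = pf t p v f + pf t p v g"
    using f g CT_add[OF v f' g'] by (simp add: pf_smooth smooth_near_add)
  show "pf t p v (\<lambda>q. f q * g q) = pf t p v f * g (\<Phi> t p) + f (\<Phi> t p) * pf t p v g"
    using f g CT_mult[OF v f' g'] by (simp add: pf_smooth smooth_near_mult)
next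
  fix c f assume f: "smooth_near A (\<Phi> t p) f"
  show "pf t p v (\<lambda>q. c * f q) = c * pf t p v f"
    using f CT_cmult[OF v pullback_near[OF t p f]] by (simp add: pf_smooth smooth_near_cmult)
qed (simp add: pushforward_def)

lemma pf_0: assumes p: "p \<in> V" and v: "v \<in> CT A p" shows "pf 0 p v = v"
proof
  fix f
  have "v (\<lambda>q. f (\<Phi> 0 q)) = v f" by (rule CT_cong[OF v V_open p]) (simp add: \<Phi>0)
  then show "pf 0 p v f = v f" using CT_zero[OF v] by (simp add: pushforward_def \<Phi>0[OF p])
qed

lemma pf_linear:
  "pf t p (v + w) = pf t p v + pf t p w" "pf t p (c *\<^sub>V v) = c *\<^sub>V pf t p v"
  by (auto simp: pushforward_def fun_eq_iff)

text \<open>Formally, the time derivative is moved past the vector \<open>v\<close> onto f, where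
  the flow equation turns it into \<xi> f. In coordinates \<open>v\<close> is a combination of
  spatial partial derivatives, so the exchange is the symmetry of mixed derivatives in time and
  space.\<close>

lemma pf_deriv:
  assumes t: "t \<in> J" and p: "p \<in> V" and v: "v \<in> CT A p" and f: "smooth_near A (\<Phi> t p) f"
  shows "((\<lambda>s. pf s p v f) has_vector_derivative pf t p v (\<lambda>q. \<xi> q f)) (at t)"
proof -
  obtain W where W: "\<Phi> t p \<in> W" "smooth_fun A W f" using f by (auto simp: smooth_near_def)
  obtain U \<phi> where U: "(U,\<phi>) \<in> A" "p \<in> U" using chart_ex by blast
  define x0 where "x0 = \<phi> p"
  define f' where "f' q = \<xi> q f" for q
  have f': "smooth_fun A W f'" unfolding f'_def by (rule smooth_cvf_fun[OF vf W(2)]) simp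
  define S where "S = {z. fst z \<in> J \<and> snd z \<in> \<phi> ` (U \<inter> V) \<and> \<Phi> (fst z) (inv_into U \<phi> (snd z)) \<in> W}"
  have S: "open S" unfolding S_def by (rule \<Phi>_domain_open[OF U(1) smooth_fun_open[OF W(2)]])
  define F where "F u z = u (\<Phi> (fst z) (inv_into U \<phi> (snd z)))" for u :: "'m \<Rightarrow> complex" and z
  have F: "Cinf_on (F u) S" if "smooth_fun A W u" for u
    unfolding F_def S_def by (rule \<Phi>_smooth[OF that U(1)])
  define I where "I = {s \<in> J. \<Phi> s p \<in> W}"
  have I: "open I" "t \<in> I" unfolding I_def using \<Phi>_time_preimage_open[OF p smooth_fun_open[OF W(2)]] W t by auto
  have IS: "(s, x0) \<in> S" if "s \<in> I" for s using that U p by (auto simp: S_def I_def x0_def)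
  \<comment> \<open>The real coordinates of \<open>v\<close>, which do not depend on the time
    \<open>s\<close>; time enters only through \<open>F\<close>.\<close>
  define c where "c b = v (\<lambda>q. complex_of_real (\<phi> q \<bullet> b))" for b
  have space: "frechet_derivative (\<lambda>x. F u (s, x)) (at x0) b = frechet_derivative (F u) (at (s, x0)) (0, b)"
    if "smooth_fun A W u" "s \<in> I" for u s b
  proof -
    have "((\<lambda>x. (s, x)) has_derivative (\<lambda>y. (0, y))) (at x0)" by (auto intro!: derivative_eq_intros)
    from diff_chain_at[OF this Cinf_on_has_derivative[OF F[OF that(1)] IS[OF that(2)]]]
    have "((\<lambda>x. F u (s, x)) has_derivative (\<lambda>y. frechet_derivative (F u) (at (s, x0)) (0, y))) (at x0)"
      by (simp add: o_def)
    from frechet_derivative_eqI[OF this] show ?thesis by metis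
  qed
  have time: "((\<lambda>s. H (s, x)) has_vector_derivative frechet_derivative H (at (s, x)) (1, 0)) (at s)"
    if H: "Cinf_on H S" "(s, x) \<in> S" for H :: "real \<times> (complex^'n) \<Rightarrow> complex" and s x
  proof -
    have "((\<lambda>s. (s, x)) has_derivative (\<lambda>y. (y, 0))) (at s)" by (auto intro!: derivative_eq_intros)
    from diff_chain_at[OF this Cinf_on_has_derivative[OF H]]
    have "((\<lambda>s. H (s, x)) has_derivative (\<lambda>y. frechet_derivative H (at (s, x)) (y *\<^sub>R (1, 0)))) (at s)"
      by (simp add: o_def)
    then show ?thesis
      unfolding linear_scale[OF Cinf_on_linear_frechet[OF H]] has_vector_derivative_def .
  qed
  have expand: "pf s p v u = (\<Sum>b\<in>Basis. c b * frechet_derivative (F u) (at (s, x0)) (0, b))"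
    if u: "smooth_fun A W u" and s: "s \<in> I" for u s
  proof -
    have sn: "smooth_near A (\<Phi> s p) u" by (rule smooth_nearI[OF u]) (use s in \<open>simp add: I_def\<close>)
    have "pf s p v u = (\<Sum>b\<in>Basis. c b * frechet_derivative (\<lambda>x. u (\<Phi> s (inv_into U \<phi> x))) (at (\<phi> p)) b)"
      unfolding pf_smooth[OF sn] c_def
      by (rule CT_real_expand[OF v U pullback_near[OF _ p sn]]) (use s in \<open>simp add: I_def\<close>)
    also have "\<dots> = (\<Sum>b\<in>Basis. c b * frechet_derivative (F u) (at (s, x0)) (0, b))"
      using space[OF u s] by (simp add: F_def x0_def)
    finally show ?thesis .
  qed
  \<comment> \<open>The flow equation on the whole domain \<open>S\<close>. It has to hold on an
    open set, since it is differentiated in space next.\<close>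
  have Ff': "F f' z = frechet_derivative (F f) (at z) (1, 0)" if z: "z \<in> S" for z
  proof -
    obtain s x where sx: "z = (s, x)" by (cases z)
    obtain q where q: "q \<in> U" "q \<in> V" "x = \<phi> q" "s \<in> J" "\<Phi> s q \<in> W" using z U(1) by (auto simp: S_def sx)
    have "((\<lambda>s. F f (s, x)) has_vector_derivative \<xi> (\<Phi> s q) f) (at s)"
      using \<Phi>_deriv[OF q(2,4) smooth_nearI[OF W(2) q(5)]] U(1) q by (simp add: F_def)
    from vector_derivative_unique_at[OF this time[OF F[OF W(2)] z[unfolded sx]]]
    show ?thesis using U(1) q by (simp add: sx F_def f'_def)
  qed
  have "frechet_derivative (F f') (at (t, x0)) = frechet_derivative (\<lambda>z. frechet_derivative (F f) (at z) (1, 0)) (at (t, x0))"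
    by (rule differentiable_cong_open(2)[OF S IS[OF I(2)] _ Cinf_on_differentiable[OF F[OF f'] IS[OF I(2)]], symmetric])
       (rule Ff')
  then have mixed: "frechet_derivative (F f') (at (t, x0)) (0, b) =
      frechet_derivative (\<lambda>z. frechet_derivative (F f) (at z) (0, b)) (at (t, x0)) (1, 0)" for b
    by (simp only: second_derivative_symmetric[OF F[OF W(2)] S IS[OF I(2)], of "(1, 0)" "(0, b)"])
  have "((\<lambda>s. \<Sum>b\<in>Basis. c b * frechet_derivative (F f) (at (s, x0)) (0, b)) has_vector_derivative
      (\<Sum>b\<in>Basis. c b * frechet_derivative (F f') (at (t, x0)) (0, b))) (at t)"
    unfolding mixed
    by (intro has_vector_derivative_sum bounded_linear.has_vector_derivative[OF bounded_linear_mult_right]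
        time[OF Cinf_on_frechet[OF F[OF W(2)]] IS[OF I(2)]])
  then have "((\<lambda>s. \<Sum>b\<in>Basis. c b * frechet_derivative (F f) (at (s, x0)) (0, b)) has_vector_derivative
      pf t p v f') (at t)"
    unfolding expand[OF f' I(2)] .
  then have "((\<lambda>s. pf s p v f) has_vector_derivative pf t p v f') (at t)"
    by (rule has_vector_derivative_transform_within_open[OF _ I]) (rule expand[OF W(2), symmetric])
  moreover have "f' = (\<lambda>q. \<xi> q f)" by (rule ext) (rule f'_def)
  ultimately show ?thesis by simp
qed

end

text \<open>E minus its conjugate is purely imaginary as a complexified field; the factor \<i> makes
  it real, so that it can have a flow on the manifold.\<close>

definition i_minus_conj :: "'m cfield \<Rightarrow> 'm cfield" where
  "i_minus_conj E = (\<lambda>p. \<i> *\<^sub>V (E p - conjf E p))"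

lemma i_minus_conj_apply: "i_minus_conj E p f = \<i> * (E p f - conjf E p f)"
  by (simp add: i_minus_conj_def)

context cmanifold
begin

lemma i_minus_conj_smooth:
  assumes E: "hol_vf A W E" shows "smooth_cvf A W (i_minus_conj E)"
proof -
  note Es = smooth_vf_cvf[OF hol_imp_smooth_vf[OF E]]
  note o = hol_vf_open[OF E]
  have "smooth_cvf A W (\<lambda>p. \<i> *\<^sub>V (E p + (-1) *\<^sub>V conjf E p))"
    by (intro smooth_cvf_smul smooth_cvf_add smooth_fun_const o Es smooth_cvf_conjf)
  then show ?thesis by (rule smooth_cvf_cong) (simp add: i_minus_conj_def smul_distribs)
qed

text \<open>\<open>E\<close> kills the conjugate of a holomorphic function, and the conjugate field
  maps it to the conjugate of a holomorphic function. Conjugate coordinates thus stay among such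
  functions.\<close>

lemma i_minus_conj_cnj:
  assumes E: "hol_vf A W E" "q \<in> W" and f: "hol_near A q f"
  shows "i_minus_conj E q (\<lambda>r. cnj (f r)) = - \<i> * cnj (E q f)"
  using T10_cnj[OF hol_vf_T10[OF E] f] by (simp add: i_minus_conj_apply conjf_def conjv_def)

lemma bracket_i_minus_conj:
  assumes E: "hol_vf A W E" and Y: "smooth_vf A W Y" and p: "p \<in> W"
  shows "bracket A (i_minus_conj E) Y p = \<i> *\<^sub>V (bracket A E Y p - bracket A (conjf E) Y p)"
proof
  fix f
  note Es = smooth_vf_cvf[OF hol_imp_smooth_vf[OF E]]
  note Yp = smooth_cvf_CT[OF smooth_vf_cvf[OF Y] p]
  show "bracket A (i_minus_conj E) Y p f = (\<i> *\<^sub>V (bracket A E Y p - bracket A (conjf E) Y p)) f"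
  proof (cases "smooth_near A p f")
    case True
    note s = smooth_cvf_near[OF Es p True] and s' = smooth_cvf_near[OF smooth_cvf_conjf[OF Es] p True]
    have sd: "smooth_near A p (\<lambda>q. E q f - conjf E q f)"
      using smooth_near_add[OF s smooth_near_cmult[OF s', of "-1"]] by simp
    have "Y p (\<lambda>q. i_minus_conj E q f) = \<i> * (Y p (\<lambda>q. E q f) - Y p (\<lambda>q. conjf E q f))"
      unfolding i_minus_conj_apply CT_cmult[OF Yp sd] CT_diff[OF Yp s s'] ..
    then show ?thesis using True by (simp add: bracket_smooth i_minus_conj_apply algebra_simps)
  qed (simp add: bracket_def)
qed

lemma bracket_i_minus_conj_T10:
  assumes E: "hol_vf A W E" and Y: "smooth_vf A W Y" and p: "p \<in> W"
  shows "bracket A (i_minus_conj E) Y p \<in> T10 A p"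
  unfolding bracket_i_minus_conj[OF assms]
  by (intro T10_smul T10_minus bracket_T10[OF hol_imp_smooth_vf[OF E] Y p] bracket_conjf_T10[OF E Y p])

text \<open>The coordinates of a coordinate field are constant, so the first half of the bracket
  vanishes on coordinates and only derivatives of the components of the flow field remain.\<close>

lemma bracket_i_minus_conj_coord:
  assumes E: "hol_vf A UNIV E" and U: "(U,\<phi>) \<in> A" "q \<in> U"
  shows "bracket A (i_minus_conj E) (pz U \<phi> k) q =
    (\<Sum>i\<in>UNIV. (- pz U \<phi> k q (\<lambda>r. i_minus_conj E r (\<lambda>r. \<phi> r $ i))) *\<^sub>V pz U \<phi> i q)"
proof -
  have EU: "hol_vf A U E" by (rule hol_vf_subset[OF E chart_open(1)[OF U(1)]]) simp
  note \<xi>q = smooth_cvf_CT[OF i_minus_conj_smooth[OF EU] U(2)]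
  have coord: "bracket A (i_minus_conj E) (pz U \<phi> k) q (\<lambda>r. \<phi> r $ i) = - pz U \<phi> k q (\<lambda>r. i_minus_conj E r (\<lambda>r. \<phi> r $ i))" for i
  proof -
    have "i_minus_conj E q (\<lambda>r. pz U \<phi> k r (\<lambda>r. \<phi> r $ i)) = i_minus_conj E q (\<lambda>r. if k = i then 1 else 0)"
      by (rule CT_cong[OF \<xi>q chart_open(1)[OF U(1)] U(2)]) (rule pz_coord[OF U(1)])
    then show ?thesis using CT_const[OF \<xi>q] by (simp add: bracket_smooth smooth_near_coord[OF U])
  qed
  show ?thesis
    by (subst T10_expand[OF bracket_i_minus_conj_T10[OF EU pz_smooth_vf[OF U(1)] U(2)] U]) (simp only: coord)
qed

end

section \<open>Transport along the flow of the real field made from \<open>E\<close>\<close>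

locale hol_flow = cmanifold A for A :: "('m::{t2_space,second_countable_topology}, 'n::finite) atlas" +
  fixes E :: "'m cfield" and J :: "real set" and V :: "'m set" and \<Phi> :: "real \<Rightarrow> 'm \<Rightarrow> 'm"
  assumes E_hol: "hol_vf A UNIV E" and lf: "local_flow A (i_minus_conj E) J V \<Phi>"

sublocale hol_flow \<subseteq> flow A "i_minus_conj E"
  by unfold_locales (rule i_minus_conj_smooth[OF E_hol], rule lf)

context hol_flow
begin

text \<open>In a chart, the (0,1)-components of a transported vector solve a linear system of differential
  equations, so they vanish identically if they vanish once.\<close>

lemma pf_T10_local:
  assumes t: "t \<in> J" and p: "p \<in> V" and v: "v \<in> CT A p"
  shows "\<exists>T. open T \<and> t \<in> T \<and> T \<subseteq> J \<and>
    (\<forall>s\<in>T. \<forall>s'\<in>T. pf s p v \<in> T10 A (\<Phi> s p) \<longrightarrow> pf s' p v \<in> T10 A (\<Phi> s' p))"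
proof -
  obtain U \<phi> where U: "(U,\<phi>) \<in> A" "\<Phi> t p \<in> U" using chart_ex by blast
  note oU = chart_open(1)[OF U(1)]
  define I where "I = {s \<in> J. \<Phi> s p \<in> U}"
  have "open I" "t \<in> I" unfolding I_def using \<Phi>_time_preimage_open[OF p oU] t U by auto
  \<comment> \<open>A closed ball, because the coefficients of the linear system are bounded by
    compactness.\<close>
  then obtain \<epsilon> where \<epsilon>: "\<epsilon> > 0" "cball t \<epsilon> \<subseteq> I" using open_contains_cball by blast
  define w where "w i q = E q (\<lambda>r. \<phi> r $ i)" for i q
  have w: "hol_fun A U (w i)" for i
    unfolding w_def by (rule hol_vf_fun[OF E_hol hol_fun_coord[OF U(1)]]) simp
  \<comment> \<open>Conjugated derivatives of the components of \<open>E\<close> along the orbit;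
    the factor - \<i> comes from \<open>i_minus_conj_cnj\<close>.\<close>
  define M where "M i j s = - \<i> * cnj (pz U \<phi> j (\<Phi> s p) (w i))" for i j s
  have "continuous_on U (\<lambda>q. pz U \<phi> j q (w i))" for i j
    by (rule smooth_fun_continuous[OF hol_imp_smooth[OF pz_hol_fun[OF U(1) w order_refl]]])
  moreover have "continuous_on (cball t \<epsilon>) (\<lambda>s. \<Phi> s p)"
    by (rule continuous_on_subset[OF \<Phi>_time_cont[OF p]]) (use \<epsilon> in \<open>auto simp: I_def\<close>)
  ultimately have "continuous_on (cball t \<epsilon>) (\<lambda>s. pz U \<phi> j (\<Phi> s p) (w i))" for i j
    by (rule continuous_on_compose2[where t = U]) (use \<epsilon> in \<open>auto simp: I_def\<close>)
  then have "continuous_on (cball t \<epsilon>) (\<lambda>s. \<Sum>i\<in>UNIV. \<Sum>j\<in>UNIV. norm (M i j s))"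
    unfolding M_def by (intro continuous_intros continuous_on_cnj)
  then have "bounded ((\<lambda>s. \<Sum>i\<in>UNIV. \<Sum>j\<in>UNIV. norm (M i j s)) ` cball t \<epsilon>)"
    by (intro compact_imp_bounded compact_continuous_image) auto
  then obtain K where K: "\<And>s. s \<in> cball t \<epsilon> \<Longrightarrow> norm (\<Sum>i\<in>UNIV. \<Sum>j\<in>UNIV. norm (M i j s)) \<le> K"
    unfolding bounded_iff by blast
  have MK: "norm (M i j s) \<le> K" if "s \<in> cball t \<epsilon>" for i j s
  proof -
    have "norm (M i j s) \<le> (\<Sum>j\<in>UNIV. norm (M i j s))" by (rule member_le_sum) auto
    also have "\<dots> \<le> (\<Sum>i\<in>UNIV. \<Sum>j\<in>UNIV. norm (M i j s))"
      by (rule member_le_sum[where f = "\<lambda>i. \<Sum>j\<in>UNIV. norm (M i j s)"]) (auto intro: sum_nonneg)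
    also have "\<dots> \<le> K" using K[OF that] by simp
    finally show ?thesis .
  qed
  define u where "u i s = pf s p v (\<lambda>q. cnj (\<phi> q $ i))" for i s
  have T10_u: "pf s p v \<in> T10 A (\<Phi> s p) \<longleftrightarrow> (\<forall>i. u i s = 0)" if "s \<in> I" for s
    unfolding u_def by (rule T10_iff_coord[OF pf_CT[OF _ p v] U(1)]) (use that in \<open>auto simp: I_def\<close>)
  have u': "(u i has_vector_derivative (\<Sum>j\<in>UNIV. M i j s * u j s)) (at s)" if s: "s \<in> I" for i s
  proof -
    have sJ: "s \<in> J" and sU: "\<Phi> s p \<in> U" using s by (auto simp: I_def)
    note vs = pf_CT[OF sJ p v]
    have wn: "hol_near A (\<Phi> s p) (w i)" by (rule hol_nearI[OF w sU])
    have "(u i has_vector_derivative pf s p v (\<lambda>q. i_minus_conj E q (\<lambda>q. cnj (\<phi> q $ i)))) (at s)"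
      unfolding u_def by (rule pf_deriv[OF sJ p v smooth_near_cnj[OF smooth_near_coord[OF U(1) sU]]])
    also have "pf s p v (\<lambda>q. i_minus_conj E q (\<lambda>q. cnj (\<phi> q $ i))) = pf s p v (\<lambda>q. - \<i> * cnj (w i q))"
      unfolding w_def
      by (rule CT_cong[OF vs oU sU])
         (rule i_minus_conj_cnj[OF E_hol UNIV_I], rule hol_nearI[OF hol_fun_coord[OF U(1)]])
    also have "\<dots> = - \<i> * pf s p v (\<lambda>q. cnj (w i q))"
      by (rule CT_cmult[OF vs smooth_near_cnj[OF hol_near_smooth[OF wn]]])
    \<comment> \<open>Here the system closes up: \<open>w i\<close> is holomorphic, so its conjugate
      is seen only by the (0,1)-components of the transported vector, which are the unknowns
      \<open>u\<close>.\<close>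
    also have "pf s p v (\<lambda>q. cnj (w i q)) = (\<Sum>j\<in>UNIV. u j s * cnj (pz U \<phi> j (\<Phi> s p) (w i)))"
      using CT_expand[OF vs U(1) sU, of "\<lambda>q. cnj (w i q)"] pz_cnj_hol[OF U(1) sU wn]
      by (simp add: u_def conjv_def)
    also have "- \<i> * \<dots> = (\<Sum>j\<in>UNIV. M i j s * u j s)"
      by (simp add: M_def sum_distrib_left mult_ac)
    finally show ?thesis .
  qed
  have sub: "{t - \<epsilon> <..< t + \<epsilon>} \<subseteq> cball t \<epsilon>" by (auto simp: dist_real_def)
  show ?thesis
  proof (intro exI[of _ "{t - \<epsilon> <..< t + \<epsilon>}"] conjI ballI impI)
    show "{t - \<epsilon> <..< t + \<epsilon>} \<subseteq> J" using sub \<epsilon> by (auto simp: I_def)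
    fix s s' assume s: "s \<in> {t - \<epsilon> <..< t + \<epsilon>}" "s' \<in> {t - \<epsilon> <..< t + \<epsilon>}" and "pf s p v \<in> T10 A (\<Phi> s p)"
    then have us: "u i s = 0" for i using T10_u[of s] sub \<epsilon>(2) by (simp add: subset_iff)
    have "u i s' = 0" for i
    proof (rule linear_system_zero[where M = M and u = u, OF _ _ s(1) us s(2)])
      fix i r assume "r \<in> {t - \<epsilon> <..< t + \<epsilon>}"
      then show "(u i has_vector_derivative (\<Sum>j\<in>UNIV. M i j r * u j r)) (at r)"
        by (intro u') (rule subsetD[OF \<epsilon>(2) subsetD[OF sub]])
    next
      fix i j r assume "r \<in> {t - \<epsilon> <..< t + \<epsilon>}"
      then show "norm (M i j r) \<le> K" by (intro MK) (rule subsetD[OF sub])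
    qed
    then show "pf s' p v \<in> T10 A (\<Phi> s' p)" using T10_u[of s'] sub \<epsilon>(2) s(2) by (simp add: subset_iff)
  qed (use \<epsilon> in auto)
qed

text \<open>The property holds at time 0, and by \<open>pf_T10_local\<close> it is constant near
  every time; connectedness of \<open>J\<close> spreads it.\<close>

lemma pf_T10:
  assumes t: "t \<in> J" and p: "p \<in> V" and v: "v \<in> T10 A p"
  shows "pf t p v \<in> T10 A (\<Phi> t p)"
proof (rule connected_induction_simple[OF J_connected J0 t])
  show "pf 0 p v \<in> T10 A (\<Phi> 0 p)" using pf_0[OF p T10_CT[OF v]] v \<Phi>0[OF p] by simp
  fix a assume "a \<in> J"
  from pf_T10_local[OF this p T10_CT[OF v]] obtain T where T: "open T" "a \<in> T" "T \<subseteq> J"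
    "\<forall>s\<in>T. \<forall>s'\<in>T. pf s p v \<in> T10 A (\<Phi> s p) \<longrightarrow> pf s' p v \<in> T10 A (\<Phi> s' p)" by blast
  then show "\<exists>T. openin (top_of_set J) T \<and> a \<in> T \<and>
      (\<forall>x\<in>T. \<forall>y\<in>T. pf x p v \<in> T10 A (\<Phi> x p) \<longrightarrow> pf y p v \<in> T10 A (\<Phi> y p))"
    by (intro exI[of _ T]) (auto intro: open_subset)
qed

end

text \<open>Index bookkeeping for \<open>form_invariant\<close>: \<open>B\<close> are the
  coefficients of the form, \<open>X\<close> their derivatives along the flow, \<open>M\<close> and
  \<open>N\<close> the matrices transporting the components \<open>x\<close> and \<open>y\<close>.
  After interchanging sums the transport terms are the negatives of the two parts of
  \<open>X\<close>.\<close>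

lemma flow_sum_identity:
  fixes x y :: "'n::finite \<Rightarrow> complex"
  assumes "\<And>k l. X k l = (\<Sum>i\<in>UNIV. - M k i * B i l) + (\<Sum>j\<in>UNIV. - N l j * B k j)"
  shows "(\<Sum>i\<in>UNIV. \<Sum>j\<in>UNIV. (\<Sum>k\<in>UNIV. x k * M k i) * y j * B i j + x i * (\<Sum>l\<in>UNIV. y l * N l j) * B i j
    + x i * y j * X i j) = 0"
proof -
  have 1: "(\<Sum>i\<in>UNIV. \<Sum>j\<in>UNIV. (\<Sum>k\<in>UNIV. x k * M k i) * y j * B i j) = (\<Sum>k\<in>UNIV. \<Sum>j\<in>UNIV. x k * y j * (\<Sum>i\<in>UNIV. M k i * B i j))"
  proof -
    have "(\<Sum>i\<in>UNIV. \<Sum>j\<in>UNIV. (\<Sum>k\<in>UNIV. x k * M k i) * y j * B i j) = (\<Sum>i\<in>UNIV. \<Sum>j\<in>UNIV. \<Sum>k\<in>UNIV. x k * y j * (M k i * B i j))"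
      by (simp add: sum_distrib_right sum_distrib_left mult_ac)
    also have "\<dots> = (\<Sum>i\<in>UNIV. \<Sum>k\<in>UNIV. \<Sum>j\<in>UNIV. x k * y j * (M k i * B i j))"
      by (rule sum.cong[OF refl]) (rule sum.swap)
    also have "\<dots> = (\<Sum>k\<in>UNIV. \<Sum>i\<in>UNIV. \<Sum>j\<in>UNIV. x k * y j * (M k i * B i j))" by (rule sum.swap)
    also have "\<dots> = (\<Sum>k\<in>UNIV. \<Sum>j\<in>UNIV. \<Sum>i\<in>UNIV. x k * y j * (M k i * B i j))"
      by (rule sum.cong[OF refl]) (rule sum.swap)
    finally show ?thesis by (simp add: sum_distrib_left)
  qed
  have 2: "(\<Sum>i\<in>UNIV. \<Sum>j\<in>UNIV. x i * (\<Sum>l\<in>UNIV. y l * N l j) * B i j) = (\<Sum>i\<in>UNIV. \<Sum>l\<in>UNIV. x i * y l * (\<Sum>j\<in>UNIV. N l j * B i j))"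
  proof (rule sum.cong[OF refl])
    fix i
    have "(\<Sum>j\<in>UNIV. x i * (\<Sum>l\<in>UNIV. y l * N l j) * B i j) = (\<Sum>j\<in>UNIV. \<Sum>l\<in>UNIV. x i * y l * (N l j * B i j))"
      by (simp add: sum_distrib_right sum_distrib_left mult_ac)
    also have "\<dots> = (\<Sum>l\<in>UNIV. \<Sum>j\<in>UNIV. x i * y l * (N l j * B i j))" by (rule sum.swap)
    finally show "(\<Sum>j\<in>UNIV. x i * (\<Sum>l\<in>UNIV. y l * N l j) * B i j) = (\<Sum>l\<in>UNIV. x i * y l * (\<Sum>j\<in>UNIV. N l j * B i j))"
      by (simp add: sum_distrib_left)
  qed
  have 3: "(\<Sum>i\<in>UNIV. \<Sum>j\<in>UNIV. x i * y j * X i j) =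
      - (\<Sum>i\<in>UNIV. \<Sum>j\<in>UNIV. x i * y j * (\<Sum>k\<in>UNIV. M i k * B k j)) - (\<Sum>i\<in>UNIV. \<Sum>j\<in>UNIV. x i * y j * (\<Sum>k\<in>UNIV. N j k * B i k))"
    unfolding assms by (simp add: sum_negf sum.distrib[symmetric] sum_subtractf[symmetric] algebra_simps)
  show ?thesis unfolding sum.distrib 1 2 3 by simp
qed

context hol_flow
begin

text \<open>In a chart, the derivative of the transported values of a form is the Lie derivative of the form.\<close>

lemma form_invariant:
  fixes b :: "'m \<Rightarrow> 'm cvec \<Rightarrow> 'm cvec \<Rightarrow> complex"
  assumes lin: "\<And>q x y z c. x \<in> T10 A q \<Longrightarrow> y \<in> T10 A q \<Longrightarrow> z \<in> T10 A q \<Longrightarrow>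
      b q (x + y) z = b q x z + b q y z \<and> b q (c *\<^sub>V x) z = c * b q x z \<and>
      b q z (x + y) = b q z x + b q z y \<and> b q z (c *\<^sub>V x) = cnj c * b q z x"
    and smooth: "\<And>U \<phi> i j. (U,\<phi>) \<in> A \<Longrightarrow> smooth_fun A U (\<lambda>q. b q (pz U \<phi> i q) (pz U \<phi> j q))"
    and inv: "\<And>U \<phi> i j q. (U,\<phi>) \<in> A \<Longrightarrow> q \<in> U \<Longrightarrow> i_minus_conj E q (\<lambda>r. b r (pz U \<phi> i r) (pz U \<phi> j r)) =
      b q (bracket A (i_minus_conj E) (pz U \<phi> i) q) (pz U \<phi> j q) + b q (pz U \<phi> i q) (bracket A (i_minus_conj E) (pz U \<phi> j) q)"
    and t: "t \<in> J" and p: "p \<in> V" and v: "v \<in> T10 A p" and w: "w \<in> T10 A p"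
  shows "b (\<Phi> t p) (pf t p v) (pf t p w) = b p v w"
proof -
  have b0: "b q 0 z = 0" "b q z 0 = 0" if "z \<in> T10 A q" for q z
    using lin[OF T10_zero T10_zero that, of 0] by (simp_all add: smul_distribs)
  have sum_left: "b q (\<Sum>i\<in>I. c i *\<^sub>V F i) z = (\<Sum>i\<in>I. c i * b q (F i) z)"
    if z: "z \<in> T10 A q" and F: "\<And>i. F i \<in> T10 A q" and I: "finite I" for q z c F and I :: "'n set"
    using I
  proof (induction I rule: finite_induct)
    case (insert i I)
    have "b q (c i *\<^sub>V F i + (\<Sum>i\<in>I. c i *\<^sub>V F i)) z = b q (c i *\<^sub>V F i) z + b q (\<Sum>i\<in>I. c i *\<^sub>V F i) z"
      by (rule lin[OF T10_smul[OF F] T10_sum[OF T10_smul[OF F]] z, THEN conjunct1])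
    then show ?case
      using lin[OF F F z, of _ i "c i"] by (simp only: sum.insert[OF insert(1,2)] insert.IH)
  qed (simp only: sum.empty b0(1)[OF z])
  have sum_right: "b q z (\<Sum>i\<in>I. c i *\<^sub>V F i) = (\<Sum>i\<in>I. cnj (c i) * b q z (F i))"
    if z: "z \<in> T10 A q" and F: "\<And>i. F i \<in> T10 A q" and I: "finite I" for q z c F and I :: "'n set"
    using I
  proof (induction I rule: finite_induct)
    case (insert i I)
    have "b q z (c i *\<^sub>V F i + (\<Sum>i\<in>I. c i *\<^sub>V F i)) = b q z (c i *\<^sub>V F i) + b q z (\<Sum>i\<in>I. c i *\<^sub>V F i)"
      by (rule lin[OF T10_smul[OF F] T10_sum[OF T10_smul[OF F]] z, THEN conjunct2, THEN conjunct2, THEN conjunct1])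
    then show ?case
      using lin[OF F F z, of _ i "c i"] by (simp only: sum.insert[OF insert(1,2)] insert.IH)
  qed (simp only: sum.empty b0(2)[OF z])
  \<comment> \<open>The claim is that this function of time is constant; its derivative is computed
    around each time in a chart containing the moving point.\<close>
  define \<beta> where "\<beta> s = b (\<Phi> s p) (pf s p v) (pf s p w)" for s
  have "(\<beta> has_derivative (\<lambda>x. 0)) (at t0)" if t0: "t0 \<in> J" for t0
  proof -
    obtain U \<phi> where U: "(U,\<phi>) \<in> A" "\<Phi> t0 p \<in> U" using chart_ex by blast
    note oU = chart_open(1)[OF U(1)]
    define I where "I = {s \<in> J. \<Phi> s p \<in> U}"
    have I: "open I" "t0 \<in> I" unfolding I_def using \<Phi>_time_preimage_open[OF p oU] t0 U by auto
    define z where "z i = (\<lambda>r. \<phi> r $ i)" for i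
    define x where "x i s = pf s p v (z i)" for i s
    define y where "y i s = pf s p w (z i)" for i s
    define B where "B i j q = b q (pz U \<phi> i q) (pz U \<phi> j q)" for i j q
    define M where "M k i = pz U \<phi> k (\<Phi> t0 p) (\<lambda>q. i_minus_conj E q (z i))" for k i
    \<comment> \<open>The coordinate expression of \<beta>. The components \<open>y\<close> are
      conjugated since \<open>b\<close> is conjugate linear in its second argument.\<close>
    let ?\<gamma> = "\<lambda>s. \<Sum>i\<in>UNIV. \<Sum>j\<in>UNIV. x i s * cnj (y j s) * B i j (\<Phi> s p)"
    have \<beta>: "\<beta> s = ?\<gamma> s" if s: "s \<in> I" for s
    proof -
      have sJ: "s \<in> J" and sU: "\<Phi> s p \<in> U" using s by (auto simp: I_def)
      note vs = pf_T10[OF sJ p v] and ws = pf_T10[OF sJ p w]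
      note zs = pz_T10[OF U(1) sU]
      have 1: "pf s p v = (\<Sum>i\<in>UNIV. x i s *\<^sub>V pz U \<phi> i (\<Phi> s p))" "pf s p w = (\<Sum>i\<in>UNIV. y i s *\<^sub>V pz U \<phi> i (\<Phi> s p))"
        unfolding x_def y_def z_def by (rule T10_expand[OF vs U(1) sU], rule T10_expand[OF ws U(1) sU])
      show ?thesis
        unfolding \<beta>_def 1
        by (simp only: sum_left[OF T10_sum[OF T10_smul[OF zs]] zs finite] sum_right[OF zs zs finite])
           (simp add: B_def sum_distrib_left mult_ac)
    qed
    have coord_deriv: "((\<lambda>s. pf s p u (z i)) has_vector_derivative (\<Sum>k\<in>UNIV. pf t0 p u (z k) * M k i)) (at t0)"
      if u: "u \<in> T10 A p" for u i
    proof -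
      have zi: "smooth_near A (\<Phi> t0 p) (z i)" unfolding z_def by (rule smooth_near_coord[OF U])
      have "pf t0 p u (\<lambda>q. i_minus_conj E q (z i)) = (\<Sum>k\<in>UNIV. pf t0 p u (z k) *\<^sub>V pz U \<phi> k (\<Phi> t0 p)) (\<lambda>q. i_minus_conj E q (z i))"
        unfolding z_def by (rule fun_cong[OF T10_expand[OF pf_T10[OF t0 p u] U]])
      then show ?thesis using pf_deriv[OF t0 p T10_CT[OF u] zi] by (simp add: M_def)
    qed
    have x': "(x i has_vector_derivative (\<Sum>k\<in>UNIV. x k t0 * M k i)) (at t0)" for i
      using coord_deriv[OF v] unfolding x_def .
    have y': "((\<lambda>s. cnj (y i s)) has_vector_derivative (\<Sum>k\<in>UNIV. cnj (y k t0) * cnj (M k i))) (at t0)" for i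
      using has_vector_derivative_cnj[OF coord_deriv[OF w]] unfolding y_def by simp
    have B': "((\<lambda>s. B i j (\<Phi> s p)) has_vector_derivative i_minus_conj E (\<Phi> t0 p) (B i j)) (at t0)" for i j
      by (rule \<Phi>_deriv[OF p t0 smooth_nearI[OF _ U(2)]]) (use smooth[OF U(1)] in \<open>simp add: B_def\<close>)
    have "(?\<gamma> has_vector_derivative (\<Sum>i\<in>UNIV. \<Sum>j\<in>UNIV.
        (\<Sum>k\<in>UNIV. x k t0 * M k i) * cnj (y j t0) * B i j (\<Phi> t0 p)
        + x i t0 * (\<Sum>l\<in>UNIV. cnj (y l t0) * cnj (M l j)) * B i j (\<Phi> t0 p)
        + x i t0 * cnj (y j t0) * i_minus_conj E (\<Phi> t0 p) (B i j))) (at t0)"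
    proof (intro has_vector_derivative_sum)
      fix i j
      have "((\<lambda>s. x i s * cnj (y j s)) has_vector_derivative
          (x i t0 * (\<Sum>l\<in>UNIV. cnj (y l t0) * cnj (M l j)) + (\<Sum>k\<in>UNIV. x k t0 * M k i) * cnj (y j t0))) (at t0)"
        by (rule has_vector_derivative_mult[OF x' y'])
      from has_vector_derivative_mult[OF this B']
      show "((\<lambda>s. x i s * cnj (y j s) * B i j (\<Phi> s p)) has_vector_derivative
          ((\<Sum>k\<in>UNIV. x k t0 * M k i) * cnj (y j t0) * B i j (\<Phi> t0 p)
          + x i t0 * (\<Sum>l\<in>UNIV. cnj (y l t0) * cnj (M l j)) * B i j (\<Phi> t0 p)
          + x i t0 * cnj (y j t0) * i_minus_conj E (\<Phi> t0 p) (B i j))) (at t0)"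
        by (rule has_vector_derivative_eq_rhs) (simp add: distrib_right add_ac)
    qed
    \<comment> \<open>The invariance hypothesis \<open>inv\<close> in components: the brackets with
      coordinate fields contribute the matrix \<open>M\<close> with a minus sign, conjugated in the
      second argument.\<close>
    moreover have "i_minus_conj E (\<Phi> t0 p) (B k l) =
        (\<Sum>i\<in>UNIV. - M k i * B i l (\<Phi> t0 p)) + (\<Sum>j\<in>UNIV. - cnj (M l j) * B k j (\<Phi> t0 p))" for k l
    proof -
      note zs = pz_T10[OF U]
      have "i_minus_conj E (\<Phi> t0 p) (B k l) =
          b (\<Phi> t0 p) (bracket A (i_minus_conj E) (pz U \<phi> k) (\<Phi> t0 p)) (pz U \<phi> l (\<Phi> t0 p))
          + b (\<Phi> t0 p) (pz U \<phi> k (\<Phi> t0 p)) (bracket A (i_minus_conj E) (pz U \<phi> l) (\<Phi> t0 p))"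
        using inv[OF U] by (simp add: B_def[abs_def])
      then show ?thesis
        unfolding bracket_i_minus_conj_coord[OF E_hol U] sum_left[OF zs zs finite] sum_right[OF zs zs finite]
        by (simp add: M_def z_def B_def)
    qed
    ultimately have "(?\<gamma> has_vector_derivative 0) (at t0)"
      by (simp only: flow_sum_identity[where M = M and N = "\<lambda>l j. cnj (M l j)" and B = "\<lambda>i j. B i j (\<Phi> t0 p)"])
    then have "(\<beta> has_vector_derivative 0) (at t0)"
      by (rule has_vector_derivative_transform_within_open[OF _ I]) (rule \<beta>[symmetric])
    then show ?thesis by (simp add: has_vector_derivative_def)
  qed
  then have "\<beta> t = \<beta> 0"
    by (rule has_derivative_zero_unique_connected[OF J_open J_connected _ t J0])
  then show ?thesis
    using pf_0[OF p T10_CT[OF v]] pf_0[OF p T10_CT[OF w]] \<Phi>0[OF p] by (simp add: \<beta>_def)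
qed

end

lemma (in cmanifold) smooth_fun_linear_image:
  assumes lin: "\<And>q a b c. q \<in> W \<Longrightarrow> a \<in> T10 A q \<Longrightarrow> b \<in> T10 A q \<Longrightarrow> T q (a + b) = T q a + T q b \<and> T q (c *\<^sub>V a) = c * T q a"
    and hol: "\<And>V Y. V \<subseteq> W \<Longrightarrow> hol_vf A V Y \<Longrightarrow> smooth_fun A V (\<lambda>q. T q (Y q))"
    and Y: "smooth_vf A W Y"
  shows "smooth_fun A W (\<lambda>q. T q (Y q) :: complex)"
proof (rule smooth_fun_local)
  fix p assume p: "p \<in> W"
  obtain U \<phi> where U: "(U,\<phi>) \<in> A" "p \<in> U" using chart_ex by blast
  have o: "open (W \<inter> U)" using smooth_vf_open[OF Y] chart_open[OF U(1)] by auto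
  have z: "hol_vf A (W \<inter> U) (pz U \<phi> i)" for i by (rule hol_vf_subset[OF pz_hol_vf[OF U(1)] o]) auto
  have lin_sum: "T q (\<Sum>i\<in>I. c i *\<^sub>V F i) = (\<Sum>i\<in>I. c i * T q (F i))"
    if q: "q \<in> W" and I: "finite I" and F: "\<And>i. F i \<in> T10 A q" for q c F and I :: "'n set"
    using I
  proof (induction I rule: finite_induct)
    case empty
    have "T q (0 *\<^sub>V 0) = 0 * T q 0" using lin[OF q T10_zero T10_zero] by blast
    then show ?case by (simp only: smul_distribs sum.empty mult_zero_left)
  next
    case (insert i I)
    have "T q (c i *\<^sub>V F i + (\<Sum>i\<in>I. c i *\<^sub>V F i)) = T q (c i *\<^sub>V F i) + T q (\<Sum>i\<in>I. c i *\<^sub>V F i)"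
      by (rule lin[OF q T10_smul[OF F] T10_sum[OF T10_smul[OF F]], THEN conjunct1])
    also have "T q (c i *\<^sub>V F i) = c i * T q (F i)" using lin[OF q F F] by blast
    finally show ?case by (simp only: sum.insert[OF insert(1,2)] insert.IH)
  qed
  have "smooth_fun A (W \<inter> U) (\<lambda>q. \<Sum>i\<in>UNIV. Y q (\<lambda>r. \<phi> r $ i) * T q (pz U \<phi> i q))"
    by (rule smooth_fun_sum[OF o], rule smooth_fun_mult[OF smooth_cvf_coord[OF smooth_vf_cvf[OF Y] U(1)] hol[OF _ z]]) auto
  then have "smooth_fun A (W \<inter> U) (\<lambda>q. T q (Y q))"
  proof (rule smooth_fun_cong)
    fix q assume q: "q \<in> W \<inter> U"
    have "T q (\<Sum>i\<in>UNIV. Y q (\<lambda>r. \<phi> r $ i) *\<^sub>V pz U \<phi> i q) = (\<Sum>i\<in>UNIV. Y q (\<lambda>r. \<phi> r $ i) * T q (pz U \<phi> i q))"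
      by (rule lin_sum) (use q pz_T10[OF U(1)] in auto)
    moreover have "Y q = (\<Sum>i\<in>UNIV. Y q (\<lambda>r. \<phi> r $ i) *\<^sub>V pz U \<phi> i q)"
      by (rule T10_expand[OF smooth_vf_T10[OF Y] U(1)]) (use q in auto)
    ultimately show "(\<Sum>i\<in>UNIV. Y q (\<lambda>r. \<phi> r $ i) * T q (pz U \<phi> i q)) = T q (Y q)" by metis
  qed
  then show "\<exists>V. p \<in> V \<and> V \<subseteq> W \<and> smooth_fun A V (\<lambda>q. T q (Y q))"
    by (intro exI[of _ "W \<inter> U"]) (use p U in auto)
qed

text \<open>Charts at both ends turn the transport of (1,0)-vectors into a linear endomorphism of
  the same space \<open>complex^'n\<close>, where injectivity implies surjectivity. This gives
  onto-ness without inverting the flow map.\<close>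

lemma (in hol_flow) pf_surj:
  assumes t: "t \<in> J" and p: "p \<in> V" and x: "x \<in> T10 A (\<Phi> t p)"
    and inj: "\<And>v. v \<in> T10 A p \<Longrightarrow> pf t p v = 0 \<Longrightarrow> v = 0"
  shows "\<exists>v\<in>T10 A p. pf t p v = x"
proof -
  obtain U \<phi> where U: "(U,\<phi>) \<in> A" "p \<in> U" using chart_ex by blast
  obtain U' \<phi>' where U': "(U',\<phi>') \<in> A" "\<Phi> t p \<in> U'" using chart_ex by blast
  define vec :: "complex^'n \<Rightarrow> 'm cvec" where "vec c = (\<Sum>i\<in>UNIV. (c $ i) *\<^sub>V pz U \<phi> i p)" for c
  define crd :: "'m cvec \<Rightarrow> complex^'n" where "crd v = (\<chi> i. v (\<lambda>r. \<phi>' r $ i))" for v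
  have vec_T10: "vec c \<in> T10 A p" for c unfolding vec_def by (intro T10_sum T10_smul pz_T10[OF U])
  have vec_lin: "vec (a + b) = vec a + vec b" "vec (r *\<^sub>R a) = complex_of_real r *\<^sub>V vec a" for a b r
    by (auto simp: vec_def fun_eq_iff sum.distrib distrib_right sum_distrib_left mult_ac scaleR_conv_of_real[where 'a = complex])
  have lin: "linear (\<lambda>c. crd (pf t p (vec c)))"
    by (rule linearI) (simp_all add: vec_lin pf_linear crd_def vec_eq_iff scaleR_conv_of_real[where 'a = complex])
  have "inj (\<lambda>c. crd (pf t p (vec c)))"
    unfolding linear_injective_0[OF lin]
  proof (intro allI impI)
    fix c assume c: "crd (pf t p (vec c)) = 0"
    have "pf t p (vec c) = 0"
      by (rule T10_eqI[OF pf_T10[OF t p vec_T10] T10_zero U']) (use c in \<open>simp add: crd_def vec_eq_iff\<close>)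
    then have 0: "vec c = 0" by (rule inj[OF vec_T10])
    have "vec c (\<lambda>r. \<phi> r $ i) = c $ i" for i
      by (simp add: vec_def pz_coord[OF U] if_distrib cong: if_cong)
    then show "c = 0" using 0 by (simp add: vec_eq_iff)
  qed
  then have "surj (\<lambda>c. crd (pf t p (vec c)))"
    by (rule linear_inj_imp_surj[OF lin])
  then obtain c where c: "crd x = crd (pf t p (vec c))" by (rule surjE)
  have "pf t p (vec c) = x"
    by (rule T10_eqI[OF pf_T10[OF t p vec_T10] x U']) (use c in \<open>simp add: crd_def vec_eq_iff\<close>)
  then show ?thesis using vec_T10 by blast
qed

context cv_structure
begin

text \<open>Holomorphic arguments are replaced by smooth ones in one slot at a time, each time by
  linearity over the coordinate fields.\<close>

lemma g_smooth:
  assumes Y: "smooth_vf A W Y" and Z: "smooth_vf A W Z"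
  shows "smooth_fun A W (\<lambda>q. g q (Y q) (Z q))"
proof (rule smooth_fun_linear_image[OF _ _ Y, where T = "\<lambda>q a. g q a (Z q)"])
  fix V X assume V: "V \<subseteq> W" and X: "hol_vf A V X"
  note oV = hol_vf_open[OF X]
  show "smooth_fun A V (\<lambda>q. g q (X q) (Z q))"
  proof (rule smooth_fun_linear_image[OF _ _ smooth_vf_subset[OF Z oV V], where T = "\<lambda>q. g q (X q)"])
    fix V' X' assume V': "V' \<subseteq> V" and X': "hol_vf A V' X'"
    have "hol_fun A V' (\<lambda>q. g q (X q) (X' q))"
      using g_hol hol_vf_subset[OF X hol_vf_open[OF X'] V'] X' unfolding hol_metric_def by blast
    then show "smooth_fun A V' (\<lambda>q. g q (X q) (X' q))" by (rule hol_imp_smooth)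
  next
    fix q a b c assume "q \<in> V" "a \<in> T10 A q" "b \<in> T10 A q"
    then show "g q (X q) (a + b) = g q (X q) a + g q (X q) b \<and> g q (X q) (c *\<^sub>V a) = c * g q (X q) a"
      using hol_vf_T10[OF X] g_smul_left g_sym T10_smul by (metis g_add_right)
  qed
next
  fix q a b c assume "q \<in> W" "a \<in> T10 A q" "b \<in> T10 A q"
  then show "g q (a + b) (Z q) = g q a (Z q) + g q b (Z q) \<and> g q (c *\<^sub>V a) (Z q) = c * g q a (Z q)"
    using smooth_vf_T10[OF Z] g_add_left g_smul_left by blast
qed

lemma h_smooth:
  assumes Y: "smooth_vf A W Y" and Z: "smooth_vf A W Z"
  shows "smooth_fun A W (\<lambda>q. h q (Y q) (Z q))"
  by (rule smooth_fun_cong[OF g_smooth[OF Y \<kappa>_smooth[OF Z]]])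
     (simp add: h_g smooth_vf_T10[OF Y] smooth_vf_T10[OF Z])

end

section \<open>Invariance of h and \<Q> under the flow\<close>

context homogeneous_cv_structure
begin

text \<open>\<open>lie_E_h\<close> rearranged. In the second argument the factor \<i> comes out as -
  \<i>, which matches the exchange of \<open>E\<close> and \<open>conjf E\<close> in the Leibniz
  rule for \<open>h\<close>.\<close>

lemma lie_real_E_h:
  assumes Y: "smooth_vf A W Y" and Z: "smooth_vf A W Z" and p: "p \<in> W"
  shows "i_minus_conj E p (\<lambda>q. h q (Y q) (Z q)) =
    h p (bracket A (i_minus_conj E) Y p) (Z p) + h p (Y p) (bracket A (i_minus_conj E) Z p)"
proof -
  note EW = E_hol[OF smooth_vf_open[OF Y]]
  note Es = hol_imp_smooth_vf[OF EW]
  note T = smooth_vf_T10[OF Y p] smooth_vf_T10[OF Z p] bracket_T10[OF Es Y p] bracket_T10[OF Es Z p]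
    bracket_conjf_T10[OF EW Y p] bracket_conjf_T10[OF EW Z p]
  have eq: "E p (\<lambda>q. h q (Y q) (Z q)) - conjf E p (\<lambda>q. h q (Y q) (Z q)) =
      h p (bracket A E Y p) (Z p) + h p (Y p) (bracket A (conjf E) Z p)
      - h p (bracket A (conjf E) Y p) (Z p) - h p (Y p) (bracket A E Z p)"
    using lie_E_h[OF Y Z p] unfolding deriv_form_def by (simp add: algebra_simps)
  show ?thesis
    unfolding i_minus_conj_apply eq bracket_i_minus_conj[OF EW Y p] bracket_i_minus_conj[OF EW Z p]
    by (simp add: h_smul_left h_smul_right h_diff_left h_diff_right T10_minus T algebra_simps)
qed

text \<open>The Lie derivatives of \<Q> along \<open>E\<close> and along \<open>conjf E\<close> are
  the same endomorphism, so they cancel in the difference.\<close>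

lemma lie_real_E_Q:
  assumes Y: "smooth_vf A W Y" and p: "p \<in> W"
  shows "bracket A (i_minus_conj E) (\<lambda>q. \<Q> q (Y q)) p = \<Q> p (bracket A (i_minus_conj E) Y p)"
proof -
  note EW = E_hol[OF smooth_vf_open[OF Y]]
  note T = bracket_T10[OF hol_imp_smooth_vf[OF EW] Y p] bracket_conjf_T10[OF EW Y p]
  have "deriv_endo (bracket A E) \<Q> Y p = deriv_endo (bracket A (conjf E)) \<Q> Y p"
    using E_derivatives_Q(1,2)[OF Y p] by simp
  then have "bracket A E (\<lambda>q. \<Q> q (Y q)) p - bracket A (conjf E) (\<lambda>q. \<Q> q (Y q)) p =
      \<Q> p (bracket A E Y p) - \<Q> p (bracket A (conjf E) Y p)"
    unfolding deriv_endo_def by (simp add: algebra_simps)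
  then show ?thesis
    unfolding bracket_i_minus_conj[OF EW Y p] bracket_i_minus_conj[OF EW Q_smooth[OF Y] p]
    by (simp add: Q_smul Q_diff T10_minus T)
qed

text \<open>\<open>form_invariant\<close> is applied to two sesquilinear forms, \<open>h\<close> and
  \<open>h\<close> with \<Q> in its first argument; the infinitesimal invariance of the second
  combines that of \<open>h\<close> with the commutation of \<Q> and the bracket.\<close>

lemma flow_h:
  assumes lf: "local_flow A (i_minus_conj E) J V \<Phi>" and t: "t \<in> J" and p: "p \<in> V"
    and v: "v \<in> T10 A p" and w: "w \<in> T10 A p"
  shows "pushforward A (\<Phi> t) p v \<in> T10 A (\<Phi> t p)"
    "h (\<Phi> t p) (pushforward A (\<Phi> t) p v) (pushforward A (\<Phi> t) p w) = h p v w"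
    "h (\<Phi> t p) (\<Q> (\<Phi> t p) (pushforward A (\<Phi> t) p v)) (pushforward A (\<Phi> t) p w) = h p (\<Q> p v) w"
proof -
  interpret hol_flow A E J V \<Phi> by unfold_locales (rule E(1), rule lf)
  show "pushforward A (\<Phi> t) p v \<in> T10 A (\<Phi> t p)" by (rule pf_T10[OF t p v])
  show "h (\<Phi> t p) (pushforward A (\<Phi> t) p v) (pushforward A (\<Phi> t) p w) = h p v w"
  proof (rule form_invariant[where b = h, OF _ _ _ t p v w])
    fix q x y z c assume "x \<in> T10 A q" "y \<in> T10 A q" "z \<in> T10 A q"
    then show "h q (x + y) z = h q x z + h q y z \<and> h q (c *\<^sub>V x) z = c * h q x z \<and>
        h q z (x + y) = h q z x + h q z y \<and> h q z (c *\<^sub>V x) = cnj c * h q z x"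
      by (intro conjI h_add_left h_smul_left h_add_right h_smul_right)
  next
    fix U \<phi> i j assume U: "(U,\<phi>) \<in> A"
    show "smooth_fun A U (\<lambda>q. h q (pz U \<phi> i q) (pz U \<phi> j q))"
      by (rule h_smooth[OF pz_smooth_vf[OF U] pz_smooth_vf[OF U]])
    fix q assume q: "q \<in> U"
    show "i_minus_conj E q (\<lambda>r. h r (pz U \<phi> i r) (pz U \<phi> j r)) =
      h q (bracket A (i_minus_conj E) (pz U \<phi> i) q) (pz U \<phi> j q) + h q (pz U \<phi> i q) (bracket A (i_minus_conj E) (pz U \<phi> j) q)"
      by (rule lie_real_E_h[OF pz_smooth_vf[OF U] pz_smooth_vf[OF U] q])
  qed
  show "h (\<Phi> t p) (\<Q> (\<Phi> t p) (pushforward A (\<Phi> t) p v)) (pushforward A (\<Phi> t) p w) = h p (\<Q> p v) w"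
  proof (rule form_invariant[where b = "\<lambda>q a b. h q (\<Q> q a) b", OF _ _ _ t p v w])
    fix q x y z c assume "x \<in> T10 A q" "y \<in> T10 A q" "z \<in> T10 A q"
    then show "h q (\<Q> q (x + y)) z = h q (\<Q> q x) z + h q (\<Q> q y) z \<and> h q (\<Q> q (c *\<^sub>V x)) z = c * h q (\<Q> q x) z \<and>
        h q (\<Q> q z) (x + y) = h q (\<Q> q z) x + h q (\<Q> q z) y \<and> h q (\<Q> q z) (c *\<^sub>V x) = cnj c * h q (\<Q> q z) x"
      by (simp only: Q_add Q_smul Q_T10 h_add_left h_smul_left h_add_right h_smul_right simp_thms)
  next
    fix U \<phi> i j assume U: "(U,\<phi>) \<in> A"
    note z = pz_smooth_vf[OF U]
    show "smooth_fun A U (\<lambda>q. h q (\<Q> q (pz U \<phi> i q)) (pz U \<phi> j q))" by (rule h_smooth[OF Q_smooth[OF z] z])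
    fix q assume q: "q \<in> U"
    show "i_minus_conj E q (\<lambda>r. h r (\<Q> r (pz U \<phi> i r)) (pz U \<phi> j r)) =
      h q (\<Q> q (bracket A (i_minus_conj E) (pz U \<phi> i) q)) (pz U \<phi> j q)
      + h q (\<Q> q (pz U \<phi> i q)) (bracket A (i_minus_conj E) (pz U \<phi> j) q)"
      using lie_real_E_h[OF Q_smooth[OF z] z q] unfolding lie_real_E_Q[OF z q] .
  qed
qed

text \<open>A transport that preserves the nondegenerate \<open>h\<close> is injective, hence onto.
  So the two vectors may be compared by pairing with transported vectors only, where
  \<open>flow_h\<close> evaluates both sides to h(\<Q>v,w) at the starting point.\<close>

lemma flow_Q:
  assumes lf: "local_flow A (i_minus_conj E) J V \<Phi>" and t: "t \<in> J" and p: "p \<in> V" and v: "v \<in> T10 A p"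
  shows "\<Q> (\<Phi> t p) (pushforward A (\<Phi> t) p v) = pushforward A (\<Phi> t) p (\<Q> p v)"
proof -
  interpret hol_flow A E J V \<Phi> by unfold_locales (rule E(1), rule lf)
  have inj: "a = 0" if a: "a \<in> T10 A p" and a0: "pf t p a = 0" for a
  proof (rule h_eqI[OF a T10_zero])
    fix b assume b: "b \<in> T10 A p"
    have "h p a b = h (\<Phi> t p) 0 (pf t p b)" using flow_h(2)[OF lf t p a b] a0 by simp
    also have "\<dots> = 0" by (rule h_zero_left[OF pf_T10[OF t p b]])
    finally show "h p a b = h p 0 b" by (simp add: h_zero_left[OF b])
  qed
  show ?thesis
  proof (rule h_eqI[OF Q_T10[OF pf_T10[OF t p v]] pf_T10[OF t p Q_T10[OF v]]])
    fix x assume "x \<in> T10 A (\<Phi> t p)"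
    then obtain w where w: "w \<in> T10 A p" "pf t p w = x" using pf_surj[OF t p _ inj] by blast
    show "h (\<Phi> t p) (\<Q> (\<Phi> t p) (pf t p v)) x = h (\<Phi> t p) (pf t p (\<Q> p v)) x"
      unfolding w(2)[symmetric] flow_h(3)[OF lf t p v w(1)] flow_h(2)[OF lf t p Q_T10[OF v] w(1)] ..
  qed
qed

end

theorem theorem3p10:
  fixes A :: "('m::{t2_space,second_countable_topology}, 'n::finite) atlas"
    and C m :: "'m \<Rightarrow> 'm cvec \<Rightarrow> 'm cvec \<Rightarrow> 'm cvec"
    and \<U> \<kappa> \<Q> :: "'m \<Rightarrow> 'm cvec \<Rightarrow> 'm cvec"
    and g h :: "'m \<Rightarrow> 'm cvec \<Rightarrow> 'm cvec \<Rightarrow> complex"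
    and D :: "'m conn"
    and e E :: "'m cfield"
  assumes CV: "CV_structure A C \<U> g \<kappa> h D \<Q>"
    and unf: "unfolding_condition A C"
    and mult_unf: "\<And>p x y z. x \<in> T10 A p \<Longrightarrow> y \<in> T10 A p \<Longrightarrow> z \<in> T10 A p \<Longrightarrow>
           m p x y \<in> T10 A p \<and> C p (m p x y) z = - C p x (C p y z)"
    and mult_C: "\<And>p x y. x \<in> T10 A p \<Longrightarrow> y \<in> T10 A p \<Longrightarrow> C p x y = - m p x y"
    and e: "hol_vf A UNIV e" "\<And>p x. x \<in> T10 A p \<Longrightarrow> C p (e p) x = - x"
    and E: "hol_vf A UNIV E" "\<And>p x. x \<in> T10 A p \<Longrightarrow> C p (E p) x = - \<U> p x"
  shows "
    \<comment> \<open>(a)\<close>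
    (F_manifold A m e \<and> Euler_field A m E) \<and>
    \<comment> \<open>(b)\<close>
    (\<forall>W Y. \<forall>p\<in>W. smooth_vf A W Y \<longrightarrow>
        \<Q> p (Y p) = skew_part A g (\<lambda>Z q. cov D E Z q - bracket A E Z q) Y p) \<and>
    (\<forall>W Y. \<forall>p\<in>W. smooth_vf A W Y \<longrightarrow>
        deriv_endo (bracket A (conjf e)) \<Q> Y p = 0 \<and>
        deriv_endo (cov D (conjf e)) \<Q> Y p = 0 \<and>
        deriv_endo (cov D e) \<Q> Y p = 0) \<and>
    \<comment> \<open>(c)\<close>
    (let S1 = agree_on_tensors A e (covC A D e) (bracket A e);
         S2 = (\<forall>p. cov D e e p = 0);
         S3 = (\<forall>W Y Z. \<forall>p\<in>W. smooth_vf A W Y \<and> smooth_vf A W Z \<longrightarrow>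
                 deriv_form e (bracket A e) (bracket A (conjf e)) h Y Z p = 0);
         S4 = (\<forall>W Y Z. \<forall>p\<in>W. smooth_vf A W Y \<and> smooth_vf A W Z \<longrightarrow>
                 deriv_form (conjf e) (bracket A (conjf e)) (bracket A e) h Y Z p = 0);
         S5 = (\<forall>W Y. \<forall>p\<in>W. smooth_vf A W Y \<longrightarrow>
                 deriv_anti (bracket A e) (bracket A (conjf e)) \<kappa> Y p = 0);
         S6 = (\<forall>W Y. \<forall>p\<in>W. smooth_vf A W Y \<longrightarrow>
                 deriv_anti (bracket A (conjf e)) (bracket A e) \<kappa> Y p = 0);
         S7 = (\<forall>W Y Z. \<forall>p\<in>W. smooth_vf A W Y \<and> smooth_vf A W Z \<longrightarrow>
                 deriv_form e (bracket A e) (bracket A e) g Y Z p = 0)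
     in (S1 \<longleftrightarrow> S2) \<and> (S2 \<longleftrightarrow> S3) \<and> (S3 \<longleftrightarrow> S4) \<and> (S4 \<longleftrightarrow> S5) \<and> (S5 \<longleftrightarrow> S6) \<and> (S6 \<longleftrightarrow> S7) \<and>
        (S1 \<longrightarrow> (\<forall>W Y. \<forall>p\<in>W. smooth_vf A W Y \<longrightarrow> deriv_endo (bracket A e) \<Q> Y p = 0))) \<and>
    \<comment> \<open>(d)\<close>
    (\<forall>d::real.
       (\<forall>W Y Z. \<forall>p\<in>W. smooth_vf A W Y \<and> smooth_vf A W Z \<longrightarrow>
          deriv_form E (bracket A E) (bracket A E) g Y Z p = complex_of_real (2 - d) * g p (Y p) (Z p)) \<longrightarrow>
       (\<forall>W Y. \<forall>p\<in>W. smooth_vf A W Y \<longrightarrow>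
          \<Q> p (Y p) = cov D E Y p - bracket A E Y p - complex_of_real ((2 - d) / 2) *\<^sub>V Y p) \<and>
       (\<forall>W Y Z. \<forall>p\<in>W. smooth_vf A W Y \<and> smooth_vf A W Z \<longrightarrow>
          deriv_form E (bracket A E) (bracket A (conjf E)) h Y Z p
            - deriv_form (conjf E) (bracket A (conjf E)) (bracket A E) h Y Z p = 0) \<and>
       (\<forall>W Y. \<forall>p\<in>W. smooth_vf A W Y \<longrightarrow>
          (let R = \<U> p (\<kappa> p (\<U> p (\<kappa> p (Y p)))) - \<kappa> p (\<U> p (\<kappa> p (\<U> p (Y p)))) in
           deriv_endo (bracket A E) \<Q> Y p = R \<and>
           deriv_endo (bracket A (conjf E)) \<Q> Y p = R \<and>
           deriv_endo (cov D E) \<Q> Y p = R \<and>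
           deriv_endo (cov D (conjf E)) \<Q> Y p = R)) \<and>
       flow_invariant_form A (\<lambda>p. \<i> *\<^sub>V (E p - conjf E p)) h \<and>
       flow_invariant_endo A (\<lambda>p. \<i> *\<^sub>V (E p - conjf E p)) \<Q>)"
proof -
  interpret cv_structure A C m \<U> \<kappa> \<Q> g h D e E
    by unfold_locales (rule CV unf e(1) E(1) | (rule mult_unf mult_C e(2) E(2), assumption+))+
  \<comment> \<open>Every condition in (c) is rewritten to this one statement about
    \<open>ne\<close>, after which the equivalences are reflexive.\<close>
  have flat: "(\<forall>p. cov D e e p = 0) \<longleftrightarrow> (\<forall>p. ne p = 0)" by (simp add: cov_def ne_def)
  have part_d: "(\<forall>W Y. \<forall>p\<in>W. smooth_vf A W Y \<longrightarrow>
          \<Q> p (Y p) = cov D E Y p - bracket A E Y p - complex_of_real ((2 - d) / 2) *\<^sub>V Y p) \<and>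
       (\<forall>W Y Z. \<forall>p\<in>W. smooth_vf A W Y \<and> smooth_vf A W Z \<longrightarrow>
          deriv_form E (bracket A E) (bracket A (conjf E)) h Y Z p
            - deriv_form (conjf E) (bracket A (conjf E)) (bracket A E) h Y Z p = 0) \<and>
       (\<forall>W Y. \<forall>p\<in>W. smooth_vf A W Y \<longrightarrow>
          (let R = \<U> p (\<kappa> p (\<U> p (\<kappa> p (Y p)))) - \<kappa> p (\<U> p (\<kappa> p (\<U> p (Y p)))) in
           deriv_endo (bracket A E) \<Q> Y p = R \<and>
           deriv_endo (bracket A (conjf E)) \<Q> Y p = R \<and>
           deriv_endo (cov D E) \<Q> Y p = R \<and>
           deriv_endo (cov D (conjf E)) \<Q> Y p = R)) \<and>
       flow_invariant_form A (\<lambda>p. \<i> *\<^sub>V (E p - conjf E p)) h \<and>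
       flow_invariant_endo A (\<lambda>p. \<i> *\<^sub>V (E p - conjf E p)) \<Q>"
    if lg: "\<forall>W Y Z. \<forall>p\<in>W. smooth_vf A W Y \<and> smooth_vf A W Z \<longrightarrow>
          deriv_form E (bracket A E) (bracket A E) g Y Z p = complex_of_real (2 - d) * g p (Y p) (Z p)"
    for d :: real
  proof -
    define c where "c = complex_of_real ((2 - d) / 2)"
    have rc: "cnj c = c" and c2: "complex_of_real (2 - d) = 2 * c" by (simp_all add: c_def)
    have lg': "deriv_form E (bracket A E) (bracket A E) g Y Z p = 2 * c * g p (Y p) (Z p)"
      if "p \<in> W" "smooth_vf A W Y" "smooth_vf A W Z" for W Y Z p
      using lg[rule_format, OF that(1) conjI[OF that(2,3)]] unfolding c2 .
    interpret homogeneous_cv_structure A C m \<U> \<kappa> \<Q> g h D e E c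
      by unfold_locales (rule rc, rule lg')
    have pres: "flow_preserves_T10 A (i_minus_conj E)"
      unfolding flow_preserves_T10_def using flow_h(1) by blast
    have inv_h: "flow_invariant_form A (i_minus_conj E) h"
      unfolding flow_invariant_form_def using pres flow_h(2) by blast
    have inv_Q: "flow_invariant_endo A (i_minus_conj E) \<Q>"
      unfolding flow_invariant_endo_def using pres flow_Q by blast
    show ?thesis
      unfolding c_def[symmetric] Let_def UU_def[symmetric]
    proof (intro conjI allI ballI impI; (elim conjE)?)
      fix W Y p assume Y: "smooth_vf A W Y" "p \<in> W"
      show "\<Q> p (Y p) = cov D E Y p - bracket A E Y p - c *\<^sub>V Y p"
        using lie_E_homogeneous[OF Y] by (simp add: cov_def)
      show "deriv_endo (bracket A E) \<Q> Y p = UU p (Y p)" "deriv_endo (bracket A (conjf E)) \<Q> Y p = UU p (Y p)"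
        "deriv_endo (cov D E) \<Q> Y p = UU p (Y p)" "deriv_endo (cov D (conjf E)) \<Q> Y p = UU p (Y p)"
        by (rule E_derivatives_Q[OF Y])+
    qed (rule lie_E_h inv_h[unfolded i_minus_conj_def] inv_Q[unfolded i_minus_conj_def]; assumption)+
  qed
  show ?thesis
    unfolding Let_def flat flat_unit_iff
  proof (intro conjI)
    show "F_manifold A m e" "Euler_field A m E" by (rule F_manifold, rule Euler_field)
    show "\<forall>W Y. \<forall>p\<in>W. smooth_vf A W Y \<longrightarrow> \<Q> p (Y p) = skew_part A g (\<lambda>Z q. cov D E Z q - bracket A E Z q) Y p"
      using Q_skew_part by blast
    show "\<forall>W Y. \<forall>p\<in>W. smooth_vf A W Y \<longrightarrow> deriv_endo (bracket A (conjf e)) \<Q> Y p = 0 \<and>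
        deriv_endo (cov D (conjf e)) \<Q> Y p = 0 \<and> deriv_endo (cov D e) \<Q> Y p = 0"
      using e_derivatives_Q by blast
    show "(\<forall>p. ne p = 0) \<longrightarrow> (\<forall>W Y. \<forall>p\<in>W. smooth_vf A W Y \<longrightarrow> deriv_endo (bracket A e) \<Q> Y p = 0)"
      using lie_e_Q by blast
  qed (rule refl | (rule allI, rule impI, rule part_d[unfolded Let_def], assumption))+
qed

end
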